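(* Let $1\le p,q\le\infty$. If $p>2$ or $q<2$, then the pair $(L_p[0,1], L_q[0,1])$ does not satisfy the WMP.
   Context: $L_p[0,1]$ is the usual Lebesgue space with its standard norm, over $\mathbb{K} = \mathbb{R}$ or $\mathbb{C}$. A bounded linear operator $T:E\to F$ attains its norm if there is $x_0$ in the unit sphere $S_E$ with $\|T(x_0)\|=\|T\|$. A maximizing sequence for $T$ is a sequence $(x_n)\subset S_E$ with $\|T(x_n)\|\to\|T\|$. A pair $(E,F)$ of Banach spaces has the weak maximizing property (WMP) if every bounded linear operator $T:E\to F$ that admits a non-weakly null maximizing sequence (i.e. one not converging weakly to $0$) attains its norm. *)

theory Defs
  imports "HOL-Analysis.Analysis" "HOL-Probability.Essential_Supremum"
begin

section \<open>Normed spaces on a carrier set\<close>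

text \<open>The exponent of an $L_p$ space is a term, so $L_p$ cannot be a type of class
  \<open>banach\<close>. Normed spaces are therefore records, whose first type parameter is the scalar field;
  this also makes ``linear'' mean complex-linear when the scalars are complex.\<close>

record ('k, 'a) nspace =
  elems :: "'a set"
  vadd :: "'a \<Rightarrow> 'a \<Rightarrow> 'a"
  vscale :: "'k \<Rightarrow> 'a \<Rightarrow> 'a"
  vnorm :: "'a \<Rightarrow> real"

definition scalar_field :: "('k::real_normed_field, 'k) nspace" where
  "scalar_field = \<lparr>elems = UNIV, vadd = (+), vscale = (*), vnorm = norm\<rparr>"

definition unit_sphere :: "('k, 'a) nspace \<Rightarrow> 'a set" where
  "unit_sphere E = {x \<in> elems E. vnorm E x = 1}"

text \<open>Values of \<open>T\<close> outside \<open>elems E\<close> are irrelevant.\<close>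

definition bounded_op :: "('k, 'a) nspace \<Rightarrow> ('k, 'b) nspace \<Rightarrow> ('a \<Rightarrow> 'b) \<Rightarrow> bool" where
  "bounded_op E F T \<longleftrightarrow>
     T \<in> elems E \<rightarrow> elems F \<and>
     (\<forall>x\<in>elems E. \<forall>y\<in>elems E. T (vadd E x y) = vadd F (T x) (T y)) \<and>
     (\<forall>c. \<forall>x\<in>elems E. T (vscale E c x) = vscale F c (T x)) \<and>
     (\<exists>C. \<forall>x\<in>elems E. vnorm F (T x) \<le> C * vnorm E x)"

definition op_norm :: "('k, 'a) nspace \<Rightarrow> ('k, 'b) nspace \<Rightarrow> ('a \<Rightarrow> 'b) \<Rightarrow> real" where
  "op_norm E F T = (SUP x\<in>{x \<in> elems E. vnorm E x \<le> 1}. vnorm F (T x))"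

definition attains_norm :: "('k, 'a) nspace \<Rightarrow> ('k, 'b) nspace \<Rightarrow> ('a \<Rightarrow> 'b) \<Rightarrow> bool" where
  "attains_norm E F T \<longleftrightarrow> (\<exists>x\<in>unit_sphere E. vnorm F (T x) = op_norm E F T)"

definition maximizing_seq ::
    "('k, 'a) nspace \<Rightarrow> ('k, 'b) nspace \<Rightarrow> ('a \<Rightarrow> 'b) \<Rightarrow> (nat \<Rightarrow> 'a) \<Rightarrow> bool" where
  "maximizing_seq E F T x \<longleftrightarrow>
     range x \<subseteq> unit_sphere E \<and> (\<lambda>n. vnorm F (T (x n))) \<longlonglongrightarrow> op_norm E F T"

definition weakly_null :: "('k::real_normed_field, 'a) nspace \<Rightarrow> (nat \<Rightarrow> 'a) \<Rightarrow> bool" where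
  "weakly_null E x \<longleftrightarrow> (\<forall>\<phi>. bounded_op E scalar_field \<phi> \<longrightarrow> (\<lambda>n. \<phi> (x n)) \<longlonglongrightarrow> 0)"

definition WMP :: "('k::real_normed_field, 'a) nspace \<Rightarrow> ('k, 'b) nspace \<Rightarrow> bool" where
  "WMP E F \<longleftrightarrow>
     (\<forall>T. bounded_op E F T \<and> (\<exists>x. maximizing_seq E F T x \<and> \<not> weakly_null E x)
          \<longrightarrow> attains_norm E F T)"


section \<open>Lebesgue spaces\<close>

text \<open>Exponents are extended nonnegative reals, with \<open>p = \<infinity>\<close> giving the essentially
  bounded functions. Only exponents \<open>p \<ge> 1\<close> are meaningful below.\<close>

definition Lp_fun ::
    "ennreal \<Rightarrow> 'a measure \<Rightarrow> ('a \<Rightarrow> 'k::{real_normed_field, second_countable_topology}) set" where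
  "Lp_fun p M = {f \<in> borel_measurable M.
     if p = \<infinity> then esssup M (\<lambda>x. ereal (norm (f x))) < \<infinity>
     else integrable M (\<lambda>x. norm (f x) powr enn2real p)}"

definition Lp_norm ::
    "ennreal \<Rightarrow> 'a measure \<Rightarrow> ('a \<Rightarrow> 'k::{real_normed_field, second_countable_topology}) \<Rightarrow> real" where
  "Lp_norm p M f =
     (if p = \<infinity> then real_of_ereal (esssup M (\<lambda>x. ereal (norm (f x))))
      else (LINT x|M. norm (f x) powr enn2real p) powr (1 / enn2real p))"

definition Lp_rel ::
    "ennreal \<Rightarrow> 'a measure \<Rightarrow> ('a \<Rightarrow> 'k::{real_normed_field, second_countable_topology}) rel" where
  "Lp_rel p M = {(f, g). f \<in> Lp_fun p M \<and> g \<in> Lp_fun p M \<and> (AE x in M. f x = g x)}"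

text \<open>Operations on equivalence classes use the union idiom of \<open>Equiv_Relations\<close>: the union of a
  family of classes that does not depend on the representatives is their common value. The lemmas
  below show independence and compute the operations on the class of a function.\<close>

definition Lp_space ::
    "ennreal \<Rightarrow> 'a measure
      \<Rightarrow> ('k::{real_normed_field, second_countable_topology}, ('a \<Rightarrow> 'k) set) nspace" where
  "Lp_space p M =
     \<lparr>elems = Lp_fun p M // Lp_rel p M,
      vadd = (\<lambda>A B. \<Union>f\<in>A. \<Union>g\<in>B. Lp_rel p M `` {\<lambda>x. f x + g x}),
      vscale = (\<lambda>c A. \<Union>f\<in>A. Lp_rel p M `` {\<lambda>x. c * f x}),
      vnorm = (\<lambda>A. the_elem (Lp_norm p M ` A))\<rparr>"

abbreviation Lp_unit_interval ::
    "ennreal \<Rightarrow> ('k::{real_normed_field, second_countable_topology}, (real \<Rightarrow> 'k) set) nspace" where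
  "Lp_unit_interval p \<equiv> Lp_space p (lebesgue_on {0..1})"


lemma equiv_Lp_rel: "equiv (Lp_fun p M) (Lp_rel p M)"
proof (rule equivI)
  show "Lp_rel p M \<subseteq> Lp_fun p M \<times> Lp_fun p M"
    by (auto simp: Lp_rel_def)
  show "refl_on (Lp_fun p M) (Lp_rel p M)"
    by (auto simp: Lp_rel_def refl_on_def)
  show "sym (Lp_rel p M)"
    by (simp add: Lp_rel_def sym_def eq_commute)
  show "trans (Lp_rel p M)"
  proof (rule transI)
    fix f g h assume "(f, g) \<in> Lp_rel p M" "(g, h) \<in> Lp_rel p M"
    moreover from this have "AE x in M. f x = g x" "AE x in M. g x = h x"
      by (simp_all add: Lp_rel_def)
    then have "AE x in M. f x = h x"
      by eventually_elim simp
    ultimately show "(f, h) \<in> Lp_rel p M"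
      by (simp add: Lp_rel_def)
  qed
qed

lemma Lp_fun_measurable: "f \<in> Lp_fun p M \<Longrightarrow> f \<in> borel_measurable M"
  by (simp add: Lp_fun_def)

lemma Lp_fun_add:
  assumes f: "f \<in> Lp_fun p M" and g: "g \<in> Lp_fun p M"
  shows "(\<lambda>x. f x + g x) \<in> Lp_fun p M"
proof -
  have [measurable]: "f \<in> borel_measurable M" "g \<in> borel_measurable M"
    using f g by (auto dest: Lp_fun_measurable)
  show ?thesis
  proof (cases "p = \<infinity>")
    case True
    have "esssup M (\<lambda>x. ereal (norm (f x + g x)))
        \<le> esssup M (\<lambda>x. ereal (norm (f x)) + ereal (norm (g x)))"
      by (rule esssup_mono) (auto simp: norm_triangle_ineq)
    also have "\<dots> \<le> esssup M (\<lambda>x. ereal (norm (f x))) + esssup M (\<lambda>x. ereal (norm (g x)))"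
      by (rule esssup_add)
    also have "\<dots> < \<infinity>"
      using f g True by (auto simp: Lp_fun_def)
    finally show ?thesis using True by (simp add: Lp_fun_def)
  next
    case False
    define r where "r = enn2real p"
    have r: "r \<ge> 0" by (simp add: r_def)
    have "integrable M (\<lambda>x. norm (f x) powr r)" "integrable M (\<lambda>x. norm (g x) powr r)"
      using f g False by (auto simp: Lp_fun_def r_def)
    then have int: "integrable M (\<lambda>x. 2 powr r * (norm (f x) powr r + norm (g x) powr r))"
      by simp
    have le: "norm (a + b) powr r \<le> 2 powr r * (norm a powr r + norm b powr r)" for a b :: 'b
    proof -
      have "norm (a + b) \<le> 2 * max (norm a) (norm b)"
        using norm_triangle_ineq[of a b] by linarith
      then have "norm (a + b) powr r \<le> (2 * max (norm a) (norm b)) powr r"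
        using r by (intro powr_mono2) auto
      also have "\<dots> = 2 powr r * max (norm a) (norm b) powr r"
        by (rule powr_mult)
      also have "\<dots> \<le> 2 powr r * (norm a powr r + norm b powr r)"
        by (intro mult_left_mono) (auto simp: max_def)
      finally show ?thesis .
    qed
    have "integrable M (\<lambda>x. norm (f x + g x) powr r)"
      by (rule Bochner_Integration.integrable_bound[OF int]) (use le in auto)
    then show ?thesis using False by (simp add: Lp_fun_def r_def)
  qed
qed

lemma Lp_fun_scale:
  assumes f: "f \<in> Lp_fun p M"
  shows "(\<lambda>x. c * f x) \<in> Lp_fun p M"
proof -
  have [measurable]: "f \<in> borel_measurable M"
    using f by (auto dest: Lp_fun_measurable)
  show ?thesis
  proof (cases "p = \<infinity>")
    case True
    define d where "d = norm c + 1"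
    have "d > 0" by (simp add: d_def add_nonneg_pos)
    have "esssup M (\<lambda>x. ereal (norm (c * f x))) \<le> esssup M (\<lambda>x. ereal d * ereal (norm (f x)))"
      by (rule esssup_mono) (auto simp: norm_mult d_def intro!: mult_right_mono)
    also have "\<dots> = ereal d * esssup M (\<lambda>x. ereal (norm (f x)))"
      by (rule esssup_cmult) fact
    also have "\<dots> < \<infinity>"
      using f True \<open>d > 0\<close>
      by (cases "esssup M (\<lambda>x. ereal (norm (f x)))") (auto simp: Lp_fun_def)
    finally show ?thesis using True by (simp add: Lp_fun_def)
  next
    case False
    then show ?thesis using f by (simp add: Lp_fun_def norm_mult powr_mult)
  qed
qed

lemma Lp_norm_cong_AE:
  assumes "f \<in> borel_measurable M" "g \<in> borel_measurable M" "AE x in M. f x = g x"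
  shows "Lp_norm p M f = Lp_norm p M g"
proof -
  have [measurable]: "f \<in> borel_measurable M" "g \<in> borel_measurable M"
    using assms by auto
  have "esssup M (\<lambda>x. ereal (norm (f x))) = esssup M (\<lambda>x. ereal (norm (g x)))"
    by (rule esssup_AE_cong) (use assms(3) in auto)
  moreover have "(LINT x|M. norm (f x) powr r) = (LINT x|M. norm (g x) powr r)" for r
    by (rule integral_cong_AE) (use assms(3) in auto)
  ultimately show ?thesis by (simp add: Lp_norm_def)
qed

lemma elems_Lp_space: "elems (Lp_space p M) = (\<lambda>f. Lp_rel p M `` {f}) ` Lp_fun p M"
  by (auto simp: Lp_space_def quotient_def)

lemma Lp_class_eq_iff:
  assumes "f \<in> Lp_fun p M" "g \<in> Lp_fun p M"
  shows "Lp_rel p M `` {f} = Lp_rel p M `` {g} \<longleftrightarrow> (AE x in M. f x = g x)"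
  using eq_equiv_class_iff[OF equiv_Lp_rel assms] assms by (simp add: Lp_rel_def)

lemma vadd_Lp_space:
  assumes f: "f \<in> Lp_fun p M" and g: "g \<in> Lp_fun p M"
  shows "vadd (Lp_space p M) (Lp_rel p M `` {f}) (Lp_rel p M `` {g}) = Lp_rel p M `` {\<lambda>x. f x + g x}"
proof -
  have "congruent2 (Lp_rel p M) (Lp_rel p M) (\<lambda>f g. Lp_rel p M `` {\<lambda>x. f x + g x})"
    by (intro congruent2I' equiv_class_eq[OF equiv_Lp_rel])
      (auto simp: Lp_rel_def intro!: Lp_fun_add elim: eventually_elim2)
  from UN_equiv_class2[OF equiv_Lp_rel equiv_Lp_rel this f g] show ?thesis
    by (simp add: Lp_space_def)
qed

lemma vscale_Lp_space:
  assumes f: "f \<in> Lp_fun p M"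
  shows "vscale (Lp_space p M) c (Lp_rel p M `` {f}) = Lp_rel p M `` {\<lambda>x. c * f x}"
proof -
  have "(\<lambda>f. Lp_rel p M `` {\<lambda>x. c * f x}) respects Lp_rel p M"
    by (intro congruentI equiv_class_eq[OF equiv_Lp_rel])
      (auto simp: Lp_rel_def intro!: Lp_fun_scale elim: eventually_mono)
  from UN_equiv_class[OF equiv_Lp_rel this f] show ?thesis
    by (simp add: Lp_space_def)
qed

lemma vnorm_Lp_space:
  assumes f: "f \<in> Lp_fun p M"
  shows "vnorm (Lp_space p M) (Lp_rel p M `` {f}) = Lp_norm p M f"
proof -
  have "Lp_norm p M g = Lp_norm p M f" if "g \<in> Lp_rel p M `` {f}" for g
    using that by (intro Lp_norm_cong_AE) (auto simp: Lp_rel_def Lp_fun_def)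
  moreover have "f \<in> Lp_rel p M `` {f}"
    using f by (simp add: Lp_rel_def)
  ultimately have "Lp_norm p M ` (Lp_rel p M `` {f}) = {Lp_norm p M f}"
    by blast
  then show ?thesis by (simp add: Lp_space_def)
qed

end

theory Submission
  imports Defs "HOL-Probability.Probability_Measure"
begin

text \<open>
  Let $r_n$ be the Rademacher functions and $R b = \sum_n b_n r_n$, which by Khinchine's inequality
  maps $\ell_2$ boundedly into every $L_q$ with $q < \infty$. For a functional $c$ on $L_p$
  and a sequence $b$ of Rademacher coefficients consider operators built from $a\, c(f)$ and
  $R(b(f))$. Precomposing with the doubling map of the interval shifts the coefficients and changes
  nothing else, so inserting multipliers $d_n < 1$ increasing to $1$ into $R$ does not change the
  norm, but then the norm is not attained as soon as it exceeds the norm on functions with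
  $b(f) = 0$. If moreover $a$ is large, functions with small $c(f)$ are far from maximizing, so a
  maximizing sequence is not weakly null. The norm exceeds that on $b(f) = 0$ because an oscillating
  perturbation of size $t$ gains more than it costs: for $2 < p < \infty$ and $q \ge 2$ take $c$ and
  $b$ from different halves of the domain (gain $t^2$, cost $t^p$), for $q < 2$ and $1 < p < \infty$
  put $c$ and $b$ on different halves of the range (gain $t^q$, cost $t^2$), for $p = \infty$ do
  both (no cost). For $p = 1$ the rank one operator $f \mapsto \int t f(t)\, dt$ works, and for
  $q = \infty$ a supremum of the functionals $c(f) + d_n b_n(f)$.
\<close>

section \<open>Joining two functions on the unit interval\<close>

text \<open>The delicate point for p > 1 and finite q is non-attainment. No strict convexity is at
  hand: for q = 1, shrinking a small coefficient may leave the norm unchanged. Instead, for a fixed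
  f, deleting sufficiently many initial coefficients of b(f) brings the value close to the one for b
  = 0, hence strictly below the supremum. The damped value is at most a proper convex combination of
  the full value and the truncated one. So the excess over b = 0 is indispensable, and Khinchine's
  inequality serves to control tails as well as to bound R.

  The estimates on R are proved for finite averages over signs, where convexity, contraction and
  shift are inductions on the number of signs, and are carried to the limit. Averages and Rademacher
  functions obey the same recursion, which halves the interval; this self-similarity takes the place
  of independence.

  Energies are q-th powers of norms, so that they are convex. Separating centre and coefficients by
  a convex splitting at 1/2 costs the factor 2^(q-1), whence the 2^q in the requirement on the
  weight a.\<close>

abbreviation UI :: "real measure" where
  "UI \<equiv> lebesgue_on {0..1}"

lemma prob_space_UI: "prob_space UI"
  by (rule prob_spaceI) (simp add: emeasure_restrict_space)

lemma AE_lebesgue_neq: "AE t in lebesgue. t \<noteq> (c :: real)"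
  by (rule AE_I'[of "{c}"]) auto

definition join :: "(real \<Rightarrow> 'a) \<Rightarrow> (real \<Rightarrow> 'a) \<Rightarrow> real \<Rightarrow> 'a" where
  "join u v t = (if t < 1/2 then u (2 * t) else v (2 * t - 1))"

lemma join_comp: "(\<lambda>t. f (join u v t)) = join (\<lambda>s. f (u s)) (\<lambda>s. f (v s))"
  by (auto simp: join_def)

lemma join_halves: "join (\<lambda>s. f (s/2)) (\<lambda>s. f ((s+1)/2)) = f"
  by (rule ext) (simp add: join_def)

lemma affine_lebesgue_measurable:
  fixes c t :: real assumes "c \<noteq> 0" shows "(\<lambda>x. t + c * x) \<in> lebesgue \<rightarrow>\<^sub>M lebesgue"
  using lebesgue_affine_measurable[where c= "\<lambda>x::real. c"] assms by simp

lemma measurable_halves [measurable]: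
  "(\<lambda>s. s/2) \<in> UI \<rightarrow>\<^sub>M UI" "(\<lambda>s. (s+1)/2) \<in> UI \<rightarrow>\<^sub>M UI"
proof -
  have 1: "(\<lambda>x. 0 + (1/2) * x) \<in> lebesgue \<rightarrow>\<^sub>M (lebesgue :: real measure)"
    by (rule affine_lebesgue_measurable) simp
  have 2: "(\<lambda>x. 1/2 + (1/2) * x) \<in> lebesgue \<rightarrow>\<^sub>M (lebesgue :: real measure)"
    by (rule affine_lebesgue_measurable) simp
  show "(\<lambda>s. s/2) \<in> UI \<rightarrow>\<^sub>M UI"
    using measurable_restrict_space3[OF 1, of "{0..1}" "{0..1}"] by simp
  show "(\<lambda>s. (s+1)/2) \<in> UI \<rightarrow>\<^sub>M UI"
    using measurable_restrict_space3[OF 2, of "{0..1}" "{0..1}"]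
    by (simp add: add_divide_distrib add.commute)
qed

lemma measurable_join [measurable]:
  assumes u: "u \<in> UI \<rightarrow>\<^sub>M N" and v: "v \<in> UI \<rightarrow>\<^sub>M N"
  shows "join u v \<in> UI \<rightarrow>\<^sub>M N"
proof -
  have 1: "(\<lambda>x. 0 + 2 * x) \<in> lebesgue \<rightarrow>\<^sub>M (lebesgue :: real measure)"
    by (rule affine_lebesgue_measurable) simp
  have 2: "(\<lambda>x. -1 + 2 * x) \<in> lebesgue \<rightarrow>\<^sub>M (lebesgue :: real measure)"
    by (rule affine_lebesgue_measurable) simp
  have "(\<lambda>t. u (2*t)) \<in> restrict_space UI {x. x < 1/2} \<rightarrow>\<^sub>M N"
    using measurable_compose[OF measurable_restrict_space3[OF 1, of "{0..1} \<inter> {x. x < 1/2}" "{0..1}"] u]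
    by (simp add: restrict_restrict_space)
  moreover have "(\<lambda>t. v (2*t-1)) \<in> restrict_space UI {x. \<not> x < 1/2} \<rightarrow>\<^sub>M N"
    using measurable_compose[OF measurable_restrict_space3[OF 2, of "{0..1} \<inter> {x. \<not> x < 1/2}" "{0..1}"] v]
    by (simp add: restrict_restrict_space)
  moreover have "{x \<in> space UI. x < 1/2} \<in> sets UI"
  proof -
    have "{x \<in> space UI. x < 1/2} = {0..1} \<inter> {..<1/2}" by auto
    then show ?thesis by (auto simp: sets_restrict_space)
  qed
  ultimately show ?thesis
    unfolding join_def[abs_def] by (subst measurable_If_restrict_space_iff) auto
qed

lemma nn_integral_join:
  fixes u v :: "real \<Rightarrow> ennreal"
  assumes [measurable]: "u \<in> borel_measurable UI" "v \<in> borel_measurable UI"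
  shows "(\<integral>\<^sup>+t. join u v t \<partial>UI) = ((\<integral>\<^sup>+t. u t \<partial>UI) + (\<integral>\<^sup>+t. v t \<partial>UI)) / 2"
proof -
  \<comment> \<open>At t = 1/2 both \<open>0 + 2 * t\<close> and \<open>-1 + 2 * t\<close> lie in
    the closed interval. Cutting \<open>u\<close> off at 1 makes the sum of the two rescaled
    functions agree with \<open>join u v\<close> at every point.\<close>
  define u' where "u' t = u t * indicator {0..1} t * indicator {0..<1} t" for t :: real
  define v' where "v' t = v t * indicator {0..1} t" for t :: real
  have mu0: "(\<lambda>t. u t * indicator {0..1} t) \<in> borel_measurable lebesgue"
    and v'_meas: "v' \<in> borel_measurable lebesgue"
    using assms unfolding v'_def by (auto simp: borel_measurable_restrict_space_iff_ennreal)
  have u'_meas: "u' \<in> borel_measurable lebesgue"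
    unfolding u'_def using mu0 by (rule borel_measurable_times_ennreal) (auto intro!: borel_measurable_indicator)
  have u'_eq: "(\<integral>\<^sup>+t. u' t \<partial>lebesgue) = (\<integral>\<^sup>+t. u t \<partial>UI)"
  proof -
    have "(\<integral>\<^sup>+t. u' t \<partial>lebesgue) = (\<integral>\<^sup>+t. u t * indicator {0..1} t \<partial>lebesgue)"
      using AE_lebesgue_neq[of 1] by (intro nn_integral_cong_AE) (auto simp: u'_def indicator_def elim!: eventually_mono)
    then show ?thesis by (simp add: nn_integral_restrict_space)
  qed
  have "(\<integral>\<^sup>+t. join u v t \<partial>UI) = (\<integral>\<^sup>+t. u' (0 + 2 * t) + v' (-1 + 2 * t) \<partial>lebesgue)"
    by (simp add: nn_integral_restrict_space)
       (intro nn_integral_cong, auto simp: join_def u'_def v'_def indicator_def)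
  also have "\<dots> = (\<integral>\<^sup>+t. u' (0 + 2 * t) \<partial>lebesgue) + (\<integral>\<^sup>+t. v' (-1 + 2 * t) \<partial>lebesgue)"
    using u'_meas v'_meas
    by (intro nn_integral_add measurable_compose[OF affine_lebesgue_measurable]) auto
  also have "\<dots> = (\<integral>\<^sup>+t. u' t \<partial>lebesgue) / 2 + (\<integral>\<^sup>+t. v' t \<partial>lebesgue) / 2"
    using nn_integral_real_affine_lebesgue[OF u'_meas, of 2 0]
          nn_integral_real_affine_lebesgue[OF v'_meas, of 2 "-1"]
    by (simp add: mult.commute[of "2::ennreal"] ennreal_mult_divide_eq)
  also have "\<dots> = ((\<integral>\<^sup>+t. u t \<partial>UI) + (\<integral>\<^sup>+t. v t \<partial>UI)) / 2"
    using u'_eq by (simp add: v'_def nn_integral_restrict_space add_divide_distrib_ennreal)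
  finally show ?thesis .
qed

lemma has_bochner_integral_join:
  fixes u v :: "real \<Rightarrow> 'a::euclidean_space"
  assumes u: "has_bochner_integral UI u i" and v: "has_bochner_integral UI v j"
  shows "has_bochner_integral UI (join u v) ((i + j) /\<^sub>R 2)"
proof -
  define u' where "u' t = indicator {0..<1} t *\<^sub>R u t" for t :: real
  define v' where "v' t = indicator {0..1} t *\<^sub>R v t" for t :: real
  have ae: "AE t in lebesgue. indicator {0..1} t *\<^sub>R u t = u' t"
    using AE_lebesgue_neq[of 1] by (auto simp: u'_def indicator_def elim!: eventually_mono)
  have u0: "has_bochner_integral lebesgue (\<lambda>t. indicator {0..1} t *\<^sub>R u t) i"
    using u by (simp add: has_bochner_integral_restrict_space)
  have "u' \<in> borel_measurable lebesgue"
  proof -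
    have "u' = (\<lambda>t. indicator {0..<1} t *\<^sub>R (indicator {0..1} t *\<^sub>R u t))"
      by (auto simp: u'_def indicator_def)
    moreover have "\<dots> \<in> borel_measurable lebesgue"
      by (rule borel_measurable_scaleR[OF _ borel_measurable_has_bochner_integral[OF u0]])
        (auto intro!: borel_measurable_indicator)
    ultimately show ?thesis by simp
  qed
  then have "has_bochner_integral lebesgue u' i"
    using u0 ae has_bochner_integral_cong_AE[of "\<lambda>t. indicator {0..1} t *\<^sub>R u t" lebesgue u' i]
    by (auto dest: has_bochner_integral_iff[THEN iffD1])
  then have 1: "has_bochner_integral lebesgue (\<lambda>t. u' (0 + 2 * t)) (i /\<^sub>R \<bar>2\<bar>)"
    by (subst (asm) has_bochner_integral_lebesgue_real_affine_iff[of 2 _ _ 0]) auto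
  have "has_bochner_integral lebesgue v' j"
    using v by (simp add: has_bochner_integral_restrict_space v'_def[abs_def])
  then have 2: "has_bochner_integral lebesgue (\<lambda>t. v' (-1 + 2 * t)) (j /\<^sub>R \<bar>2\<bar>)"
    by (subst (asm) has_bochner_integral_lebesgue_real_affine_iff[of 2 _ _ "-1"]) auto
  have eq: "indicator {0..1} t *\<^sub>R join u v t = u' (0 + 2 * t) + v' (-1 + 2 * t)" for t
    by (auto simp: join_def u'_def v'_def indicator_def)
  show ?thesis
    using has_bochner_integral_add[OF 1 2]
    by (simp add: has_bochner_integral_restrict_space eq scaleR_add_right)
qed

lemma integral_join:
  fixes u v :: "real \<Rightarrow> 'a::euclidean_space"
  assumes "integrable UI u" "integrable UI v"
  shows "(LINT t|UI. join u v t) = ((LINT t|UI. u t) + (LINT t|UI. v t)) /\<^sub>R 2"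
  using assms by (intro has_bochner_integral_integral_eq has_bochner_integral_join)
    (auto simp: has_bochner_integral_iff)

lemma integrable_join:
  fixes u v :: "real \<Rightarrow> 'a::euclidean_space"
  assumes "integrable UI u" "integrable UI v"
  shows "integrable UI (join u v)"
  using has_bochner_integral_join[of u _ v] assms by (auto simp: has_bochner_integral_iff)

text \<open>\<open>f\<close> is the join of its own halves, so the mean of the two extended
  integrals of the norms is finite, and hence each of them is. Extended integrals allow this before
  integrability of the halves is known.\<close>

lemma integrable_halves:
  fixes f :: "real \<Rightarrow> 'a::euclidean_space"
  assumes f: "integrable UI f"
  shows "integrable UI (\<lambda>s. f (s/2))" "integrable UI (\<lambda>s. f ((s+1)/2))"
proof -
  have [measurable]: "f \<in> borel_measurable UI"
    using f by auto
  have m: "(\<lambda>s. ennreal (norm (f (s/2)))) \<in> borel_measurable UI"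
    "(\<lambda>s. ennreal (norm (f ((s+1)/2)))) \<in> borel_measurable UI"
    using measurable_compose[OF measurable_halves(1), of f borel]
      measurable_compose[OF measurable_halves(2), of f borel] by auto
  have "(\<integral>\<^sup>+t. ennreal (norm (f t)) \<partial>UI) < \<infinity>"
    using f by (simp add: integrable_iff_bounded)
  then have "((\<integral>\<^sup>+s. norm (f (s/2)) \<partial>UI) + (\<integral>\<^sup>+s. norm (f ((s+1)/2)) \<partial>UI)) / 2 < \<infinity>"
    using nn_integral_join[OF m] by (simp add: join_halves[of "\<lambda>t. ennreal (norm (f t))"])
  then have "(\<integral>\<^sup>+s. norm (f (s/2)) \<partial>UI) < \<infinity> \<and> (\<integral>\<^sup>+s. norm (f ((s+1)/2)) \<partial>UI) < \<infinity>"
    by (auto simp: ennreal_divide_eq_top_iff top_unique less_top[symmetric])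
  then show "integrable UI (\<lambda>s. f (s/2))" "integrable UI (\<lambda>s. f ((s+1)/2))"
    using measurable_compose[OF measurable_halves(1), of f borel]
      measurable_compose[OF measurable_halves(2), of f borel]
    by (auto simp: integrable_iff_bounded)
qed

lemma integral_halves:
  fixes f :: "real \<Rightarrow> 'a::euclidean_space"
  assumes f: "integrable UI f"
  shows "(LINT t|UI. f t) = ((LINT s|UI. f (s/2)) + (LINT s|UI. f ((s+1)/2))) /\<^sub>R 2"
  using integral_join[OF integrable_halves[OF f]] by (simp add: join_halves)

text \<open>The exceptional points lie in the join of two null sets, and
  \<open>nn_integral_join\<close> computes its measure as the mean of theirs.\<close>

lemma AE_join:
  assumes "AE t in UI. P t" "AE t in UI. Q t"
  shows "AE t in UI. join P Q t"
proof -
  obtain A where A: "{t \<in> space UI. \<not> P t} \<subseteq> A" "emeasure UI A = 0" "A \<in> sets UI"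
    using assms(1) by (rule AE_E)
  obtain B where B: "{t \<in> space UI. \<not> Q t} \<subseteq> B" "emeasure UI B = 0" "B \<in> sets UI"
    using assms(2) by (rule AE_E)
  have [measurable]: "A \<in> sets UI" "B \<in> sets UI" by fact+
  have "(\<integral>\<^sup>+t. join (indicator A) (indicator B) t \<partial>UI) = 0"
    using A B by (subst nn_integral_join) auto
  then have "AE t in UI. join (indicator A) (indicator B) t = (0::ennreal)"
    by (subst (asm) nn_integral_0_iff_AE) auto
  then show ?thesis
  proof (rule AE_mp, intro AE_I2 impI)
    fix t assume "t \<in> space UI" "join (indicator A) (indicator B) t = (0::ennreal)"
    then show "join P Q t"
      using subsetD[OF A(1), of "2 * t"] subsetD[OF B(1), of "2 * t - 1"]
      by (cases "t < 1/2") (auto simp: join_def indicator_def split: if_splits)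
  qed
qed

lemma AE_halves:
  assumes "AE t in UI. P t"
  shows "AE s in UI. P (s/2)" "AE s in UI. P ((s+1)/2)"
proof -
  obtain A where A: "{t \<in> space UI. \<not> P t} \<subseteq> A" "emeasure UI A = 0" "A \<in> sets UI"
    using assms(1) by (rule AE_E)
  have [measurable]: "A \<in> sets UI" by fact
  have m: "(\<lambda>s. indicator A (s/2) :: ennreal) \<in> borel_measurable UI"
    "(\<lambda>s. indicator A ((s+1)/2) :: ennreal) \<in> borel_measurable UI"
    using measurable_compose[OF measurable_halves(1), of "indicator A" borel]
      measurable_compose[OF measurable_halves(2), of "indicator A" borel] by auto
  have "(\<integral>\<^sup>+t. indicator A t \<partial>UI) = 0"
    using A by simp
  then have "((\<integral>\<^sup>+s. indicator A (s/2) \<partial>UI) + (\<integral>\<^sup>+s. indicator A ((s+1)/2) \<partial>UI)) / 2 = 0"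
    using nn_integral_join[OF m] by (simp add: join_halves)
  then have "(\<integral>\<^sup>+s. indicator A (s/2) \<partial>UI) = 0 \<and> (\<integral>\<^sup>+s. indicator A ((s+1)/2) \<partial>UI) = 0"
    by (simp add: ennreal_divide_eq_0_iff)
  then have "AE s in UI. indicator A (s/2) = (0::ennreal)" "AE s in UI. indicator A ((s+1)/2) = (0::ennreal)"
    using m by (auto simp: nn_integral_0_iff_AE)
  moreover have "indicator A t = (0::ennreal) \<longrightarrow> P t" if "t \<in> {0..1}" for t
    using that A(1) by (auto simp: indicator_def split: if_splits)
  then have "AE s in UI. indicator A (s/2) = (0::ennreal) \<longrightarrow> P (s/2)"
    "AE s in UI. indicator A ((s+1)/2) = (0::ennreal) \<longrightarrow> P ((s+1)/2)"
    by auto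
  ultimately show "AE s in UI. P (s/2)" "AE s in UI. P ((s+1)/2)"
    by auto
qed

section \<open>Averages over signs\<close>

text \<open>This is the mean of \<open>F\<close> over the 2^k points obtained by adding the first
  \<open>k\<close> entries of \<open>b\<close>, with arbitrary signs, to the centre
  \<open>c\<close>. The recursion absorbs the first signed entry into the centre, which lets
  inequalities be proved by induction over all centres.\<close>

fun signed_avg :: "('k::real_vector \<Rightarrow> real) \<Rightarrow> nat \<Rightarrow> 'k \<Rightarrow> (nat \<Rightarrow> 'k) \<Rightarrow> real" where
  "signed_avg F 0 c b = F c"
| "signed_avg F (Suc k) c b =
     (signed_avg F k (c + b 0) (\<lambda>m. b (Suc m)) + signed_avg F k (c - b 0) (\<lambda>m. b (Suc m))) / 2"

lemma signed_avg_mono: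
  assumes "\<And>z. F z \<le> G z"
  shows "signed_avg F k c b \<le> signed_avg G k c b"
  by (induction k arbitrary: c b) (auto intro: assms add_mono divide_right_mono)

lemma signed_avg_scale: "signed_avg (\<lambda>z. a * F z) k c b = a * signed_avg F k c b"
  by (induction k arbitrary: c b) (simp_all add: algebra_simps)

lemma signed_avg_sum:
  "signed_avg (\<lambda>z. \<Sum>i\<in>I. F i z) k c b = (\<Sum>i\<in>I. signed_avg (F i) k c b)"
  by (induction k arbitrary: c b) (simp_all add: sum.distrib sum_divide_distrib[symmetric])

lemma signed_avg_zero: "signed_avg F k c (\<lambda>m. 0) = F c"
  by (induction k arbitrary: c) auto

lemma signed_avg_shift:
  "signed_avg F (Suc k) c (case_nat 0 b) = signed_avg F k c b"
  by simp

lemma signed_avg_homogeneous: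
  assumes "\<And>z. F (s *\<^sub>R z) = a * F z"
  shows "signed_avg F k (s *\<^sub>R c) (\<lambda>m. s *\<^sub>R b m) = a * signed_avg F k c b"
proof (induction k arbitrary: c b)
  case (Suc k)
  show ?case
    using Suc[of "c + b 0" "\<lambda>m. b (Suc m)"] Suc[of "c - b 0" "\<lambda>m. b (Suc m)"]
    by (simp add: algebra_simps)
qed (simp add: assms)

lemma signed_avg_minus:
  assumes "\<And>z. F (- z) = F z"
  shows "signed_avg F k (- c) (\<lambda>m. - b m) = signed_avg F k c b"
  using signed_avg_homogeneous[of F "-1" 1 k c b] assms by simp

lemma signed_avg_convex:
  assumes F: "convex_on UNIV F" and s: "0 \<le> s" "0 \<le> t" "s + t = 1"
  shows "signed_avg F k (s *\<^sub>R c + t *\<^sub>R c') (\<lambda>m. s *\<^sub>R b m + t *\<^sub>R b' m)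
    \<le> s * signed_avg F k c b + t * signed_avg F k c' b'"
proof (induction k arbitrary: c b c' b')
  case 0
  then show ?case using F s by (simp add: convex_on_def)
next
  case (Suc k)
  have "s *\<^sub>R c + t *\<^sub>R c' + (s *\<^sub>R b 0 + t *\<^sub>R b' 0) = s *\<^sub>R (c + b 0) + t *\<^sub>R (c' + b' 0)"
    "s *\<^sub>R c + t *\<^sub>R c' - (s *\<^sub>R b 0 + t *\<^sub>R b' 0) = s *\<^sub>R (c - b 0) + t *\<^sub>R (c' - b' 0)"
    by (simp_all add: algebra_simps)
  then show ?case
    using Suc[of "c + b 0" "c' + b' 0" "\<lambda>m. b (Suc m)" "\<lambda>m. b' (Suc m)"]
      Suc[of "c - b 0" "c' - b' 0" "\<lambda>m. b (Suc m)" "\<lambda>m. b' (Suc m)"]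
    by (simp only: signed_avg.simps) (simp add: field_simps)
qed

text \<open>Both shrunken centres are convex combinations of \<open>c + d\<close> and
  \<open>c - d\<close>, with the weights (1+s)/2 and (1-s)/2 interchanged. Adding the two convexity
  inequalities makes the weights sum to one.\<close>

lemma signed_avg_contract_center:
  assumes F: "convex_on UNIV F" and s: "\<bar>s\<bar> \<le> 1"
  shows "signed_avg F k (c + s *\<^sub>R d) b + signed_avg F k (c - s *\<^sub>R d) b
    \<le> signed_avg F k (c + d) b + signed_avg F k (c - d) b"
proof -
  define l where "l = (1 + s) / 2"
  define m where "m = (1 - s) / 2"
  have lm: "0 \<le> l" "0 \<le> m" "l + m = 1" and s_eq: "s = l - m"
    using s by (auto simp: l_def m_def field_simps)
  have bb: "(\<lambda>i. l *\<^sub>R b i + m *\<^sub>R b i) = b" "(\<lambda>i. m *\<^sub>R b i + l *\<^sub>R b i) = b"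
    using lm by (simp_all add: scaleR_add_left[symmetric] add.commute)
  have "l *\<^sub>R (c + d) + m *\<^sub>R (c - d) = (l + m) *\<^sub>R c + (l - m) *\<^sub>R d"
    "m *\<^sub>R (c + d) + l *\<^sub>R (c - d) = (l + m) *\<^sub>R c - (l - m) *\<^sub>R d"
    by (simp_all add: algebra_simps)
  then have cd: "l *\<^sub>R (c + d) + m *\<^sub>R (c - d) = c + s *\<^sub>R d"
    "m *\<^sub>R (c + d) + l *\<^sub>R (c - d) = c - s *\<^sub>R d"
    using lm s_eq by simp_all
  have ml: "m + l = 1" using lm by simp
  have "signed_avg F k (c + s *\<^sub>R d) b \<le> l * signed_avg F k (c + d) b + m * signed_avg F k (c - d) b"
    using signed_avg_convex[OF F lm, of k "c + d" "c - d" b b] unfolding cd bb .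
  moreover have "signed_avg F k (c - s *\<^sub>R d) b \<le> m * signed_avg F k (c + d) b + l * signed_avg F k (c - d) b"
    using signed_avg_convex[OF F lm(2,1) ml, of k "c + d" "c - d" b b] unfolding cd bb .
  ultimately have "signed_avg F k (c + s *\<^sub>R d) b + signed_avg F k (c - s *\<^sub>R d) b
     \<le> (l + m) * signed_avg F k (c + d) b + (l + m) * signed_avg F k (c - d) b"
    by (simp add: algebra_simps)
  then show ?thesis using lm by simp
qed

text \<open>The contraction principle, one coefficient at a time: the induction hypothesis restores
  the later coefficients at the centres \<open>c + e 0 *\<^sub>R b 0\<close> and
  \<open>c - e 0 *\<^sub>R b 0\<close>, and the previous lemma restores the first.\<close>

lemma signed_avg_contract_coeffs:
  assumes F: "convex_on UNIV F" and e: "\<And>m. \<bar>e m\<bar> \<le> 1"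
  shows "signed_avg F k c (\<lambda>m. e m *\<^sub>R b m) \<le> signed_avg F k c b"
  using e
proof (induction k arbitrary: c b e)
  case (Suc k)
  let ?b = "\<lambda>m. b (Suc m)"
  have "signed_avg F (Suc k) c (\<lambda>m. e m *\<^sub>R b m)
    \<le> (signed_avg F k (c + e 0 *\<^sub>R b 0) ?b + signed_avg F k (c - e 0 *\<^sub>R b 0) ?b) / 2"
    using Suc.IH[of "\<lambda>m. e (Suc m)" "c + e 0 *\<^sub>R b 0" ?b] Suc.IH[of "\<lambda>m. e (Suc m)" "c - e 0 *\<^sub>R b 0" ?b]
      Suc.prems by simp
  also have "\<dots> \<le> signed_avg F (Suc k) c b"
    using signed_avg_contract_center[OF F Suc.prems[of 0], of k c "b 0" ?b] by simp
  finally show ?case .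
qed simp

text \<open>Sign changes of the coefficients do not matter for an even convex function, so the
  centre may be contracted as well.\<close>

lemma signed_avg_contract:
  assumes F: "convex_on UNIV F" and even: "\<And>z. F (- z) = F z"
    and s: "\<bar>s\<bar> \<le> 1" and e: "\<And>m. \<bar>e m\<bar> \<le> 1"
  shows "signed_avg F k (s *\<^sub>R c) (\<lambda>m. e m *\<^sub>R b m) \<le> signed_avg F k c b"
proof -
  have "signed_avg F k (- x) b \<le> signed_avg F k x b" for x
    using signed_avg_contract_coeffs[OF F, where e = "\<lambda>_. -1" and k = k and c = x and b = b]
      signed_avg_minus[where F = F and k = k and c = x and b = "\<lambda>m. - b m"] even
    by simp
  then have "signed_avg F k (- x) b = signed_avg F k x b" for x
    by (metis antisym minus_minus)
  then have "signed_avg F k (s *\<^sub>R c) b \<le> signed_avg F k c b"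
    using signed_avg_contract_center[OF F s, of k 0 c b] by simp
  then show ?thesis
    using signed_avg_contract_coeffs[OF F, where e = e and k = k and c = "s *\<^sub>R c" and b = b] e by simp
qed

text \<open>Jensen's inequality for one further sign; the base case is contraction by the factor 0.
  Monotonicity in \<open>k\<close> later guarantees that the averages converge.\<close>

lemma signed_avg_incr:
  assumes F: "convex_on UNIV F"
  shows "signed_avg F k c b \<le> signed_avg F (Suc k) c b"
proof (induction k arbitrary: c b)
  case 0
  then show ?case
    using signed_avg_contract_center[OF F, of 0 0 c "b 0" b] by simp
next
  case (Suc k)
  have "signed_avg F (Suc k) c b \<le>
      (signed_avg F (Suc k) (c + b 0) (\<lambda>m. b (Suc m)) + signed_avg F (Suc k) (c - b 0) (\<lambda>m. b (Suc m))) / 2"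
    using Suc[of "c + b 0" "\<lambda>m. b (Suc m)"] Suc[of "c - b 0" "\<lambda>m. b (Suc m)"]
    unfolding signed_avg.simps(2)[of F k c] by (intro divide_right_mono add_mono) auto
  also have "\<dots> = signed_avg F (Suc (Suc k)) c b"
    by (rule signed_avg.simps(2)[symmetric])
  finally show ?case .
qed

section \<open>Khinchine's inequality through exponential moments\<close>

lemma cosh_le_exp_square: "cosh x \<le> exp (x\<^sup>2 / 2)" for x :: real
proof -
  have pow: "(\<lambda>n. (x\<^sup>2/2)^n /\<^sub>R fact n) sums exp (x\<^sup>2/2)"
    by (rule exp_converges)
  have c: "(\<lambda>n. if even n then x ^ n /\<^sub>R fact n else 0) sums cosh x"
    by (rule cosh_converges)
  have c': "(\<lambda>n. x ^ (2 * n) /\<^sub>R fact (2 * n)) sums cosh x"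
  proof -
    have "(\<lambda>n. (\<lambda>n. if even n then x ^ n /\<^sub>R fact n else 0) (2 * n)) sums cosh x"
      by (subst sums_mono_reindex) (use c in \<open>auto simp: strict_mono_def elim!: oddE\<close>)
    then show ?thesis by simp
  qed
  \<comment> \<open>This makes each term of the even power series of cosh at most the corresponding
    term of the exponential series.\<close>
  have fact_le: "2 ^ n * fact n \<le> (fact (2 * n) :: real)" for n
  proof (induction n)
    case (Suc n)
    have "(2::real) ^ Suc n * fact (Suc n) = 2 * (real n + 1) * (2 ^ n * fact n)" by (simp add: algebra_simps)
    also have "\<dots> \<le> 2 * (real n + 1) * fact (2 * n)"
      by (intro mult_left_mono Suc) auto
    also have "\<dots> \<le> (2 * real n + 2) * (2 * real n + 1) * fact (2 * n)"
      by (intro mult_right_mono) (auto simp: algebra_simps)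
    also have "\<dots> = fact (2 * Suc n)" by (simp add: algebra_simps)
    finally show ?case .
  qed simp
  show ?thesis
  proof (rule sums_le[OF _ c' pow])
    fix n
    have "x ^ (2 * n) / fact (2 * n) \<le> x ^ (2 * n) / (2 ^ n * fact n)"
      by (intro divide_left_mono fact_le) (auto simp: power_mult)
    moreover have "x ^ (2 * n) / (2 ^ n * fact n) = (x\<^sup>2 / 2) ^ n / fact n"
      by (simp add: power_divide power_mult)
    ultimately show "x ^ (2 * n) /\<^sub>R fact (2 * n) \<le> (x\<^sup>2 / 2) ^ n /\<^sub>R fact n"
      by (simp only: real_scaleR_def divide_inverse mult.commute)
  qed
qed

text \<open>The exponential turns the sum into a product over the signs. Averaging one sign yields a
  factor \<open>cosh (b m \<bullet> i)\<close>, which is at most exp(|b m|^2/2) as \<open>i\<close>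
  has norm at most 1.\<close>

lemma signed_avg_exp_inner:
  fixes i :: "'k::real_inner"
  assumes "norm i \<le> 1"
  shows "signed_avg (\<lambda>z. exp (z \<bullet> i)) k c b \<le> exp (c \<bullet> i + (\<Sum>m<k. (norm (b m))\<^sup>2) / 2)"
proof (induction k arbitrary: c b)
  case (Suc k)
  let ?s = "(\<Sum>m<k. (norm (b (Suc m)))\<^sup>2) / 2"
  have "signed_avg (\<lambda>z. exp (z \<bullet> i)) (Suc k) c b
      \<le> (exp ((c + b 0) \<bullet> i + ?s) + exp ((c - b 0) \<bullet> i + ?s)) / 2"
    using Suc[of "c + b 0" "\<lambda>m. b (Suc m)"] Suc[of "c - b 0" "\<lambda>m. b (Suc m)"] by simp
  also have "\<dots> = exp (c \<bullet> i + ?s) * cosh (b 0 \<bullet> i)"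
    by (simp only: cosh_field_def inner_add_left inner_diff_left exp_add exp_diff exp_minus) (simp add: field_simps)
  also have "cosh (b 0 \<bullet> i) \<le> exp ((norm (b 0))\<^sup>2 / 2)"
  proof (rule order_trans[OF cosh_le_exp_square])
    have "\<bar>b 0 \<bullet> i\<bar> \<le> norm (b 0) * norm i" by (rule Cauchy_Schwarz_ineq2)
    also have "\<dots> \<le> norm (b 0)" using assms by (simp add: mult_left_le)
    finally have "(b 0 \<bullet> i)\<^sup>2 \<le> (norm (b 0))\<^sup>2" by (rule power2_le_iff_abs_le[THEN iffD2, rotated]) simp
    then show "exp ((b 0 \<bullet> i)\<^sup>2 / 2) \<le> exp ((norm (b 0))\<^sup>2 / 2)" by simp
  qed
  also have "exp (c \<bullet> i + ?s) * exp ((norm (b 0))\<^sup>2 / 2) = exp (c \<bullet> i + (\<Sum>m<Suc k. (norm (b m))\<^sup>2) / 2)"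
    unfolding sum.lessThan_Suc_shift by (simp add: exp_add[symmetric] add_divide_distrib algebra_simps)
  finally show ?case by (simp del: signed_avg.simps sum.lessThan_Suc)
qed simp

text \<open>The constant comes from ln(x/s) \<le> x/s - 1 multiplied by s; the additional gain of a
  factor exp(-s) is given away.\<close>

lemma powr_le_exp: "x powr s \<le> s powr s * exp x" if "0 \<le> x" "0 < s" for x s :: real
proof (cases "x = 0")
  case False
  then have x: "0 < x" using that by simp
  have "ln (x / s) \<le> x / s - 1" using x that by (intro ln_le_minus_one) auto
  then have "s * (ln x - ln s) \<le> s * (x / s - 1)"
    using x that by (intro mult_left_mono) (auto simp: ln_div)
  then have "s * ln x \<le> s * ln s + x" using that by (simp add: algebra_simps)
  then have "exp (s * ln x) \<le> exp (s * ln s + x)" by simp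
  then show ?thesis using x that by (simp add: powr_def exp_add mult_ac)
qed simp

text \<open>The powers of \<open>s\<close> and of the dimension with exponent \<open>s\<close> arise
  in comparing a power of the norm with exponentials of coordinates. The remaining 2 * DIM *
  exp(1/2) counts these exponentials, each of mean at most exp(1/2) when the squares of the
  coefficients sum to at most 1.\<close>

definition khinchine_const :: "'k::euclidean_space itself \<Rightarrow> real \<Rightarrow> real" where
  "khinchine_const _ s = 2 * exp (1/2) * DIM('k) powr (s + 1) * s powr s"

lemma khinchine_const_pos: "0 < s \<Longrightarrow> 0 < khinchine_const TYPE('k::euclidean_space) s"
  by (simp add: khinchine_const_def)

text \<open>The norm is at most the dimension times the largest coordinate, and the exponential of
  an absolute value is at most the sum of the exponentials of both signs. The sum over the whole
  basis removes the dependence of the largest coordinate on \<open>z\<close>.\<close>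

lemma norm_powr_le_exp_inner:
  fixes z :: "'k::euclidean_space"
  assumes "0 < s"
  shows "norm z powr s \<le> DIM('k) powr s * s powr s * (\<Sum>i\<in>Basis. exp (z \<bullet> i) + exp (z \<bullet> (- i)))"
proof -
  obtain j where j: "j \<in> Basis" "\<And>i. i \<in> Basis \<Longrightarrow> \<bar>z \<bullet> i\<bar> \<le> \<bar>z \<bullet> j\<bar>"
  proof -
    have "Max ((\<lambda>i. \<bar>z \<bullet> i\<bar>) ` Basis) \<in> (\<lambda>i. \<bar>z \<bullet> i\<bar>) ` Basis"
      by (rule Max_in) auto
    then obtain j where "j \<in> Basis" "Max ((\<lambda>i. \<bar>z \<bullet> i\<bar>) ` Basis) = \<bar>z \<bullet> j\<bar>"
      by (elim imageE) metis
    then show ?thesis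
      using Max_ge[of "(\<lambda>i. \<bar>z \<bullet> i\<bar>) ` Basis"] by (intro that[of j]) auto
  qed
  have "norm z \<le> (\<Sum>i\<in>Basis. \<bar>z \<bullet> i\<bar>)" by (rule norm_le_l1)
  also have "\<dots> \<le> DIM('k) * \<bar>z \<bullet> j\<bar>" by (rule sum_bounded_above) (use j in auto)
  finally have "norm z powr s \<le> (DIM('k) * \<bar>z \<bullet> j\<bar>) powr s"
    using assms by (intro powr_mono2) auto
  also have "\<dots> = DIM('k) powr s * \<bar>z \<bullet> j\<bar> powr s" by (simp add: powr_mult)
  also have "\<dots> \<le> DIM('k) powr s * (s powr s * exp \<bar>z \<bullet> j\<bar>)"
    using assms by (intro mult_left_mono powr_le_exp) auto
  also have "\<dots> \<le> DIM('k) powr s * (s powr s * (exp (z \<bullet> j) + exp (z \<bullet> (- j))))"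
    by (intro mult_left_mono) (auto simp: abs_if)
  also have "\<dots> \<le> DIM('k) powr s * (s powr s * (\<Sum>i\<in>Basis. exp (z \<bullet> i) + exp (z \<bullet> (- i))))"
    using j by (intro mult_left_mono member_le_sum) auto
  finally show ?thesis by (simp add: mult_ac)
qed

text \<open>The exponential bound is not homogeneous. It is applied to coefficients whose squares
  sum to at most 1, and scaling does the rest; vanishing coefficients, which cannot be normalised,
  are treated apart.\<close>

lemma khinchine_signed_avg:
  fixes b :: "nat \<Rightarrow> 'k::euclidean_space"
  assumes s: "0 < s"
  shows "signed_avg (\<lambda>z. norm z powr s) k 0 b
    \<le> khinchine_const TYPE('k) s * (\<Sum>m<k. (norm (b m))\<^sup>2) powr (s / 2)"
proof -
  have unit: "signed_avg (\<lambda>z. norm z powr s) k 0 b \<le> khinchine_const TYPE('k) s"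
    if "(\<Sum>m<k. (norm (b m))\<^sup>2) \<le> 1" for b :: "nat \<Rightarrow> 'k"
  proof -
    have "signed_avg (\<lambda>z. norm z powr s) k 0 b \<le> DIM('k) powr s * s powr s *
      (\<Sum>i\<in>Basis. signed_avg (\<lambda>z. exp (z \<bullet> i)) k 0 b + signed_avg (\<lambda>z. exp (z \<bullet> (- i))) k 0 b)"
    proof -
      have add: "signed_avg (\<lambda>z. F z + G z) k c b = signed_avg F k c b + signed_avg G k c b"
        for F G c k and b :: "nat \<Rightarrow> 'k"
        by (induction k arbitrary: c b) (simp_all add: add_divide_distrib)
      show ?thesis
        using signed_avg_mono[OF norm_powr_le_exp_inner[OF s], where k = k and c = 0 and b = b]
        by (simp add: signed_avg_scale signed_avg_sum add del: inner_minus_right)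
    qed
    also have "\<dots> \<le> DIM('k) powr s * s powr s * (\<Sum>i\<in>(Basis::'k set). exp (1/2) + exp (1/2))"
    proof (intro mult_left_mono sum_mono add_mono)
      fix i :: 'k assume i: "i \<in> Basis"
      have "signed_avg (\<lambda>z. exp (z \<bullet> j)) k 0 b \<le> exp (1/2)" if "norm j \<le> 1" for j
        using that \<open>(\<Sum>m<k. (norm (b m))\<^sup>2) \<le> 1\<close>
        by (intro order_trans[OF signed_avg_exp_inner]) auto
      then show "signed_avg (\<lambda>z. exp (z \<bullet> i)) k 0 b \<le> exp (1/2)"
        "signed_avg (\<lambda>z. exp (z \<bullet> - i)) k 0 b \<le> exp (1/2)"
        using i by (auto simp del: inner_minus_right)
    qed auto
    also have "\<dots> = khinchine_const TYPE('k) s"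
      by (simp add: khinchine_const_def powr_add)
    finally show ?thesis .
  qed
  define \<beta> where "\<beta> = sqrt (\<Sum>m<k. (norm (b m))\<^sup>2)"
  show ?thesis
  proof (cases "\<beta> = 0")
    case True
    then have z: "b m = 0" if "m < k" for m
      using that by (auto simp: \<beta>_def sum_nonneg_eq_0_iff)
    have "signed_avg F k c b = F c" if "\<And>m. m < k \<Longrightarrow> b m = 0" for F c k and b :: "nat \<Rightarrow> 'k"
      using that by (induction k arbitrary: c b) auto
    then show ?thesis using z True s by simp
  next
    case False
    then have \<beta>: "\<beta> > 0" by (simp add: \<beta>_def sum_nonneg less_le)
    have sq: "(\<Sum>m<k. (norm (b m))\<^sup>2) = \<beta>\<^sup>2" by (simp add: \<beta>_def sum_nonneg)
    have "signed_avg (\<lambda>z. norm z powr s) k 0 (\<lambda>m. b m /\<^sub>R \<beta>) \<le> khinchine_const TYPE('k) s"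
      using \<beta> by (intro unit) (simp add: power_mult_distrib sum_distrib_left[symmetric] sq power_inverse)
    moreover have "signed_avg (\<lambda>z. norm z powr s) k 0 b
        = \<beta> powr s * signed_avg (\<lambda>z. norm z powr s) k 0 (\<lambda>m. b m /\<^sub>R \<beta>)"
      using signed_avg_homogeneous[where F = "\<lambda>z::'k. norm z powr s" and s = \<beta> and a = "\<beta> powr s" and k = k and c = 0
            and b = "\<lambda>m. b m /\<^sub>R \<beta>"] \<beta>
      by (simp add: powr_mult)
    moreover have "\<beta> powr s = (\<Sum>m<k. (norm (b m))\<^sup>2) powr (s / 2)"
    proof -
      have "\<beta>\<^sup>2 = \<beta> powr 2" using \<beta> by simp
      then show ?thesis by (simp only: sq powr_powr) simp
    qed
    ultimately show ?thesis
      by (metis mult.commute mult_left_mono powr_ge_zero)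
  qed
qed

text \<open>When one argument vanishes the inequality reduces to \<open>a powr q \<le> a\<close> for
  a weight \<open>a\<close> strictly between 0 and 1; otherwise it is convexity on the positive
  half-line.\<close>

lemma powr_convex_nonneg:
  fixes x y :: real
  assumes "1 \<le> q" "0 \<le> x" "0 \<le> y" "0 < t" "t < 1"
  shows "((1 - t) * x + t * y) powr q \<le> (1 - t) * x powr q + t * y powr q"
proof -
  have le: "a powr q \<le> a" if "0 < a" "a < 1" for a :: real
    using powr_mono'[of 1 q a] that assms(1) by simp
  consider "x = 0" | "y = 0" | "0 < x" "0 < y"
    using assms by fastforce
  then show ?thesis
  proof cases
    case 1
    then show ?thesis
      using mult_right_mono[OF le[of t], of "y powr q"] assms by (simp add: powr_mult)
  next
    case 2
    then show ?thesis
      using mult_right_mono[OF le[of "1 - t"], of "x powr q"] assms by (simp add: powr_mult)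
  next
    case 3
    then show ?thesis
      using convex_onD[OF powr_convex[OF assms(1)], of t x y] assms by simp
  qed
qed

lemma convex_on_norm_powr:
  assumes "1 \<le> q"
  shows "convex_on UNIV (\<lambda>z::'k::real_normed_vector. norm z powr q)"
proof (rule convex_onI)
  fix t :: real and x y :: 'k assume t: "0 < t" "t < 1"
  have "norm ((1 - t) *\<^sub>R x + t *\<^sub>R y) \<le> (1 - t) * norm x + t * norm y"
    using norm_triangle_ineq[of "(1 - t) *\<^sub>R x" "t *\<^sub>R y"] t by simp
  then have "norm ((1 - t) *\<^sub>R x + t *\<^sub>R y) powr q \<le> ((1 - t) * norm x + t * norm y) powr q"
    using assms by (intro powr_mono2) auto
  also have "\<dots> \<le> (1 - t) * norm x powr q + t * norm y powr q"
    using t assms by (intro powr_convex_nonneg) auto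
  finally show "norm ((1 - t) *\<^sub>R x + t *\<^sub>R y) powr q \<le> (1 - t) * norm x powr q + t * norm y powr q" .
qed simp

section \<open>Rademacher series\<close>

text \<open>\<open>rad (Suc n)\<close> is \<open>rad n\<close> after the doubling map. Every value
  is 1 or -1, at dyadic points and outside the interval too, so identities such as
  \<open>abs_rad\<close> hold pointwise.\<close>

primrec rad :: "nat \<Rightarrow> real \<Rightarrow> real" where
  "rad 0 = join (\<lambda>_. 1) (\<lambda>_. - 1)"
| "rad (Suc n) = join (rad n) (rad n)"

lemma abs_rad [simp]: "\<bar>rad n t\<bar> = 1"
  by (induction n arbitrary: t) (auto simp: join_def)

lemma rad_measurable [measurable]: "rad n \<in> borel_measurable UI"
  by (induction n) (auto intro!: measurable_join)

definition radsum :: "nat \<Rightarrow> 'k::real_vector \<Rightarrow> (nat \<Rightarrow> 'k) \<Rightarrow> real \<Rightarrow> 'k" where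
  "radsum k c b t = c + (\<Sum>m<k. rad m t *\<^sub>R b m)"

lemma radsum_0 [simp]: "radsum 0 c b = (\<lambda>t. c)"
  by (simp add: radsum_def[abs_def])

lemma radsum_Suc:
  "radsum (Suc k) c b = join (radsum k (c + b 0) (\<lambda>m. b (Suc m))) (radsum k (c - b 0) (\<lambda>m. b (Suc m)))"
  by (rule ext) (auto simp: radsum_def sum.lessThan_Suc_shift join_def simp del: sum.lessThan_Suc)

lemma radsum_measurable [measurable]:
  fixes b :: "nat \<Rightarrow> 'k::euclidean_space"
  shows "radsum k c b \<in> borel_measurable UI"
  unfolding radsum_def[abs_def] by measurable

text \<open>Both sides satisfy the same recursion: \<open>radsum_Suc\<close> splits at the middle of
  the interval, and integrating a join averages its halves. Here self-similarity replaces
  independence of the Rademacher functions.\<close>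

lemma has_bochner_integral_radsum:
  fixes F :: "'k::real_vector \<Rightarrow> real"
  shows "has_bochner_integral UI (\<lambda>t. F (radsum k c b t)) (signed_avg F k c b)"
proof (induction k arbitrary: c b)
  case 0
  show ?case
    using prob_space.prob_space[OF prob_space_UI] has_bochner_integral_integrable[of UI "\<lambda>_. F c"]
      finite_measure.integrable_const[OF prob_space.finite_measure[OF prob_space_UI], of "F c"]
    by simp
next
  case (Suc k)
  show ?case
    using has_bochner_integral_join[OF Suc[of "c + b 0" "\<lambda>m. b (Suc m)"] Suc[of "c - b 0" "\<lambda>m. b (Suc m)"]]
    unfolding radsum_Suc join_comp[where f = F] by simp
qed

lemmas integral_radsum = has_bochner_integral_radsum[THEN has_bochner_integral_integral_eq]
lemmas integrable_radsum = has_bochner_integral_radsum[THEN integrable.intros]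

lemma radsum_add:
  "radsum k (c + c') (\<lambda>m. b m + b' m) t = radsum k c b t + radsum k c' b' t"
  by (simp add: radsum_def sum.distrib scaleR_add_right)

lemma radsum_diff:
  "k \<le> l \<Longrightarrow> radsum l 0 b t - radsum k 0 b t = radsum l 0 (\<lambda>m. if m < k then 0 else b m) t"
proof -
  assume "k \<le> l"
  then have "(\<Sum>m<l. rad m t *\<^sub>R b m) = (\<Sum>m<k. rad m t *\<^sub>R b m) + (\<Sum>m=k..<l. rad m t *\<^sub>R b m)"
    by (metis lessThan_atLeast0 sum.atLeastLessThan_concat zero_le)
  moreover have "(\<Sum>m<l. rad m t *\<^sub>R (if m < k then 0 else b m)) = (\<Sum>m=k..<l. rad m t *\<^sub>R b m)"
    by (rule sum.mono_neutral_cong_right) auto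
  ultimately show ?thesis by (simp add: radsum_def)
qed

section \<open>Square-summable coefficients and the limits of their Rademacher series\<close>

definition l2 :: "(nat \<Rightarrow> 'k::real_normed_vector) \<Rightarrow> bool" where
  "l2 b \<longleftrightarrow> summable (\<lambda>m. (norm (b m))\<^sup>2)"

lemma l2I:
  assumes "\<And>N. (\<Sum>m<N. (norm (b m))\<^sup>2) \<le> B"
  shows "l2 b"
  unfolding l2_def
  by (rule summableI_nonneg_bounded[of _ B]) (use assms in auto)

lemma l2_add: assumes "l2 b" "l2 b'" shows "l2 (\<lambda>m. b m + b' m)"
  unfolding l2_def
proof (rule summable_comparison_test')
  show "summable (\<lambda>m. 2 * (norm (b m))\<^sup>2 + 2 * (norm (b' m))\<^sup>2)"
    using assms by (auto simp: l2_def intro!: summable_add summable_mult)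
  fix m :: nat
  have "(norm (b m + b' m))\<^sup>2 \<le> (norm (b m) + norm (b' m))\<^sup>2"
    by (rule power_mono[OF norm_triangle_ineq]) simp
  also have "\<dots> \<le> 2 * (norm (b m))\<^sup>2 + 2 * (norm (b' m))\<^sup>2"
    using sum_squares_bound[of "norm (b m)" "norm (b' m)"] by (simp add: power2_sum)
  finally show "norm ((norm (b m + b' m))\<^sup>2) \<le> 2 * (norm (b m))\<^sup>2 + 2 * (norm (b' m))\<^sup>2" by simp
qed

lemma l2_mult:
  assumes "l2 b" and "\<And>m. norm (b' m) \<le> C * norm (b m)"
  shows "l2 b'"
  unfolding l2_def
proof (rule summable_comparison_test')
  show "summable (\<lambda>m. C\<^sup>2 * (norm (b m))\<^sup>2)"
    using assms by (auto simp: l2_def intro!: summable_mult)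
  fix m show "norm ((norm (b' m))\<^sup>2) \<le> C\<^sup>2 * (norm (b m))\<^sup>2"
    using power_mono[OF assms(2)[of m], of 2] by (simp add: power_mult_distrib)
qed

lemma l2_shift: "l2 b \<Longrightarrow> l2 (case_nat 0 b)"
  unfolding l2_def by (subst summable_Suc_iff[symmetric]) simp

text \<open>One subsequential pointwise limit serves all exponents, so that the limit of the
  Rademacher series is not tied to a particular one.\<close>

definition is_radlim :: "(nat \<Rightarrow> 'k::euclidean_space) \<Rightarrow> (real \<Rightarrow> 'k) \<Rightarrow> bool" where
  "is_radlim b g \<longleftrightarrow> g \<in> borel_measurable UI \<and>
     (\<forall>q\<ge>1. integrable UI (\<lambda>t. norm (g t) powr q) \<and>
        (\<forall>k. integrable UI (\<lambda>t. norm (g t - radsum k 0 b t) powr q)) \<and>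
        (\<lambda>k. LINT t|UI. norm (g t - radsum k 0 b t) powr q) \<longlonglongrightarrow> 0)"

definition tail2 :: "(nat \<Rightarrow> 'k::real_normed_vector) \<Rightarrow> nat \<Rightarrow> real" where
  "tail2 b k = (\<Sum>m. (norm (b (m + k)))\<^sup>2)"

lemma tail2_tendsto: "l2 b \<Longrightarrow> tail2 b \<longlonglongrightarrow> 0"
  unfolding l2_def tail2_def[abs_def] by (rule suminf_exist_split2)

lemma tail2_nonneg: "l2 b \<Longrightarrow> 0 \<le> tail2 b k"
  unfolding l2_def tail2_def by (intro suminf_nonneg) (auto intro: summable_ignore_initial_segment)

lemma sum_le_tail2:
  assumes "l2 b"
  shows "(\<Sum>m<l. (norm (if m < k then 0 else b m))\<^sup>2) \<le> tail2 b k"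
proof -
  have s: "summable (\<lambda>m. (norm (b (m + k)))\<^sup>2)"
    using assms unfolding l2_def by (rule summable_ignore_initial_segment)
  have "(\<Sum>m<l. (norm (if m < k then 0 else b m))\<^sup>2) = (\<Sum>m=k..<l. (norm (b m))\<^sup>2)"
    by (rule sum.mono_neutral_cong_right) auto
  also have "\<dots> \<le> (\<Sum>m=k..<l + k. (norm (b m))\<^sup>2)"
    by (rule sum_mono2) auto
  also have "\<dots> = (\<Sum>m<l. (norm (b (m + k)))\<^sup>2)"
    using sum.shift_bounds_nat_ivl[of "\<lambda>m. (norm (b m))\<^sup>2" 0 k l] by (simp add: lessThan_atLeast0)
  also have "\<dots> \<le> tail2 b k"
    unfolding tail2_def by (rule sum_le_suminf[OF s]) auto
  finally show ?thesis .
qed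

lemma integral_radsum_diff_le:
  fixes b :: "nat \<Rightarrow> 'k::euclidean_space"
  assumes b: "l2 b" and q: "0 < q" and kl: "k \<le> l"
  shows "(LINT t|UI. norm (radsum l 0 b t - radsum k 0 b t) powr q)
    \<le> khinchine_const TYPE('k) q * tail2 b k powr (q / 2)"
proof -
  have "(LINT t|UI. norm (radsum l 0 b t - radsum k 0 b t) powr q)
     = signed_avg (\<lambda>z. norm z powr q) l 0 (\<lambda>m. if m < k then 0 else b m)"
    unfolding radsum_diff[OF kl] by (rule integral_radsum)
  also have "\<dots> \<le> khinchine_const TYPE('k) q * (\<Sum>m<l. (norm (if m < k then 0 else b m))\<^sup>2) powr (q / 2)"
    by (rule khinchine_signed_avg[OF q])
  also have "\<dots> \<le> khinchine_const TYPE('k) q * tail2 b k powr (q / 2)"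
    using q khinchine_const_pos[OF q, where 'k = 'k] sum_le_tail2[OF b]
    by (intro mult_left_mono powr_mono2) (auto intro!: sum_nonneg)
  finally show ?thesis .
qed

lemma khinchine_tail_tendsto:
  fixes b :: "nat \<Rightarrow> 'k::euclidean_space"
  assumes "l2 b" "0 < q"
  shows "(\<lambda>k. khinchine_const TYPE('k) q * tail2 b k powr (q / 2)) \<longlonglongrightarrow> 0"
  using assms tendsto_powr'[OF tail2_tendsto[OF assms(1)] tendsto_const, of "q / 2"] tail2_nonneg[OF assms(1)]
  by (intro tendsto_mult_right_zero) auto

text \<open>Khinchine's inequality for exponent 1 makes the partial sums Cauchy in mean, so a
  subsequence converges almost everywhere. The Khinchine bounds for every other exponent are uniform
  in the upper index and pass to this pointwise limit by Fatou's lemma.\<close>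

lemma exists_radlim:
  fixes b :: "nat \<Rightarrow> 'k::euclidean_space"
  assumes b: "l2 b"
  shows "\<exists>g. is_radlim b g"
proof -
  let ?S = "\<lambda>k. radsum k 0 b"
  let ?K = "\<lambda>q k. khinchine_const TYPE('k) q * tail2 b k powr (q / 2)"
  have int: "integrable UI (?S k)" for k
    using integrable_radsum[of "\<lambda>z. norm z" k 0 b] by (simp add: integrable_norm_iff)
  have cauchy: "\<exists>N. \<forall>i\<ge>N. \<forall>j\<ge>N. LINT t|UI. norm (?S i t - ?S j t) < e" if "e > 0" for e
  proof -
    have "eventually (\<lambda>k. ?K 1 k < e / 2) sequentially"
      using order_tendstoD(2)[OF khinchine_tail_tendsto[OF b, of 1], of "e / 2"] that by simp
    then obtain N where N: "?K 1 N < e / 2"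
      by (auto simp: eventually_sequentially)
    have le: "(LINT t|UI. norm (?S i t - ?S N t)) < e / 2" if "i \<ge> N" for i
      using integral_radsum_diff_le[OF b, of 1 N i] that N by simp
    have "(LINT t|UI. norm (?S i t - ?S j t)) < e" if "i \<ge> N" "j \<ge> N" for i j
    proof -
      have "(LINT t|UI. norm (?S i t - ?S j t)) \<le> (LINT t|UI. norm (?S i t - ?S N t) + norm (?S j t - ?S N t))"
        using int by (intro integral_mono) (auto intro: norm_triangle_ineq4 order_trans[OF _ norm_triangle_ineq4])
      also have "\<dots> = (LINT t|UI. norm (?S i t - ?S N t)) + (LINT t|UI. norm (?S j t - ?S N t))"
        using int by (intro Bochner_Integration.integral_add) auto
      finally show ?thesis using le[of i] le[of j] that by simp
    qed
    then show ?thesis by blast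
  qed
  obtain r where r: "strict_mono r" "AE t in UI. Cauchy (\<lambda>i. ?S (r i) t)"
    using cauchy_L1_AE_cauchy_subseq[OF int cauchy] by blast
  define g where "g t = lim (\<lambda>i. ?S (r i) t)" for t
  have g_meas [measurable]: "g \<in> borel_measurable UI"
    unfolding g_def[abs_def] by (rule borel_measurable_lim_metric) measurable
  have conv: "AE t in UI. (\<lambda>i. ?S (r i) t) \<longlonglongrightarrow> g t"
    using r(2) by (auto simp: g_def Cauchy_convergent_iff convergent_LIMSEQ_iff elim!: eventually_mono)
  have fatou: "(\<integral>\<^sup>+t. norm (g t - ?S k t) powr q \<partial>UI) \<le> ?K q k" if q: "1 \<le> q" for q k
  proof -
    have "(\<integral>\<^sup>+t. norm (g t - ?S k t) powr q \<partial>UI)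
       = (\<integral>\<^sup>+t. liminf (\<lambda>i. ennreal (norm (?S (r i) t - ?S k t) powr q)) \<partial>UI)"
    proof (rule nn_integral_cong_AE, use conv in eventually_elim)
      fix t assume "(\<lambda>i. ?S (r i) t) \<longlonglongrightarrow> g t"
      then have "(\<lambda>i. ennreal (norm (?S (r i) t - ?S k t) powr q)) \<longlonglongrightarrow> ennreal (norm (g t - ?S k t) powr q)"
        using q by (intro tendsto_ennrealI tendsto_powr' tendsto_norm tendsto_diff tendsto_const) auto
      then show "ennreal (norm (g t - ?S k t) powr q) = liminf (\<lambda>i. ennreal (norm (?S (r i) t - ?S k t) powr q))"
        by (intro lim_imp_Liminf[symmetric]) auto
    qed
    also have "\<dots> \<le> liminf (\<lambda>i. \<integral>\<^sup>+t. ennreal (norm (?S (r i) t - ?S k t) powr q) \<partial>UI)"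
      by (rule nn_integral_liminf) measurable
    also have "\<dots> \<le> liminf (\<lambda>i. ennreal (?K q k))"
    proof (rule Liminf_mono, rule eventually_mono[OF eventually_ge_at_top[of k]])
      fix i assume "i \<ge> k"
      then have ki: "k \<le> r i" using seq_suble[OF r(1), of i] by simp
      have "integrable UI (\<lambda>t. norm (?S (r i) t - ?S k t) powr q)"
        unfolding radsum_diff[OF ki] by (rule integrable_radsum)
      then have "(\<integral>\<^sup>+t. ennreal (norm (?S (r i) t - ?S k t) powr q) \<partial>UI)
          = ennreal (LINT t|UI. norm (?S (r i) t - ?S k t) powr q)"
        by (intro nn_integral_eq_integral) auto
      also have "\<dots> \<le> ennreal (?K q k)"
        using integral_radsum_diff_le[OF b _ ki, of q] q by (intro ennreal_leI) auto
      finally show "(\<integral>\<^sup>+t. ennreal (norm (?S (r i) t - ?S k t) powr q) \<partial>UI) \<le> ennreal (?K q k)" .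
    qed
    also have "\<dots> = ennreal (?K q k)" by (simp add: Liminf_const)
    finally show ?thesis .
  qed
  have int': "integrable UI (\<lambda>t. norm (g t - ?S k t) powr q)" if "1 \<le> q" for q k
    using fatou[OF that, of k] by (auto simp: integrable_iff_bounded intro: le_less_trans)
  have le: "(LINT t|UI. norm (g t - ?S k t) powr q) \<le> ?K q k" if "1 \<le> q" for q k
  proof -
    have "ennreal (LINT t|UI. norm (g t - ?S k t) powr q) \<le> ennreal (?K q k)"
      using fatou[OF that, of k] int'[OF that, of k] by (subst nn_integral_eq_integral[symmetric]) auto
    then show ?thesis
      using that khinchine_const_pos[of q, where 'k = 'k] by (subst (asm) ennreal_le_iff) auto
  qed
  have "(\<lambda>k. LINT t|UI. norm (g t - ?S k t) powr q) \<longlonglongrightarrow> 0" if "1 \<le> q" for q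
    by (rule tendsto_sandwich[OF _ _ tendsto_const khinchine_tail_tendsto[OF b, of q]])
      (use le[OF that] that in auto)
  moreover have "integrable UI (\<lambda>t. norm (g t) powr q)" if "1 \<le> q" for q
    using int'[OF that, of 0] by simp
  ultimately have "is_radlim b g"
    using int' unfolding is_radlim_def by simp
  then show ?thesis by blast
qed

text \<open>\<open>x + y\<close> is a convex combination of \<open>x / (1 - d)\<close> and
  \<open>y / d\<close>. For small \<open>d\<close> the factor of \<open>x\<close> is close to 1, so
  a vanishing \<open>y\<close> perturbs the integral of a q-th power by a vanishing amount.\<close>

lemma norm_powr_add_le:
  fixes x y :: "'k::real_normed_vector"
  assumes q: "1 \<le> q" and d: "0 < d" "d < 1"
  shows "norm (x + y) powr q \<le> (1 - d) powr (1 - q) * norm x powr q + d powr (1 - q) * norm y powr q"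
proof -
  have "x + y = (1 - d) *\<^sub>R (x /\<^sub>R (1 - d)) + d *\<^sub>R (y /\<^sub>R d)"
    using d by simp
  then have "norm (x + y) powr q \<le> (1 - d) * norm (x /\<^sub>R (1 - d)) powr q + d * norm (y /\<^sub>R d) powr q"
    using convex_onD[OF convex_on_norm_powr[OF q, where 'k = 'k], of d "x /\<^sub>R (1 - d)" "y /\<^sub>R d"] d by simp
  moreover have "e * norm (z /\<^sub>R e) powr q = e powr (1 - q) * norm z powr q" if "0 < e" for e and z :: 'k
    using that by (simp add: powr_divide powr_diff field_simps)
  ultimately show ?thesis using d by simp
qed

lemma norm_powr_add_le2:
  fixes x y :: "'k::real_normed_vector"
  assumes "1 \<le> q"
  shows "norm (x + y) powr q \<le> 2 powr (q - 1) * (norm x powr q + norm y powr q)"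
proof -
  have "(1/2 :: real) powr (1 - q) = 2 powr (q - 1)"
    using powr_minus_divide[of 2 "1 - q"] by (simp add: powr_divide)
  then show ?thesis
    using norm_powr_add_le[OF assms, of "1/2" x y] by (simp add: distrib_left)
qed

lemma integrable_norm_powr_add:
  fixes f g :: "'a \<Rightarrow> 'k::euclidean_space"
  assumes q: "1 \<le> q" and [measurable]: "f \<in> borel_measurable M" "g \<in> borel_measurable M"
    and "integrable M (\<lambda>t. norm (f t) powr q)" "integrable M (\<lambda>t. norm (g t) powr q)"
  shows "integrable M (\<lambda>t. norm (f t + g t) powr q)"
proof (rule Bochner_Integration.integrable_bound[of M "\<lambda>t. 2 powr (q - 1) * (norm (f t) powr q + norm (g t) powr q)"])
  show "integrable M (\<lambda>t. 2 powr (q - 1) * (norm (f t) powr q + norm (g t) powr q))"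
    using assms(4,5) by simp
  show "AE t in M. norm (norm (f t + g t) powr q) \<le> norm (2 powr (q - 1) * (norm (f t) powr q + norm (g t) powr q))"
    by (rule AE_I2) (simp add: norm_powr_add_le2[OF q])
qed measurable

lemma finite_measure_UI: "finite_measure UI"
  by (rule prob_space.finite_measure[OF prob_space_UI])

lemma integrable_const_UI [simp]: "integrable UI (\<lambda>_. c)"
  by (rule finite_measure.integrable_const[OF finite_measure_UI])

lemma integral_const_UI [simp]: "(LINT t|UI. c) = (c :: 'k::{banach, second_countable_topology})"
  using prob_space.prob_space[OF prob_space_UI] by simp

lemma integrable_of_norm_powr:
  fixes f :: "real \<Rightarrow> 'k::euclidean_space"
  assumes p: "1 \<le> p" and [measurable]: "f \<in> borel_measurable UI"
    and int: "integrable UI (\<lambda>t. norm (f t) powr p)"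
  shows "integrable UI f"
proof (rule Bochner_Integration.integrable_bound[of _ "\<lambda>t. 1 + norm (f t) powr p"])
  have "x \<le> 1 + x powr p" if "0 \<le> x" for x :: real
  proof (cases "x \<le> 1")
    case False
    then show ?thesis using powr_mono[of 1 p x] p by simp
  qed (auto intro: order_trans[of _ 1])
  then show "AE t in UI. norm (f t) \<le> norm (1 + norm (f t) powr p)" by simp
qed (use int in auto)

lemma is_radlim_measurable: "is_radlim b g \<Longrightarrow> g \<in> borel_measurable UI"
  by (simp add: is_radlim_def)

lemma is_radlim_integrable:
  assumes "is_radlim b g"
  shows "1 \<le> q \<Longrightarrow> integrable UI (\<lambda>t. norm (g t) powr q)" "integrable UI g"
proof -
  show *: "integrable UI (\<lambda>t. norm (g t) powr q)" if "1 \<le> q" for q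
    using assms that by (simp add: is_radlim_def)
  show "integrable UI g"
    by (rule integrable_of_norm_powr[OF order_refl is_radlim_measurable[OF assms] *[OF order_refl]])
qed

lemma is_radlim_integrable_diff:
  "is_radlim b g \<Longrightarrow> 1 \<le> q \<Longrightarrow> integrable UI (\<lambda>t. norm (g t - radsum k 0 b t) powr q)"
  by (simp add: is_radlim_def)

lemma is_radlim_unique:
  assumes g: "is_radlim b g" and g': "is_radlim b g'"
  shows "AE t in UI. g t = g' t"
proof -
  have [measurable]: "g \<in> borel_measurable UI" "g' \<in> borel_measurable UI"
    using assms by (auto simp: is_radlim_def)
  have int: "integrable UI (\<lambda>t. norm (g t - radsum k 0 b t))" "integrable UI (\<lambda>t. norm (g' t - radsum k 0 b t))" for k
    using is_radlim_integrable_diff[OF g, of 1] is_radlim_integrable_diff[OF g', of 1] by simp_all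
  have "(\<lambda>k. (LINT t|UI. norm (g t - radsum k 0 b t)) + (LINT t|UI. norm (g' t - radsum k 0 b t))) \<longlonglongrightarrow> 0 + 0"
    using g g' unfolding is_radlim_def by (intro tendsto_add) (auto dest!: spec[of _ 1])
  moreover have "(LINT t|UI. norm (g t - g' t)) \<le>
      (LINT t|UI. norm (g t - radsum k 0 b t)) + (LINT t|UI. norm (g' t - radsum k 0 b t))" for k
  proof -
    have "(LINT t|UI. norm (g t - g' t)) \<le> (LINT t|UI. norm (g t - radsum k 0 b t) + norm (g' t - radsum k 0 b t))"
    proof (rule integral_mono)
      show "integrable UI (\<lambda>t. norm (g t - g' t))"
        using is_radlim_integrable(2)[OF g] is_radlim_integrable(2)[OF g'] by auto
      show "integrable UI (\<lambda>t. norm (g t - radsum k 0 b t) + norm (g' t - radsum k 0 b t))"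
        using int[of k] by (rule Bochner_Integration.integrable_add)
      show "norm (g t - g' t) \<le> norm (g t - radsum k 0 b t) + norm (g' t - radsum k 0 b t)" for t
        using norm_triangle_ineq4[of "g t - radsum k 0 b t" "g' t - radsum k 0 b t"] by simp
    qed
    also have "\<dots> = (LINT t|UI. norm (g t - radsum k 0 b t)) + (LINT t|UI. norm (g' t - radsum k 0 b t))"
      using int[of k] by (rule Bochner_Integration.integral_add)
    finally show ?thesis .
  qed
  ultimately have "(LINT t|UI. norm (g t - g' t)) \<le> 0"
    by (intro LIMSEQ_le_const) (auto intro!: exI[of _ 0])
  moreover have "integrable UI (\<lambda>t. norm (g t - g' t))"
    using is_radlim_integrable(2)[OF g] is_radlim_integrable(2)[OF g'] by auto
  ultimately have "AE t in UI. norm (g t - g' t) = 0"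
    by (subst integral_nonneg_eq_0_iff_AE[symmetric]) (auto intro: antisym)
  then show ?thesis by simp
qed

lemma is_radlim_add:
  assumes g: "is_radlim b g" and g': "is_radlim b' g'"
  shows "is_radlim (\<lambda>m. b m + b' m) (\<lambda>t. g t + g' t)"
proof -
  have [measurable]: "g \<in> borel_measurable UI" "g' \<in> borel_measurable UI"
    using assms by (auto simp: is_radlim_def)
  have eq: "g t + g' t - radsum k 0 (\<lambda>m. b m + b' m) t = (g t - radsum k 0 b t) + (g' t - radsum k 0 b' t)" for k t
    using radsum_add[of k 0 0 b b' t] by simp
  have int: "integrable UI (\<lambda>t. norm (g t - radsum k 0 b t) powr q)"
    "integrable UI (\<lambda>t. norm (g' t - radsum k 0 b' t) powr q)" if "1 \<le> q" for k q
    using g g' that by (auto simp: is_radlim_def)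
  have int': "integrable UI (\<lambda>t. norm ((g t - radsum k 0 b t) + (g' t - radsum k 0 b' t)) powr q)" if "1 \<le> q" for k q
    by (rule integrable_norm_powr_add[OF that]) (use int[OF that] in auto)
  have "(\<lambda>k. LINT t|UI. norm ((g t - radsum k 0 b t) + (g' t - radsum k 0 b' t)) powr q) \<longlonglongrightarrow> 0" if q: "1 \<le> q" for q
  proof (rule tendsto_sandwich[OF _ _ tendsto_const])
    show "(\<lambda>k. 2 powr (q - 1) * ((LINT t|UI. norm (g t - radsum k 0 b t) powr q)
        + (LINT t|UI. norm (g' t - radsum k 0 b' t) powr q))) \<longlonglongrightarrow> 0"
      using g g' q unfolding is_radlim_def by (intro tendsto_mult_right_zero tendsto_add_zero) auto
    have "(LINT t|UI. norm ((g t - radsum k 0 b t) + (g' t - radsum k 0 b' t)) powr q) \<le>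
      (LINT t|UI. 2 powr (q - 1) * (norm (g t - radsum k 0 b t) powr q + norm (g' t - radsum k 0 b' t) powr q))" for k
      by (rule integral_mono[OF int'[OF q]]) (simp add: int[OF q], rule norm_powr_add_le2[OF q])
    then show "\<forall>\<^sub>F k in sequentially. (LINT t|UI. norm ((g t - radsum k 0 b t) + (g' t - radsum k 0 b' t)) powr q)
        \<le> 2 powr (q - 1) * ((LINT t|UI. norm (g t - radsum k 0 b t) powr q)
        + (LINT t|UI. norm (g' t - radsum k 0 b' t) powr q))"
      using int[OF q] by simp
  qed (auto intro!: eventuallyI)
  moreover have "integrable UI (\<lambda>t. norm (g t + g' t) powr q)" if "1 \<le> q" for q
    using int'[OF that, of 0] by simp
  ultimately show ?thesis
    using int' unfolding is_radlim_def eq by auto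
qed

lemma is_radlim_mult:
  fixes b :: "nat \<Rightarrow> 'k::{real_normed_field, euclidean_space}"
  assumes g: "is_radlim b g"
  shows "is_radlim (\<lambda>m. z * b m) (\<lambda>t. z * g t)"
proof -
  have [measurable]: "g \<in> borel_measurable UI"
    using assms by (auto simp: is_radlim_def)
  have eq: "z * g t - radsum k 0 (\<lambda>m. z * b m) t = z * (g t - radsum k 0 b t)" for k t
    by (simp add: radsum_def right_diff_distrib sum_distrib_left)
  have "(\<lambda>k. norm z powr q * (LINT t|UI. norm (g t - radsum k 0 b t) powr q)) \<longlonglongrightarrow> 0" if "1 \<le> q" for q
    using g that unfolding is_radlim_def by (intro tendsto_mult_right_zero) auto
  then show ?thesis
    using g unfolding is_radlim_def eq by (auto simp: norm_mult powr_mult)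
qed

text \<open>The limit is an arbitrary choice for each \<open>b\<close>; by
  \<open>is_radlim_unique\<close> it is determined almost everywhere, so linearity holds only in
  that sense.\<close>

definition rlim :: "(nat \<Rightarrow> 'k::euclidean_space) \<Rightarrow> real \<Rightarrow> 'k" where
  "rlim b = (SOME g. is_radlim b g)"

lemma is_radlim_rlim: "l2 b \<Longrightarrow> is_radlim b (rlim b)"
  unfolding rlim_def by (rule someI_ex[OF exists_radlim])

lemma rlim_measurable [measurable]: "l2 b \<Longrightarrow> rlim b \<in> borel_measurable UI"
  by (rule is_radlim_measurable[OF is_radlim_rlim])

lemma rlim_add:
  assumes "l2 b" "l2 b'"
  shows "AE t in UI. rlim (\<lambda>m. b m + b' m) t = rlim b t + rlim b' t"
  by (rule is_radlim_unique[OF is_radlim_rlim[OF l2_add[OF assms]]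
    is_radlim_add[OF is_radlim_rlim[OF assms(1)] is_radlim_rlim[OF assms(2)]]])

lemma rlim_mult:
  fixes b :: "nat \<Rightarrow> 'k::{real_normed_field, euclidean_space}"
  assumes "l2 b"
  shows "AE t in UI. rlim (\<lambda>m. z * b m) t = z * rlim b t"
proof -
  have "l2 (\<lambda>m. z * b m)"
    by (rule l2_mult[OF assms, of _ "norm z"]) (simp add: norm_mult)
  from is_radlim_unique[OF is_radlim_rlim[OF this] is_radlim_mult[OF is_radlim_rlim[OF assms]]]
  show ?thesis .
qed

lemma integrable_rlim:
  assumes "l2 b" "1 \<le> q"
  shows "integrable UI (\<lambda>t. norm (c + rlim b t) powr q)"
  by (rule integrable_norm_powr_add[OF assms(2)])
    (use assms is_radlim_integrable(1)[OF is_radlim_rlim[OF assms(1)] assms(2)] in auto)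

section \<open>Moments of a centre plus a Rademacher series\<close>

definition rnorm :: "real \<Rightarrow> 'k::euclidean_space \<Rightarrow> (nat \<Rightarrow> 'k) \<Rightarrow> real" where
  "rnorm q c b = (LINT t|UI. norm (c + rlim b t) powr q)"

text \<open>The averages are increasing and bounded, so they have a limit.
  \<open>norm_powr_add_le\<close> compares them with \<open>rnorm\<close> in both directions; for
  fixed \<open>d\<close> the error disappears as k grows, and letting \<open>d\<close> tend to 0
  identifies the limit. All inequalities between averages are thereby inherited by
  \<open>rnorm\<close>.\<close>

lemma signed_avg_tendsto_rnorm:
  assumes b: "l2 b" and q: "1 \<le> q"
  shows "(\<lambda>k. signed_avg (\<lambda>z. norm z powr q) k c b) \<longlonglongrightarrow> rnorm q c b"
proof -
  define a where "a k = signed_avg (\<lambda>z. norm z powr q) k c b" for k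
  define e where "e k = (LINT t|UI. norm (rlim b t - radsum k 0 b t) powr q)" for k
  have rl: "is_radlim b (rlim b)" by (rule is_radlim_rlim[OF b])
  have [measurable]: "rlim b \<in> borel_measurable UI" using b by measurable
  have e: "e \<longlonglongrightarrow> 0" using rl q unfolding is_radlim_def e_def[abs_def] by auto
  have int_e: "integrable UI (\<lambda>t. norm (rlim b t - radsum k 0 b t) powr q)" for k
    using rl q unfolding is_radlim_def by auto
  have a_eq: "a k = (LINT t|UI. norm (radsum k c b t) powr q)"
    and int_a: "integrable UI (\<lambda>t. norm (radsum k c b t) powr q)" for k
    unfolding a_def by (rule integral_radsum[symmetric], rule integrable_radsum)
  have c_eq: "radsum k c b t = c + radsum k 0 b t" for k t
    by (simp add: radsum_def)
  have 1: "a k \<le> (1 - d) powr (1 - q) * rnorm q c b + d powr (1 - q) * e k" if d: "0 < d" "d < 1" for d k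
  proof -
    have "a k \<le> (LINT t|UI. (1 - d) powr (1 - q) * norm (c + rlim b t) powr q
        + d powr (1 - q) * norm (rlim b t - radsum k 0 b t) powr q)"
      unfolding a_eq
    proof (rule integral_mono[OF int_a])
      show "norm (radsum k c b t) powr q \<le> (1 - d) powr (1 - q) * norm (c + rlim b t) powr q
        + d powr (1 - q) * norm (rlim b t - radsum k 0 b t) powr q" for t
        using norm_powr_add_le[OF q d, of "c + rlim b t" "- (rlim b t - radsum k 0 b t)"]
        unfolding norm_minus_cancel by (simp add: c_eq)
    qed (use integrable_rlim[OF b q] int_e in auto)
    also have "\<dots> = (1 - d) powr (1 - q) * rnorm q c b + d powr (1 - q) * e k"
      using integrable_rlim[OF b q, of c] int_e[of k] by (simp add: rnorm_def e_def)
    finally show ?thesis .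
  qed
  have 2: "rnorm q c b \<le> (1 - d) powr (1 - q) * a k + d powr (1 - q) * e k" if d: "0 < d" "d < 1" for d k
  proof -
    have "rnorm q c b \<le> (LINT t|UI. (1 - d) powr (1 - q) * norm (radsum k c b t) powr q
        + d powr (1 - q) * norm (rlim b t - radsum k 0 b t) powr q)"
      unfolding rnorm_def
    proof (rule integral_mono[OF integrable_rlim[OF b q]])
      show "norm (c + rlim b t) powr q \<le> (1 - d) powr (1 - q) * norm (radsum k c b t) powr q
        + d powr (1 - q) * norm (rlim b t - radsum k 0 b t) powr q" for t
        using norm_powr_add_le[OF q d, of "radsum k c b t" "rlim b t - radsum k 0 b t"] by (simp add: c_eq)
    qed (use int_a int_e in auto)
    also have "\<dots> = (1 - d) powr (1 - q) * a k + d powr (1 - q) * e k"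
      using int_a[of k] int_e[of k] by (simp add: a_eq e_def)
    finally show ?thesis .
  qed
  have "incseq a"
    unfolding a_def by (intro incseq_SucI signed_avg_incr convex_on_norm_powr q)
  moreover have "bdd_above (range a)"
  proof -
    have "Bseq e" using e by (rule convergent_imp_Bseq[OF convergentI])
    then obtain K where "\<And>k. norm (e k) \<le> K" unfolding Bseq_def by blast
    then have K: "e k \<le> K" for k
      by (metis abs_ge_self order_trans real_norm_def)
    have "a k \<le> (1 - 1/2) powr (1 - q) * rnorm q c b + (1/2) powr (1 - q) * K" for k
      by (rule order_trans[OF 1[of "1/2" k]]) (auto intro!: mult_left_mono K)
    then show ?thesis by (intro bdd_aboveI2)
  qed
  ultimately obtain L where L: "a \<longlonglongrightarrow> L"
    using LIMSEQ_incseq_SUP[of a] by blast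
  have r1: "((\<lambda>d. (1 - d) powr (1 - q) * x) \<longlongrightarrow> (1 - 0) powr (1 - q) * x) (at_right 0)" for x :: real
    by (intro tendsto_intros) auto
  have small: "eventually (\<lambda>d::real. 0 < d \<and> d < 1) (at_right 0)"
    by (auto simp: eventually_at_right[OF zero_less_one] intro!: exI[of _ 1])
  have "L \<le> (1 - d) powr (1 - q) * rnorm q c b + d powr (1 - q) * 0" if d: "0 < d" "d < 1" for d
  proof (rule LIMSEQ_le[OF L])
    show "(\<lambda>k. (1 - d) powr (1 - q) * rnorm q c b + d powr (1 - q) * e k)
        \<longlonglongrightarrow> (1 - d) powr (1 - q) * rnorm q c b + d powr (1 - q) * 0"
      by (intro tendsto_add tendsto_const tendsto_mult e)
  qed (intro exI allI impI 1[OF d])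
  then have "L \<le> (1 - 0) powr (1 - q) * rnorm q c b"
    by (intro tendsto_lowerbound[OF r1] eventually_mono[OF small]) auto
  moreover have "rnorm q c b \<le> (1 - d) powr (1 - q) * L + d powr (1 - q) * 0" if d: "0 < d" "d < 1" for d
  proof (rule LIMSEQ_le[OF tendsto_const])
    show "(\<lambda>k. (1 - d) powr (1 - q) * a k + d powr (1 - q) * e k)
        \<longlonglongrightarrow> (1 - d) powr (1 - q) * L + d powr (1 - q) * 0"
      by (intro tendsto_add tendsto_const tendsto_mult e L)
  qed (intro exI allI impI 2[OF d])
  then have "rnorm q c b \<le> (1 - 0) powr (1 - q) * L"
    by (intro tendsto_lowerbound[OF r1] eventually_mono[OF small]) auto
  ultimately have "L = rnorm q c b" by simp
  then show ?thesis using L unfolding a_def[abs_def] by simp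
qed

lemma rnorm_nonneg: "0 \<le> rnorm q c b"
  by (simp add: rnorm_def)

lemma rnorm_convex:
  assumes b: "l2 b" "l2 b'" and q: "1 \<le> q" and st: "0 \<le> s" "0 \<le> t" "s + t = 1"
  shows "rnorm q (s *\<^sub>R c + t *\<^sub>R c') (\<lambda>m. s *\<^sub>R b m + t *\<^sub>R b' m) \<le> s * rnorm q c b + t * rnorm q c' b'"
proof -
  have l: "l2 (\<lambda>m. s *\<^sub>R b m + t *\<^sub>R b' m)"
    by (intro l2_add l2_mult[OF b(1), of _ s] l2_mult[OF b(2), of _ t]) (use st in auto)
  show ?thesis
    by (rule LIMSEQ_le[OF signed_avg_tendsto_rnorm[OF l q]
        tendsto_add[OF tendsto_mult[OF tendsto_const signed_avg_tendsto_rnorm[OF b(1) q]]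
          tendsto_mult[OF tendsto_const signed_avg_tendsto_rnorm[OF b(2) q]]]])
      (intro exI allI impI signed_avg_convex[OF convex_on_norm_powr[OF q] st])
qed

lemma rnorm_contract:
  assumes b: "l2 b" and q: "1 \<le> q" and s: "\<bar>s\<bar> \<le> 1" and e: "\<And>m. \<bar>e m\<bar> \<le> 1"
  shows "rnorm q (s *\<^sub>R c) (\<lambda>m. e m *\<^sub>R b m) \<le> rnorm q c b"
proof -
  have l: "l2 (\<lambda>m. e m *\<^sub>R b m)"
    by (rule l2_mult[OF b, of _ 1]) (use e in \<open>auto intro: mult_left_le_one_le\<close>)
  show ?thesis
    by (rule LIMSEQ_le[OF signed_avg_tendsto_rnorm[OF l q] signed_avg_tendsto_rnorm[OF b q]])
      (intro exI allI impI signed_avg_contract[OF convex_on_norm_powr[OF q] _ s e] norm_minus_cancel[THEN arg_cong])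
qed

text \<open>A leading zero coefficient only delays the sequence of averages by one index.\<close>

lemma rnorm_shift:
  assumes b: "l2 b" and q: "1 \<le> q"
  shows "rnorm q c (case_nat 0 b) = rnorm q c b"
proof -
  have "(\<lambda>k. signed_avg (\<lambda>z. norm z powr q) (Suc k) c (case_nat 0 b)) \<longlonglongrightarrow> rnorm q c (case_nat 0 b)"
    by (rule LIMSEQ_Suc[OF signed_avg_tendsto_rnorm[OF l2_shift[OF b] q]])
  then show ?thesis
    unfolding signed_avg_shift by (rule LIMSEQ_unique[OF _ signed_avg_tendsto_rnorm[OF b q]])
qed

lemma rnorm_scale:
  fixes b :: "nat \<Rightarrow> 'k::euclidean_space"
  assumes b: "l2 b" and q: "1 \<le> q" and s: "0 \<le> s"
  shows "rnorm q (s *\<^sub>R c) (\<lambda>m. s *\<^sub>R b m) = s powr q * rnorm q c b"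
proof -
  have l: "l2 (\<lambda>m. s *\<^sub>R b m)" by (rule l2_mult[OF b, of _ s]) (use s in auto)
  have "(\<lambda>k. s powr q * signed_avg (\<lambda>z. norm z powr q) k c b) \<longlonglongrightarrow> rnorm q (s *\<^sub>R c) (\<lambda>m. s *\<^sub>R b m)"
    using signed_avg_tendsto_rnorm[OF l q, of "s *\<^sub>R c"]
      signed_avg_homogeneous[where F = "\<lambda>z::'k. norm z powr q" and s = s and a = "s powr q"] s
    by (simp add: powr_mult)
  then show ?thesis
    using LIMSEQ_unique tendsto_mult[OF tendsto_const signed_avg_tendsto_rnorm[OF b q]] by blast
qed

lemma rnorm_zero:
  assumes "1 \<le> q"
  shows "rnorm q c (\<lambda>_. 0 :: 'k::euclidean_space) = norm c powr q"
proof -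
  have "l2 (\<lambda>_. 0 :: 'k)" by (simp add: l2_def)
  from signed_avg_tendsto_rnorm[OF this assms, of c] show ?thesis
    by (simp add: signed_avg_zero LIMSEQ_const_iff)
qed

lemma rnorm_le_tail:
  fixes b :: "nat \<Rightarrow> 'k::euclidean_space"
  assumes b: "l2 b" and q: "1 \<le> q"
  shows "rnorm q 0 (\<lambda>m. if m < n then 0 else b m) \<le> khinchine_const TYPE('k) q * tail2 b n powr (q / 2)"
proof -
  have l: "l2 (\<lambda>m. if m < n then 0 else b m)"
    by (rule l2_mult[OF b, of _ 1]) auto
  have "signed_avg (\<lambda>z. norm z powr q) k 0 (\<lambda>m. if m < n then 0 else b m)
      \<le> khinchine_const TYPE('k) q * tail2 b n powr (q / 2)" for k
  proof (rule order_trans[OF khinchine_signed_avg])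
    show "khinchine_const TYPE('k) q * (\<Sum>m<k. (norm (if m < n then 0 else b m))\<^sup>2) powr (q / 2)
      \<le> khinchine_const TYPE('k) q * tail2 b n powr (q / 2)"
      using q khinchine_const_pos[of q, where 'k = 'k] sum_le_tail2[OF b]
      by (intro mult_left_mono powr_mono2) (auto intro!: sum_nonneg)
  qed (use q in auto)
  then show ?thesis
    by (intro LIMSEQ_le_const2[OF signed_avg_tendsto_rnorm[OF l q]]) auto
qed

section \<open>Shift-invariant sets of pairs\<close>

text \<open>The q-th power of the \<open>L_q\<close> norm of the function equal to
  \<open>\<alpha> *\<^sub>R c\<close> on the left half and to \<open>\<beta> *\<^sub>R c\<close>
  plus the Rademacher series on the right half. With \<open>\<alpha> = 0\<close> centre and
  oscillation share a half of the range; with \<open>\<beta> = 0\<close> they are apart.\<close>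

definition pair_energy :: "real \<Rightarrow> real \<Rightarrow> real \<Rightarrow> 'k::euclidean_space \<Rightarrow> (nat \<Rightarrow> 'k) \<Rightarrow> real" where
  "pair_energy q \<alpha> \<beta> c b = (\<alpha> powr q * norm c powr q + rnorm q (\<beta> *\<^sub>R c) b) / 2"

lemma pair_energy_convex:
  fixes b b' :: "nat \<Rightarrow> 'k::euclidean_space"
  assumes b: "l2 b" "l2 b'" and q: "1 \<le> q" and st: "0 \<le> s" "0 \<le> t" "s + t = 1"
  shows "pair_energy q \<alpha> \<beta> (s *\<^sub>R c + t *\<^sub>R c') (\<lambda>m. s *\<^sub>R b m + t *\<^sub>R b' m)
    \<le> s * pair_energy q \<alpha> \<beta> c b + t * pair_energy q \<alpha> \<beta> c' b'"
proof -
  have "norm (s *\<^sub>R c + t *\<^sub>R c') powr q \<le> s * norm c powr q + t * norm c' powr q"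
    using convex_on_norm_powr[OF q, where 'k = 'k] st by (auto simp: convex_on_def)
  then have "\<alpha> powr q * norm (s *\<^sub>R c + t *\<^sub>R c') powr q \<le> \<alpha> powr q * (s * norm c powr q + t * norm c' powr q)"
    by (rule mult_left_mono) simp
  moreover have "\<beta> *\<^sub>R (s *\<^sub>R c + t *\<^sub>R c') = s *\<^sub>R (\<beta> *\<^sub>R c) + t *\<^sub>R (\<beta> *\<^sub>R c')"
    by (simp add: algebra_simps)
  ultimately show ?thesis
    using rnorm_convex[OF b q st, of "\<beta> *\<^sub>R c" "\<beta> *\<^sub>R c'"] unfolding pair_energy_def
    by (simp only:) (simp add: field_simps)
qed

lemma pair_energy_contract:
  assumes b: "l2 b" and q: "1 \<le> q" and s: "\<bar>s\<bar> \<le> 1" and e: "\<And>m. \<bar>e m\<bar> \<le> 1"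
  shows "pair_energy q \<alpha> \<beta> (s *\<^sub>R c) (\<lambda>m. e m *\<^sub>R b m) \<le> pair_energy q \<alpha> \<beta> c b"
proof -
  have "norm (s *\<^sub>R c) \<le> norm c"
    using s by (simp add: mult_left_le_one_le)
  then have "norm (s *\<^sub>R c) powr q \<le> norm c powr q"
    using q by (intro powr_mono2) auto
  then have "\<alpha> powr q * norm (s *\<^sub>R c) powr q \<le> \<alpha> powr q * norm c powr q"
    by (rule mult_left_mono) simp
  moreover have "\<beta> *\<^sub>R s *\<^sub>R c = s *\<^sub>R \<beta> *\<^sub>R c" by simp
  ultimately show ?thesis
    using rnorm_contract[OF b q s, where e = e and c = "\<beta> *\<^sub>R c"] e unfolding pair_energy_def
    by (intro divide_right_mono add_mono) (auto simp: mult.commute)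
qed

lemma pair_energy_shift:
  "l2 b \<Longrightarrow> 1 \<le> q \<Longrightarrow> pair_energy q \<alpha> \<beta> c (case_nat 0 b) = pair_energy q \<alpha> \<beta> c b"
  by (simp add: pair_energy_def rnorm_shift)

lemma pair_energy_scale:
  assumes "l2 b" "1 \<le> q" "0 \<le> s"
  shows "pair_energy q \<alpha> \<beta> (s *\<^sub>R c) (\<lambda>m. s *\<^sub>R b m) = s powr q * pair_energy q \<alpha> \<beta> c b"
proof -
  have "\<beta> *\<^sub>R s *\<^sub>R c = s *\<^sub>R \<beta> *\<^sub>R c" by simp
  then show ?thesis
    using rnorm_scale[OF assms, of "\<beta> *\<^sub>R c"] assms
    by (simp add: pair_energy_def powr_mult algebra_simps)
qed

lemma pair_energy_no_coeffs:
  assumes "1 \<le> q" "0 \<le> \<beta>"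
  shows "pair_energy q \<alpha> \<beta> c (\<lambda>_. 0) = (\<alpha> powr q + \<beta> powr q) / 2 * norm c powr q"
  using assms by (simp add: pair_energy_def rnorm_zero powr_mult algebra_simps add_divide_distrib)

lemma pair_energy_no_center: "pair_energy q \<alpha> \<beta> 0 b = rnorm q 0 b / 2"
  by (simp add: pair_energy_def)

lemma pair_energy_nonneg: "0 \<le> pair_energy q \<alpha> \<beta> c b"
  by (simp add: pair_energy_def rnorm_nonneg)

lemma l2_zero: "l2 (\<lambda>_. 0)"
  by (simp add: l2_def)

text \<open>The pair is a convex combination of (c/(1-d), 0) and (0, b/d); homogeneity of degree
  \<open>q\<close> turns the weights into their powers with exponent 1 - q.\<close>

lemma pair_energy_split:
  assumes b: "l2 b" and q: "1 \<le> q" and d: "0 < d" "d < 1"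
  shows "pair_energy q \<alpha> \<beta> c b
    \<le> (1 - d) powr (1 - q) * pair_energy q \<alpha> \<beta> c (\<lambda>_. 0) + d powr (1 - q) * pair_energy q \<alpha> \<beta> 0 b"
proof -
  have l: "l2 (\<lambda>m. (1 / d) *\<^sub>R b m)"
    by (rule l2_mult[OF b, of _ "1 / d"]) (use d in auto)
  have "pair_energy q \<alpha> \<beta> c b \<le> (1 - d) * pair_energy q \<alpha> \<beta> ((1 / (1 - d)) *\<^sub>R c) (\<lambda>_. (1 / (1 - d)) *\<^sub>R 0)
      + d * pair_energy q \<alpha> \<beta> ((1 / d) *\<^sub>R 0) (\<lambda>m. (1 / d) *\<^sub>R b m)"
    using pair_energy_convex[OF l2_zero l q, of "1 - d" d \<alpha> \<beta> "(1 / (1 - d)) *\<^sub>R c" 0] d by simp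
  also have "\<dots> = (1 - d) * ((1 / (1 - d)) powr q * pair_energy q \<alpha> \<beta> c (\<lambda>_. 0))
      + d * ((1 / d) powr q * pair_energy q \<alpha> \<beta> 0 b)"
    using d by (simp only: pair_energy_scale[OF l2_zero q] pair_energy_scale[OF b q] divide_nonneg_pos
        zero_le_one diff_gt_0_iff_gt less_imp_le zero_le_divide_1_iff diff_ge_0_iff_ge)
  also have "\<dots> = (1 - d) powr (1 - q) * pair_energy q \<alpha> \<beta> c (\<lambda>_. 0) + d powr (1 - q) * pair_energy q \<alpha> \<beta> 0 b"
  proof -
    have "x * (1 / x) powr q = x powr (1 - q)" if "0 < x" for x :: real
      using that by (simp add: powr_divide powr_diff)
    then show ?thesis using d by (simp only: mult.assoc[symmetric] diff_gt_0_iff_gt)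
  qed
  finally show ?thesis .
qed

text \<open>The multipliers increase to 1 without reaching it.\<close>

definition damp :: "nat \<Rightarrow> real" where
  "damp n = (real n + 1) / (real n + 2)"

lemma damp_pos: "0 < damp n" and damp_less_1: "damp n < 1"
  by (simp_all add: damp_def)

lemma damp_mono: "m \<le> n \<Longrightarrow> damp m \<le> damp n"
  by (simp add: damp_def field_simps)

lemma damp_tendsto: "damp \<longlonglongrightarrow> 1"
  using LIMSEQ_Suc[OF LIMSEQ_n_over_Suc_n[where 'a = real]] by (simp add: damp_def[abs_def] add.commute)

lemma l2_damp: "l2 b \<Longrightarrow> l2 (\<lambda>m. damp m *\<^sub>R b m)"
  by (rule l2_mult[of b _ 1])
    (use damp_pos damp_less_1 in \<open>auto simp: less_imp_le abs_of_pos intro!: mult_left_le_one_le\<close>)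

text \<open>\<open>X\<close> will be the set of values (c(f), b(f)) over a unit ball.
  \<open>M0\<close> bounds the energy without oscillation, \<open>exceeds\<close> says that
  oscillation helps, and the factor \<open>2 powr q\<close> in \<open>coeffs\<close> is what the
  splitting at 1/2 requires to leave M0/2.\<close>

locale shift_invariant_pairs =
  fixes X :: "('k::euclidean_space \<times> (nat \<Rightarrow> 'k)) set" and q \<alpha> \<beta> M0 :: real
  assumes q: "1 \<le> q"
    and l2: "(c, b) \<in> X \<Longrightarrow> l2 b"
    and shift: "(c, b) \<in> X \<Longrightarrow> (c, case_nat 0 b) \<in> X"
    and center: "(c, b) \<in> X \<Longrightarrow> pair_energy q \<alpha> \<beta> c (\<lambda>_. 0) \<le> M0"
    and coeffs: "(c, b) \<in> X \<Longrightarrow> pair_energy q \<alpha> \<beta> 0 b \<le> M0 / 2 powr q"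
    and exceeds: "\<exists>(c, b)\<in>X. M0 < pair_energy q \<alpha> \<beta> c b"
begin

abbreviation E :: "'k \<Rightarrow> (nat \<Rightarrow> 'k) \<Rightarrow> real" where
  "E \<equiv> pair_energy q \<alpha> \<beta>"

definition top_energy :: real where
  "top_energy = (SUP (c, b)\<in>X. E c b)"

lemma E_damp_le: "l2 b \<Longrightarrow> E c (\<lambda>m. damp m *\<^sub>R b m) \<le> E c b"
  using pair_energy_contract[of b q 1 damp \<alpha> \<beta> c] q damp_pos damp_less_1
  by (auto simp: abs_of_pos less_imp_le)

text \<open>The splitting at d = 1/2 costs 2^(q-1), which reduces the bound M0/2^q of
  \<open>coeffs\<close> to M0/2. A pair with a very small centre thus stays well below the supremum;
  this later excludes weakly null maximizing sequences.\<close>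

lemma E_le_center:
  assumes "(c, b) \<in> X"
  shows "E c b \<le> 2 powr (q - 1) * E c (\<lambda>_. 0) + M0 / 2"
proof -
  have half: "(1 / 2 :: real) powr (1 - q) = 2 powr (q - 1)"
    using powr_minus_divide[of 2 "1 - q"] by (simp add: powr_divide)
  have "2 powr (q - 1) * E 0 b \<le> 2 powr (q - 1) * (M0 / 2 powr q)"
    by (rule mult_left_mono[OF coeffs[OF assms]]) simp
  also have "\<dots> = M0 / 2" by (simp add: powr_diff)
  finally show ?thesis
    using pair_energy_split[OF l2[OF assms] q, of "1/2" \<alpha> \<beta> c] half by simp
qed

lemma bdd_above_E: "bdd_above ((\<lambda>(c, b). E c b) ` X)"
proof (rule bdd_aboveI2)
  fix x assume x: "x \<in> X"
  obtain c b where cb: "x = (c, b)" by (cases x)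
  have "E c b \<le> 2 powr (q - 1) * E c (\<lambda>_. 0) + M0 / 2"
    using E_le_center x cb by simp
  also have "\<dots> \<le> 2 powr (q - 1) * M0 + M0 / 2"
    using center[of c b] x cb by (intro add_right_mono mult_left_mono) auto
  finally show "(case x of (c, b) \<Rightarrow> E c b) \<le> 2 powr (q - 1) * M0 + M0 / 2"
    by (simp add: cb)
qed

lemma E_le_top: "(c, b) \<in> X \<Longrightarrow> E c b \<le> top_energy"
  using cSUP_upper[OF _ bdd_above_E, of "(c, b)"] by (simp add: top_energy_def)

lemma M0_less_top: "M0 < top_energy"
  using exceeds E_le_top by (auto intro: less_le_trans)

lemma E_damp_le_center:
  "(c, b) \<in> X \<Longrightarrow> E c (\<lambda>m. damp m *\<^sub>R b m) \<le> 2 powr (q - 1) * E c (\<lambda>_. 0) + M0 / 2"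
  using E_damp_le[OF l2] E_le_center by (meson order_trans)

text \<open>Removing sufficiently many initial coefficients brings the energy close to that of the centre,
  hence below the supremum; the damped pair is dominated by a proper convex combination of the
  original pair and the truncated one.\<close>

lemma E_damp_less_top:
  assumes X: "(c, b) \<in> X"
  shows "E c (\<lambda>m. damp m *\<^sub>R b m) < top_energy"
proof -
  note b = l2[OF X]
  let ?P = "\<lambda>n m. if m < n then 0 else b m"
  have lP: "l2 (?P n)" for n by (rule l2_mult[OF b, of _ 1]) auto
  \<comment> \<open>The order of choices matters: \<open>d\<close> is so small that the splitting
    factor still keeps \<open>M0\<close> below the supremum, and only with \<open>d\<close> fixed is
    \<open>n\<close> taken so large that the tail is negligible despite its factor
    \<open>d powr (1 - q)\<close>.\<close>
  have "((\<lambda>d. (1 - d) powr (1 - q) * M0) \<longlongrightarrow> (1 - 0) powr (1 - q) * M0) (at_right 0)"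
    by (intro tendsto_intros) auto
  then have "eventually (\<lambda>d. (1 - d) powr (1 - q) * M0 < top_energy) (at_right 0)"
    using M0_less_top by (auto dest: order_tendstoD)
  moreover have "eventually (\<lambda>d::real. 0 < d \<and> d < 1) (at_right 0)"
    by (auto simp: eventually_at_right[OF zero_less_one] intro!: exI[of _ 1])
  ultimately have "eventually (\<lambda>d. (1 - d) powr (1 - q) * M0 < top_energy \<and> 0 < d \<and> d < 1) (at_right 0)"
    by (rule eventually_conj)
  then obtain d where d: "(1 - d) powr (1 - q) * M0 < top_energy" "0 < d" "d < 1"
    using eventually_happens[of _ "at_right (0::real)"] by (auto simp: trivial_limit_at_right_real)
  have "(\<lambda>n. (1 - d) powr (1 - q) * M0 + d powr (1 - q) * (khinchine_const TYPE('k) q * tail2 b n powr (q / 2) / 2))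
      \<longlonglongrightarrow> (1 - d) powr (1 - q) * M0 + d powr (1 - q) * (0 / 2)"
    using q by (intro tendsto_intros khinchine_tail_tendsto[OF b]) auto
  then have "eventually (\<lambda>n. (1 - d) powr (1 - q) * M0
      + d powr (1 - q) * (khinchine_const TYPE('k) q * tail2 b n powr (q / 2) / 2) < top_energy) sequentially"
    using d(1) by (auto dest: order_tendstoD)
  then obtain n where n: "(1 - d) powr (1 - q) * M0
      + d powr (1 - q) * (khinchine_const TYPE('k) q * tail2 b n powr (q / 2) / 2) < top_energy"
    by (auto simp: eventually_sequentially)
  have P_less: "E c (?P n) < top_energy"
  proof -
    have "E c (?P n) \<le> (1 - d) powr (1 - q) * E c (\<lambda>_. 0) + d powr (1 - q) * E 0 (?P n)"
      by (rule pair_energy_split[OF lP q d(2,3)])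
    also have "\<dots> \<le> (1 - d) powr (1 - q) * M0
      + d powr (1 - q) * (khinchine_const TYPE('k) q * tail2 b n powr (q / 2) / 2)"
      using center[OF X] rnorm_le_tail[OF b q, of n] unfolding pair_energy_no_center
      by (intro add_mono mult_left_mono divide_right_mono) auto
    finally show ?thesis using n by simp
  qed
  \<comment> \<open>\<open>e\<close> replaces the multipliers below \<open>n\<close> by the larger
    constant \<open>damp n\<close> and the others by 1. It therefore dominates \<open>damp\<close>,
    and applying it to \<open>b\<close> is exactly the convex combination of \<open>b\<close> and
    its truncation with weight \<open>damp n\<close>.\<close>
  define e where "e m = (if m < n then damp n else 1)" for m
  have e_pos: "0 < e m" and damp_le_e: "damp m \<le> e m" for m
    using damp_pos damp_less_1 damp_mono[of m n] by (auto simp: e_def less_imp_le)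
  have le: "l2 (\<lambda>m. e m *\<^sub>R b m)"
    by (rule l2_mult[OF b, of _ 1])
      (use damp_pos damp_less_1 in \<open>auto simp: e_def less_imp_le abs_of_pos intro!: mult_left_le_one_le\<close>)
  have "E c (\<lambda>m. damp m *\<^sub>R b m) = E (1 *\<^sub>R c) (\<lambda>m. (damp m / e m) *\<^sub>R (e m *\<^sub>R b m))"
    using e_pos by (simp add: less_imp_neq[symmetric])
  also have "\<dots> \<le> E c (\<lambda>m. e m *\<^sub>R b m)"
  proof (rule pair_energy_contract[OF le q])
    show "\<bar>damp m / e m\<bar> \<le> 1" for m
      using e_pos[of m] damp_le_e[of m] damp_pos[of m] by simp
  qed simp
  also have "\<dots> = E (damp n *\<^sub>R c + (1 - damp n) *\<^sub>R c) (\<lambda>m. damp n *\<^sub>R b m + (1 - damp n) *\<^sub>R ?P n m)"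
  proof -
    have "(\<lambda>m. e m *\<^sub>R b m) = (\<lambda>m. damp n *\<^sub>R b m + (1 - damp n) *\<^sub>R ?P n m)"
      by (rule ext) (simp add: e_def scaleR_add_left[symmetric])
    then show ?thesis by (simp add: scaleR_add_left[symmetric])
  qed
  also have "\<dots> \<le> damp n * E c b + (1 - damp n) * E c (?P n)"
    by (rule pair_energy_convex[OF b lP q]) (use damp_pos[of n] damp_less_1[of n] in auto)
  also have "\<dots> < damp n * top_energy + (1 - damp n) * top_energy"
    using P_less E_le_top[OF X] damp_pos[of n] damp_less_1[of n]
    by (intro add_le_less_mono mult_left_mono mult_strict_left_mono) auto
  finally show ?thesis by (simp add: algebra_simps)
qed

text \<open>Shifting a nearly optimal pair \<open>k\<close> times keeps its energy and moves its
  coefficients to indices from \<open>k\<close> on, where every multiplier is at least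
  \<open>damp k\<close>. Damping then loses no more than scaling the whole pair by
  \<open>damp k\<close>, a factor tending to 1.\<close>

lemma E_damp_approx:
  assumes "\<epsilon> > 0"
  shows "\<exists>(c, b)\<in>X. top_energy - \<epsilon> < E c (\<lambda>m. damp m *\<^sub>R b m)"
proof -
  have "X \<noteq> {}" using exceeds by auto
  then obtain c b where X: "(c, b) \<in> X" and gt: "top_energy - \<epsilon> < E c b"
    using less_cSUP_iff[OF _ bdd_above_E, of "top_energy - \<epsilon>"] assms by (auto simp: top_energy_def)
  have "(\<lambda>k. damp k powr q * E c b) \<longlonglongrightarrow> 1 powr q * E c b"
    using q by (intro tendsto_intros damp_tendsto) auto
  then have "eventually (\<lambda>k. top_energy - \<epsilon> < damp k powr q * E c b) sequentially"
    using gt by (auto dest: order_tendstoD)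
  then obtain k where k: "top_energy - \<epsilon> < damp k powr q * E c b"
    by (auto simp: eventually_sequentially)
  define b' where "b' = (case_nat 0 ^^ k) b"
  have b': "(c, b') \<in> X \<and> E c b' = E c b \<and> (\<forall>m<k. b' m = 0)"
    unfolding b'_def
  proof (induction k)
    case (Suc k)
    then show ?case
      using shift[of c "(case_nat 0 ^^ k) b"] pair_energy_shift[OF l2 q, of c "(case_nat 0 ^^ k) b" \<alpha> \<beta> c]
      by (auto split: nat.split)
  qed (use X in simp)
  then have lb': "l2 b'" using l2 by blast
  have "damp k powr q * E c b = E (damp k *\<^sub>R c) (\<lambda>m. damp k *\<^sub>R b' m)"
    using b' pair_energy_scale[OF lb' q, of "damp k" \<alpha> \<beta> c] damp_pos[of k] by simp
  \<comment> \<open>The pair scaled by \<open>damp k\<close> is written as a contraction of the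
    damped one. For m < k the factor may be 0 because \<open>b' m\<close> vanishes there; from
    \<open>k\<close> on the quotient is at most 1 by monotonicity.\<close>
  also have "\<dots> = E (damp k *\<^sub>R c) (\<lambda>m. (if m < k then 0 else damp k / damp m) *\<^sub>R (damp m *\<^sub>R b' m))"
    using b' damp_pos by (intro arg_cong[of _ _ "E (damp k *\<^sub>R c)"] ext) (auto simp: less_imp_neq[symmetric])
  also have "\<dots> \<le> E c (\<lambda>m. damp m *\<^sub>R b' m)"
    by (rule pair_energy_contract[OF l2_damp[OF lb'] q])
      (use damp_pos damp_less_1 damp_mono in \<open>auto simp: abs_of_pos less_imp_le divide_le_eq_1_pos\<close>)
  finally show ?thesis using k b' by (auto intro!: bexI[of _ "(c, b')"])
qed

end

section \<open>Rademacher coefficients\<close>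

definition rcoef :: "(real \<Rightarrow> 'k::euclidean_space) \<Rightarrow> nat \<Rightarrow> 'k" where
  "rcoef f n = (LINT t|UI. rad n t *\<^sub>R f t)"

lemma integrable_rad_scaleR:
  fixes f :: "real \<Rightarrow> 'k::euclidean_space"
  assumes "integrable UI f"
  shows "integrable UI (\<lambda>t. rad n t *\<^sub>R f t)"
proof -
  have [measurable]: "f \<in> borel_measurable UI" using assms by auto
  show ?thesis
    by (rule Bochner_Integration.integrable_bound[OF assms]) auto
qed

lemma norm_rcoef_le:
  fixes f :: "real \<Rightarrow> 'k::euclidean_space"
  assumes "integrable UI f"
  shows "norm (rcoef f n) \<le> (LINT t|UI. norm (f t))"
  using integral_norm_bound[of UI "\<lambda>t. rad n t *\<^sub>R f t"] by (simp add: rcoef_def)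

lemma rcoef_add:
  fixes f g :: "real \<Rightarrow> 'k::euclidean_space"
  assumes "integrable UI f" "integrable UI g"
  shows "rcoef (\<lambda>t. f t + g t) n = rcoef f n + rcoef g n"
  using integrable_rad_scaleR[OF assms(1)] integrable_rad_scaleR[OF assms(2)]
  by (simp add: rcoef_def scaleR_add_right)

lemma rcoef_mult:
  fixes f :: "real \<Rightarrow> 'k::{real_normed_field, euclidean_space}"
  shows "rcoef (\<lambda>t. z * f t) n = z * rcoef f n"
  unfolding rcoef_def by (simp flip: mult_scaleR_right)

lemma rcoef_scaleR:
  fixes f :: "real \<Rightarrow> 'k::euclidean_space"
  shows "rcoef (\<lambda>t. s *\<^sub>R f t) n = s *\<^sub>R rcoef f n"
proof -
  have "(\<lambda>t. rad n t *\<^sub>R s *\<^sub>R f t) = (\<lambda>t. s *\<^sub>R (rad n t *\<^sub>R f t))"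
    by (simp add: mult.commute)
  then show ?thesis by (simp only: rcoef_def integral_scaleR_right)
qed

lemma rcoef_cong_AE:
  fixes f g :: "real \<Rightarrow> 'k::euclidean_space"
  assumes [measurable]: "f \<in> borel_measurable UI" "g \<in> borel_measurable UI" and "AE t in UI. f t = g t"
  shows "rcoef f = rcoef g"
proof
  fix n show "rcoef f n = rcoef g n"
    unfolding rcoef_def by (rule integral_cong_AE) (use assms(3) in auto)
qed

text \<open>\<open>rad 0\<close> has opposite signs on the two copies of \<open>f\<close>, so the
  coefficient of index 0 cancels, while \<open>rad (Suc m)\<close> acts as \<open>rad m\<close> on
  each copy. This is the shift of the coefficients.\<close>

lemma rcoef_join_self:
  fixes f :: "real \<Rightarrow> 'k::euclidean_space"
  assumes f: "integrable UI f"
  shows "rcoef (join f f) = case_nat 0 (rcoef f)"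
proof
  fix n
  show "rcoef (join f f) n = case_nat 0 (rcoef f) n"
  proof (cases n)
    case 0
    have "(\<lambda>t. rad 0 t *\<^sub>R join f f t) = join f (\<lambda>t. - f t)"
      by (auto simp: join_def)
    then show ?thesis
      using integral_join[OF f integrable_minus[OF f]] 0 by (simp add: rcoef_def)
  next
    case (Suc m)
    have "(\<lambda>t. rad (Suc m) t *\<^sub>R join f f t) = join (\<lambda>t. rad m t *\<^sub>R f t) (\<lambda>t. rad m t *\<^sub>R f t)"
      by (auto simp: join_def)
    then show ?thesis
      using integral_join[OF integrable_rad_scaleR[OF f] integrable_rad_scaleR[OF f], of m m] Suc
      by (simp add: rcoef_def scaleR_2[symmetric])
  qed
qed

text \<open>\<open>p / (p - 1)\<close> is the conjugate exponent. The summand 1 bounds the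
  contribution of the function in Young's inequality, the Khinchine constant that of the Rademacher
  sum; the square is there because a sum of squares is bounded.\<close>

definition rcoef_const :: "'k::euclidean_space itself \<Rightarrow> real \<Rightarrow> real" where
  "rcoef_const T p = (1 + khinchine_const T (p / (p - 1)))\<^sup>2"

text \<open>Pairing the function with the normalised Rademacher sum of its own coefficients
  dualises the Khinchine inequality; no orthogonality is needed.\<close>

lemma rcoef_square_sum_le:
  fixes f :: "real \<Rightarrow> 'k::euclidean_space"
  assumes p: "1 < p" and [measurable]: "f \<in> borel_measurable UI"
    and int: "integrable UI (\<lambda>t. norm (f t) powr p)" and le1: "(LINT t|UI. norm (f t) powr p) \<le> 1"
  shows "(\<Sum>n<N. (norm (rcoef f n))\<^sup>2) \<le> rcoef_const TYPE('k) p"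
proof -
  define s where "s = p / (p - 1)"
  have s: "1 < s" "1 / p + 1 / s = 1" using p by (auto simp: s_def field_simps)
  define \<beta> where "\<beta> = sqrt (\<Sum>n<N. (norm (rcoef f n))\<^sup>2)"
  have sq: "(\<Sum>n<N. (norm (rcoef f n))\<^sup>2) = \<beta>\<^sup>2" and "0 \<le> \<beta>"
    by (simp_all add: \<beta>_def sum_nonneg)
  have f: "integrable UI f"
    by (rule integrable_of_norm_powr[OF _ _ int]) (use p in auto)
  have Kpos: "0 < khinchine_const TYPE('k) s" using s by (intro khinchine_const_pos) auto
  have "\<beta> \<le> 1 + khinchine_const TYPE('k) s"
  proof (cases "\<beta> = 0")
    case False
    with \<open>0 \<le> \<beta>\<close> have \<beta>: "0 < \<beta>" by simp
    define a where "a n = rcoef f n /\<^sub>R \<beta>" for n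
    define g where "g = radsum N 0 a"
    have sum_a: "(\<Sum>n<N. (norm (a n))\<^sup>2) = 1"
      using \<beta> by (simp add: a_def power_mult_distrib sum_distrib_left[symmetric] sq power_inverse)
    have g_int: "integrable UI (\<lambda>t. norm (g t) powr s)"
      unfolding g_def by (rule integrable_radsum)
    have g_le: "(LINT t|UI. norm (g t) powr s) \<le> khinchine_const TYPE('k) s"
      using khinchine_signed_avg[of s N a] s integral_radsum[of "\<lambda>z. norm z powr s" N 0 a]
      by (simp add: g_def sum_a)
    have "\<beta> = (\<Sum>n<N. rcoef f n \<bullet> a n)"
    proof -
      have "rcoef f n \<bullet> a n = (norm (rcoef f n))\<^sup>2 / \<beta>" for n
        by (simp add: a_def power2_norm_eq_inner divide_inverse)
      then have "(\<Sum>n<N. rcoef f n \<bullet> a n) = \<beta>\<^sup>2 / \<beta>"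
        by (simp only: sum_divide_distrib[symmetric] sq)
      then show ?thesis using \<beta> by (simp add: power2_eq_square)
    qed
    also have "\<dots> = (\<Sum>n<N. LINT t|UI. (rad n t *\<^sub>R f t) \<bullet> a n)"
      unfolding rcoef_def by (intro sum.cong refl integral_inner_left[symmetric] integrable_rad_scaleR f)
    also have "\<dots> = (LINT t|UI. (\<Sum>n<N. (rad n t *\<^sub>R f t) \<bullet> a n))"
      by (rule Bochner_Integration.integral_sum[symmetric]) (intro integrable_inner_left integrable_rad_scaleR f)
    \<comment> \<open>Young's inequality can stand in for Hoelder's here, since the p-th moment of
      \<open>f\<close> and the s-th moment of \<open>g\<close> are both already bounded.\<close>
    also have "\<dots> \<le> (LINT t|UI. norm (f t) powr p / p + norm (g t) powr s / s)"
    proof (rule integral_mono)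
      fix t
      have "(\<Sum>n<N. (rad n t *\<^sub>R f t) \<bullet> a n) = f t \<bullet> g t"
        by (simp add: g_def radsum_def inner_sum_right)
      also have "\<dots> \<le> norm (f t) * norm (g t)" by (rule norm_cauchy_schwarz)
      also have "\<dots> \<le> norm (f t) powr p / p + norm (g t) powr s / s"
        by (rule Youngs_inequality) (use p s in auto)
      finally show "(\<Sum>n<N. (rad n t *\<^sub>R f t) \<bullet> a n) \<le> norm (f t) powr p / p + norm (g t) powr s / s" .
    next
      show "integrable UI (\<lambda>t. \<Sum>n<N. (rad n t *\<^sub>R f t) \<bullet> a n)"
        by (intro Bochner_Integration.integrable_sum integrable_inner_left integrable_rad_scaleR f)
    qed (use int g_int in auto)
    also have "\<dots> = (LINT t|UI. norm (f t) powr p) / p + (LINT t|UI. norm (g t) powr s) / s"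
      using int g_int by simp
    also have "\<dots> \<le> 1 + khinchine_const TYPE('k) s"
    proof (rule add_mono)
      show "(LINT t|UI. norm (f t) powr p) / p \<le> 1"
        using le1 p by simp
      have "(LINT t|UI. norm (g t) powr s) / s \<le> (LINT t|UI. norm (g t) powr s) / 1"
        using s by (intro divide_left_mono) auto
      then show "(LINT t|UI. norm (g t) powr s) / s \<le> khinchine_const TYPE('k) s"
        using g_le by simp
    qed
    finally show ?thesis .
  qed (use Kpos in simp)
  then have "\<beta>\<^sup>2 \<le> (1 + khinchine_const TYPE('k) s)\<^sup>2"
    using \<open>0 \<le> \<beta>\<close> by (rule power_mono)
  then show ?thesis by (simp add: sq rcoef_const_def s_def)
qed

lemma l2_rcoef:
  fixes f :: "real \<Rightarrow> 'k::euclidean_space"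
  assumes p: "1 < p" and [measurable]: "f \<in> borel_measurable UI"
    and int: "integrable UI (\<lambda>t. norm (f t) powr p)"
  shows "l2 (rcoef f)"
proof -
  \<comment> \<open>The summand 1 keeps the normalising factor finite when \<open>f\<close> vanishes
    almost everywhere.\<close>
  define A where "A = (LINT t|UI. norm (f t) powr p) + 1"
  have A: "0 < A" by (auto simp: A_def intro!: add_nonneg_pos)
  define s where "s = A powr (- (1 / p))"
  have s: "0 < s" using A by (simp add: s_def)
  have "s powr p = A powr (- 1)" using p by (simp add: s_def powr_powr)
  then have "s powr p = 1 / A" using A powr_minus_divide[of A 1] by simp
  then have eq: "norm (s *\<^sub>R f t) powr p = norm (f t) powr p / A" for t
    using s by (simp add: powr_mult)
  have "(\<Sum>n<N. (norm (rcoef (\<lambda>t. s *\<^sub>R f t) n))\<^sup>2) \<le> rcoef_const TYPE('k) p" for N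
  proof (rule rcoef_square_sum_le[OF p])
    show "integrable UI (\<lambda>t. norm (s *\<^sub>R f t) powr p)" unfolding eq using int by simp
    show "(LINT t|UI. norm (s *\<^sub>R f t) powr p) \<le> 1"
      unfolding eq using A by (simp add: A_def)
  qed simp
  then have "l2 (rcoef (\<lambda>t. s *\<^sub>R f t))" by (rule l2I)
  then show ?thesis
    by (rule l2_mult[of _ _ "1 / s"]) (use s in \<open>simp add: rcoef_scaleR\<close>)
qed

lemma norm_integral_powr_le:
  fixes f :: "real \<Rightarrow> 'k::euclidean_space"
  assumes p: "1 \<le> p" and [measurable]: "f \<in> borel_measurable UI"
    and int: "integrable UI (\<lambda>t. norm (f t) powr p)"
  shows "(LINT t|UI. norm (f t)) powr p \<le> (LINT t|UI. norm (f t) powr p)"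
proof -
  interpret prob_space UI by (rule prob_space_UI)
  have f: "integrable UI f" by (rule integrable_of_norm_powr[OF p _ int]) simp
  have conv: "convex_on UNIV (\<lambda>x. \<bar>x\<bar> powr p)"
    using convex_on_norm_powr[OF p, where 'k = real] by simp
  have "\<bar>expectation (\<lambda>t. norm (f t))\<bar> powr p \<le> expectation (\<lambda>t. \<bar>norm (f t)\<bar> powr p)"
    by (rule jensens_inequality[where I = UNIV and q = "\<lambda>x. \<bar>x\<bar> powr p"]) (use f int conv in auto)
  then show ?thesis by simp
qed

section \<open>Operators on Lebesgue spaces without the weak maximizing property\<close>

abbreviation Lp :: "ennreal \<Rightarrow> (real \<Rightarrow> 'k::{real_normed_field, second_countable_topology}) set" where
  "Lp p \<equiv> Lp_fun p UI"

lemma Lp_fun_zero: "(\<lambda>_. 0 :: 'k::{real_normed_field, second_countable_topology}) \<in> Lp p"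
  by (simp add: Lp_fun_def esssup_const emeasure_restrict_space zero_ereal_def[symmetric])

lemma AE_norm_le_Lp_norm_infinity:
  assumes f: "f \<in> Lp top"
  shows "AE t in UI. norm (f t) \<le> Lp_norm top UI f" "0 \<le> Lp_norm top UI f"
proof -
  let ?e = "esssup UI (\<lambda>t. ereal (norm (f t)))"
  have [measurable]: "f \<in> borel_measurable UI" using f by (auto simp: Lp_fun_def)
  have "esssup UI (\<lambda>_. ereal 0) \<le> ?e" by (rule esssup_AE_mono) auto
  then have nn: "0 \<le> ?e"
    by (simp add: esssup_const emeasure_restrict_space zero_ereal_def)
  have "?e < \<infinity>" using f by (simp add: Lp_fun_def)
  then have e: "?e = ereal (Lp_norm top UI f)"
    using nn by (cases ?e) (auto simp: Lp_norm_def)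
  then show "0 \<le> Lp_norm top UI f" using nn by simp
  show "AE t in UI. norm (f t) \<le> Lp_norm top UI f"
    using esssup_AE[where f = "\<lambda>t. ereal (norm (f t))" and M = UI] e by simp
qed

lemma Lp_infinity_I:
  assumes [measurable]: "f \<in> borel_measurable UI" and le: "AE t in UI. norm (f t) \<le> C"
  shows "f \<in> Lp top" "Lp_norm top UI f \<le> C"
proof -
  have e: "esssup UI (\<lambda>t. ereal (norm (f t))) \<le> ereal C"
    by (rule esssup_I) (use le in auto)
  then have "esssup UI (\<lambda>t. ereal (norm (f t))) < \<infinity>"
    by (auto intro: le_less_trans)
  then show f: "f \<in> Lp top" by (simp add: Lp_fun_def)
  have "0 \<le> esssup UI (\<lambda>t. ereal (norm (f t)))"
  proof -
    have "esssup UI (\<lambda>_. ereal 0) \<le> esssup UI (\<lambda>t. ereal (norm (f t)))" by (rule esssup_AE_mono) auto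
    then show ?thesis by (simp add: esssup_const emeasure_restrict_space zero_ereal_def)
  qed
  then show "Lp_norm top UI f \<le> C"
    using e by (cases "esssup UI (\<lambda>t. ereal (norm (f t)))") (auto simp: Lp_norm_def)
qed

lemma Lp_fun_ennreal_iff:
  "1 \<le> r \<Longrightarrow> f \<in> Lp_fun (ennreal r) M \<longleftrightarrow> f \<in> borel_measurable M \<and> integrable M (\<lambda>t. norm (f t) powr r)"
  by (simp add: Lp_fun_def)

lemma Lp_norm_ennreal:
  "1 \<le> r \<Longrightarrow> Lp_norm (ennreal r) M f = (LINT t|M. norm (f t) powr r) powr (1 / r)"
  by (simp add: Lp_norm_def)

lemma Lp_norm_ennreal_le_1_iff:
  assumes "1 \<le> r"
  shows "Lp_norm (ennreal r) M f \<le> 1 \<longleftrightarrow> (LINT t|M. norm (f t) powr r) \<le> 1"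
proof -
  have "x powr (1 / r) \<le> 1 \<longleftrightarrow> x \<le> 1" if "0 \<le> x" for x :: real
  proof (cases "x \<le> 1")
    case True
    then show ?thesis using powr_le1[of "1 / r" x] that assms by simp
  next
    case False
    then have "1 < x powr (1 / r)" by (intro gr_one_powr) (use assms in auto)
    with False show ?thesis by simp
  qed
  then show ?thesis using assms by (simp add: Lp_norm_ennreal)
qed

lemma exponent_cases:
  assumes "1 \<le> (p :: ennreal)"
  obtains "p = top" | r where "p = ennreal r" "1 \<le> r"
proof (cases p)
  case (real r)
  then show thesis using assms that(2)[of r] by (simp add: ennreal_1[symmetric] del: ennreal_1)
qed (use that in simp)

lemma Lp_norm_nonneg:
  fixes f :: "real \<Rightarrow> 'k::{real_normed_field, second_countable_topology}"
  assumes "f \<in> Lp p"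
  shows "0 \<le> Lp_norm p UI f"
  using assms AE_norm_le_Lp_norm_infinity(2)[of f] by (cases "p = top") (auto simp: Lp_norm_def)

lemma Lp_norm_scale:
  fixes f :: "real \<Rightarrow> 'k::{real_normed_field, second_countable_topology}"
  assumes p: "1 \<le> p" and f: "f \<in> Lp p"
  shows "Lp_norm p UI (\<lambda>t. c * f t) = norm c * Lp_norm p UI f"
  using p
proof (cases rule: exponent_cases)
  case 1
  have [measurable]: "f \<in> borel_measurable UI" using f by (rule Lp_fun_measurable)
  \<comment> \<open>Only this inequality is obtained from the essential supremum; applying it to
    \<open>inverse c\<close> gives the reverse one.\<close>
  have le: "Lp_norm top UI (\<lambda>t. c * f t) \<le> norm c * Lp_norm top UI f"
    if "f \<in> Lp top" for c and f :: "real \<Rightarrow> 'k"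
    using that AE_norm_le_Lp_norm_infinity(1)[OF that] Lp_fun_measurable[OF that]
    by (intro Lp_infinity_I(2)) (auto simp: norm_mult elim!: eventually_mono intro!: mult_left_mono)
  have f': "f \<in> Lp top" using f 1 by simp
  show ?thesis
  proof (cases "c = 0")
    case True
    then show ?thesis
      using le[OF f', of 0] Lp_norm_nonneg[OF Lp_fun_zero, of top, where 'k = 'k] 1 by simp
  next
    case False
    have "Lp_norm top UI (\<lambda>t. inverse c * (c * f t)) \<le> norm (inverse c) * Lp_norm top UI (\<lambda>t. c * f t)"
      by (rule le[OF Lp_fun_scale[OF f']])
    moreover have "(\<lambda>t. inverse c * (c * f t)) = f" using False by auto
    ultimately have "norm c * Lp_norm top UI f \<le> norm c * (norm (inverse c) * Lp_norm top UI (\<lambda>t. c * f t))"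
      by (intro mult_left_mono) auto
    moreover have "norm c * (norm (inverse c) * z) = z" for z
      using False by (simp add: norm_inverse)
    ultimately have "norm c * Lp_norm top UI f \<le> Lp_norm top UI (\<lambda>t. c * f t)"
      by (simp only:)
    then show ?thesis using le[OF f', of c] 1 by simp
  qed
next
  case (2 r)
  then show ?thesis
    by (simp add: Lp_norm_ennreal norm_mult powr_mult powr_powr)
qed

lemma Lp_norm_eq_0:
  assumes p: "1 \<le> p" and f: "f \<in> Lp p" and 0: "Lp_norm p UI f = 0"
  shows "AE t in UI. f t = 0"
  using p
proof (cases rule: exponent_cases)
  case 1
  then show ?thesis using AE_norm_le_Lp_norm_infinity(1)[of f] f 0 by simp
next
  case (2 r)
  then have "(LINT t|UI. norm (f t) powr r) = 0" and "integrable UI (\<lambda>t. norm (f t) powr r)"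
    using f 0 by (simp_all add: Lp_norm_ennreal Lp_fun_ennreal_iff)
  then show ?thesis by (simp add: integral_nonneg_eq_0_iff_AE)
qed

lemma Lp_norm_zero:
  assumes "1 \<le> p"
  shows "Lp_norm p UI (\<lambda>_. 0 :: 'k::{real_normed_field, second_countable_topology}) = 0"
  using Lp_norm_scale[OF assms Lp_fun_zero, where c = "0 :: 'k"] by simp

section \<open>From maps on functions to operators on equivalence classes\<close>

definition Lp_rep :: "('a \<Rightarrow> 'k) set \<Rightarrow> 'a \<Rightarrow> 'k" where
  "Lp_rep A = (SOME f. f \<in> A)"

lemma Lp_rep_class:
  assumes f: "f \<in> Lp_fun p M"
  shows "Lp_rep (Lp_rel p M `` {f}) \<in> Lp_fun p M" "AE t in M. Lp_rep (Lp_rel p M `` {f}) t = f t"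
proof -
  have "f \<in> Lp_rel p M `` {f}" using f by (simp add: Lp_rel_def)
  then have "Lp_rep (Lp_rel p M `` {f}) \<in> Lp_rel p M `` {f}"
    unfolding Lp_rep_def by (rule someI[where P = "\<lambda>g. g \<in> Lp_rel p M `` {f}"])
  then show "Lp_rep (Lp_rel p M `` {f}) \<in> Lp_fun p M" "AE t in M. Lp_rep (Lp_rel p M `` {f}) t = f t"
    by (auto simp: Lp_rel_def elim: eventually_mono)
qed

text \<open>Here \<open>M\<close> is the norm, approached by \<open>T_approx\<close> but by
  \<open>T_less\<close> not attained anywhere on the closed ball. The functional
  \<open>\<phi>\<close> is the witness against weak nullness: \<open>T_null\<close> says that it
  does not tend to 0 along any maximizing sequence.\<close>

locale Lp_operator =
  fixes p q :: ennreal
    and T :: "(real \<Rightarrow> 'k) \<Rightarrow> real \<Rightarrow> 'k::{real_normed_field, second_countable_topology}"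
    and \<phi> :: "(real \<Rightarrow> 'k) \<Rightarrow> 'k"
    and C M :: real
  assumes p: "1 \<le> p" and q: "1 \<le> q"
    and T_fun: "f \<in> Lp p \<Longrightarrow> T f \<in> Lp q"
    and T_cong: "f \<in> Lp p \<Longrightarrow> g \<in> Lp p \<Longrightarrow> AE t in UI. f t = g t \<Longrightarrow> AE t in UI. T f t = T g t"
    and T_add: "f \<in> Lp p \<Longrightarrow> g \<in> Lp p \<Longrightarrow> AE t in UI. T (\<lambda>t. f t + g t) t = T f t + T g t"
    and T_scale: "f \<in> Lp p \<Longrightarrow> AE t in UI. T (\<lambda>t. c * f t) t = c * T f t"
    and \<phi>_cong: "f \<in> Lp p \<Longrightarrow> g \<in> Lp p \<Longrightarrow> AE t in UI. f t = g t \<Longrightarrow> \<phi> f = \<phi> g"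
    and \<phi>_add: "f \<in> Lp p \<Longrightarrow> g \<in> Lp p \<Longrightarrow> \<phi> (\<lambda>t. f t + g t) = \<phi> f + \<phi> g"
    and \<phi>_scale: "f \<in> Lp p \<Longrightarrow> \<phi> (\<lambda>t. c * f t) = c * \<phi> f"
    and \<phi>_bound: "f \<in> Lp p \<Longrightarrow> Lp_norm p UI f \<le> 1 \<Longrightarrow> norm (\<phi> f) \<le> C"
    and M_pos: "0 < M"
    and T_less: "f \<in> Lp p \<Longrightarrow> Lp_norm p UI f \<le> 1 \<Longrightarrow> Lp_norm q UI (T f) < M"
    and T_approx: "\<epsilon> > 0 \<Longrightarrow> \<exists>f\<in>Lp p. Lp_norm p UI f \<le> 1 \<and> M - \<epsilon> < Lp_norm q UI (T f)"
    and T_null: "(\<And>n. F n \<in> Lp p \<and> Lp_norm p UI (F n) \<le> 1) \<Longrightarrow> (\<lambda>n. \<phi> (F n)) \<longlonglongrightarrow> 0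
      \<Longrightarrow> \<not> (\<lambda>n. Lp_norm q UI (T (F n))) \<longlonglongrightarrow> M"
begin

abbreviation cls_p :: "(real \<Rightarrow> 'k) \<Rightarrow> (real \<Rightarrow> 'k) set" where
  "cls_p f \<equiv> Lp_rel p UI `` {f}"

abbreviation cls_q :: "(real \<Rightarrow> 'k) \<Rightarrow> (real \<Rightarrow> 'k) set" where
  "cls_q f \<equiv> Lp_rel q UI `` {f}"

definition class_op :: "(real \<Rightarrow> 'k) set \<Rightarrow> (real \<Rightarrow> 'k) set" where
  "class_op A = cls_q (T (Lp_rep A))"

definition class_fun :: "(real \<Rightarrow> 'k) set \<Rightarrow> 'k" where
  "class_fun A = \<phi> (Lp_rep A)"

lemma class_op_class: "f \<in> Lp p \<Longrightarrow> class_op (cls_p f) = cls_q (T f)"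
  unfolding class_op_def using Lp_rep_class[of f p UI]
  by (subst Lp_class_eq_iff) (blast intro: T_fun T_cong)+

lemma class_fun_class: "f \<in> Lp p \<Longrightarrow> class_fun (cls_p f) = \<phi> f"
  unfolding class_fun_def using Lp_rep_class[of f p UI] by (intro \<phi>_cong) auto

lemma normalize:
  assumes f: "f \<in> Lp p" and pos: "0 < Lp_norm p UI f"
  shows "(\<lambda>t. of_real (1 / Lp_norm p UI f) * f t) \<in> Lp p"
    "Lp_norm p UI (\<lambda>t. of_real (1 / Lp_norm p UI f) * f t) = 1"
    "Lp_norm q UI (T (\<lambda>t. of_real (1 / Lp_norm p UI f) * f t)) = Lp_norm q UI (T f) / Lp_norm p UI f"
    "\<phi> (\<lambda>t. of_real (1 / Lp_norm p UI f) * f t) = of_real (1 / Lp_norm p UI f) * \<phi> f"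
proof -
  let ?c = "of_real (1 / Lp_norm p UI f) :: 'k"
  have c: "norm ?c = 1 / Lp_norm p UI f" using pos by (simp add: norm_divide)
  show 1: "(\<lambda>t. ?c * f t) \<in> Lp p" by (rule Lp_fun_scale[OF f])
  show "Lp_norm p UI (\<lambda>t. ?c * f t) = 1" using pos by (simp only: Lp_norm_scale[OF p f] c) simp
  have "Lp_norm q UI (T (\<lambda>t. ?c * f t)) = Lp_norm q UI (\<lambda>t. ?c * T f t)"
    by (intro Lp_norm_cong_AE Lp_fun_measurable[OF T_fun] 1 Lp_fun_measurable[OF Lp_fun_scale[OF T_fun]] f T_scale)
  then show "Lp_norm q UI (T (\<lambda>t. ?c * f t)) = Lp_norm q UI (T f) / Lp_norm p UI f"
    by (simp only: Lp_norm_scale[OF q T_fun[OF f]] c) simp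
  show "\<phi> (\<lambda>t. ?c * f t) = ?c * \<phi> f" by (rule \<phi>_scale[OF f])
qed

lemma T_norm_zero:
  assumes f: "f \<in> Lp p" and 0: "Lp_norm p UI f = 0"
  shows "Lp_norm q UI (T f) = 0" "\<phi> f = 0"
proof -
  have ae: "AE t in UI. f t = 0 * f t" using Lp_norm_eq_0[OF p f 0] by simp
  have f0: "(\<lambda>t. 0 * f t) \<in> Lp p" by (rule Lp_fun_scale[OF f])
  have "AE t in UI. T f t = 0"
    using T_cong[OF f f0 ae] T_scale[OF f, of 0] by eventually_elim simp
  then have "Lp_norm q UI (T f) = Lp_norm q UI (\<lambda>_. 0 :: 'k)"
    by (intro Lp_norm_cong_AE Lp_fun_measurable[OF T_fun] f) auto
  then show "Lp_norm q UI (T f) = 0" by (simp only: Lp_norm_zero[OF q])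
  show "\<phi> f = 0" using \<phi>_cong[OF f f0 ae] \<phi>_scale[OF f, of 0] by simp
qed

lemma T_bound: "f \<in> Lp p \<Longrightarrow> Lp_norm q UI (T f) \<le> M * Lp_norm p UI f"
proof -
  assume f: "f \<in> Lp p"
  show ?thesis
  proof (cases "Lp_norm p UI f = 0")
    case False
    then have pos: "0 < Lp_norm p UI f" using Lp_norm_nonneg[OF f] by simp
    show ?thesis
      using T_less[OF normalize(1)[OF f pos]] pos
      unfolding normalize(2,3)[OF f pos] by (simp add: divide_less_eq less_imp_le)
  qed (simp add: T_norm_zero[OF f])
qed

lemma \<phi>_norm_bound: "f \<in> Lp p \<Longrightarrow> norm (\<phi> f) \<le> C * Lp_norm p UI f"
proof -
  assume f: "f \<in> Lp p"
  show ?thesis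
  proof (cases "Lp_norm p UI f = 0")
    case False
    then have pos: "0 < Lp_norm p UI f" using Lp_norm_nonneg[OF f] by simp
    show ?thesis
      using \<phi>_bound[OF normalize(1)[OF f pos]] pos
      unfolding normalize(2,4)[OF f pos] by (simp add: norm_mult norm_divide divide_le_eq)
  qed (simp add: T_norm_zero[OF f])
qed

lemma ex_maximizing:
  assumes "0 < \<epsilon>"
  shows "\<exists>f\<in>Lp p. Lp_norm p UI f = 1 \<and> M - \<epsilon> < Lp_norm q UI (T f)"
proof -
  \<comment> \<open>Taking the minimum with \<open>M\<close> keeps the lower bound nonnegative, so
    \<open>T f\<close> is nonzero and \<open>f\<close> can be normalised. Dividing by a norm at most
    1 only increases the value.\<close>
  obtain f where f: "f \<in> Lp p" "Lp_norm p UI f \<le> 1" "M - min \<epsilon> M < Lp_norm q UI (T f)"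
    using T_approx[of "min \<epsilon> M"] assms M_pos by auto
  then have Tf: "0 < Lp_norm q UI (T f)" by simp
  then have pos: "0 < Lp_norm p UI f"
    using T_norm_zero(1)[OF f(1)] Lp_norm_nonneg[OF f(1)] by (cases "Lp_norm p UI f = 0") auto
  have "Lp_norm q UI (T f) \<le> Lp_norm q UI (T f) / Lp_norm p UI f"
    using Tf f(2) pos by (simp add: field_simps)
  then show ?thesis
    using normalize(1-3)[OF f(1) pos] f(3) by (intro bexI) auto
qed

lemma bounded_op_class_op: "bounded_op (Lp_unit_interval p) (Lp_unit_interval q) class_op"
  unfolding bounded_op_def elems_Lp_space
proof (intro conjI ballI allI exI[of _ M]; (elim imageE; clarify)?)
  show "class_op \<in> (\<lambda>f. cls_p f) ` Lp p \<rightarrow> (\<lambda>f. cls_q f) ` Lp q"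
    by (auto simp: class_op_class T_fun)
next
  fix f g :: "real \<Rightarrow> 'k" assume fg: "f \<in> Lp p" "g \<in> Lp p"
  then show "class_op (vadd (Lp_unit_interval p) (cls_p f) (cls_p g)) = vadd (Lp_unit_interval q) (class_op (cls_p f)) (class_op (cls_p g))"
    by (simp add: vadd_Lp_space class_op_class Lp_fun_add T_fun Lp_class_eq_iff T_add)
next
  fix c and f :: "real \<Rightarrow> 'k" assume "f \<in> Lp p"
  then show "class_op (vscale (Lp_unit_interval p) c (cls_p f)) = vscale (Lp_unit_interval q) c (class_op (cls_p f))"
    by (simp add: vscale_Lp_space class_op_class Lp_fun_scale T_fun Lp_class_eq_iff T_scale)
next
  fix f :: "real \<Rightarrow> 'k" assume "f \<in> Lp p"
  then show "vnorm (Lp_unit_interval q) (class_op (cls_p f)) \<le> M * vnorm (Lp_unit_interval p) (cls_p f)"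
    by (simp add: vnorm_Lp_space class_op_class T_fun T_bound)
qed

lemma bounded_op_class_fun: "bounded_op (Lp_unit_interval p) scalar_field class_fun"
  unfolding bounded_op_def elems_Lp_space
proof (intro conjI ballI allI exI[of _ C]; (elim imageE; clarify)?)
  show "class_fun \<in> (\<lambda>f. cls_p f) ` Lp p \<rightarrow> elems scalar_field"
    by (simp add: scalar_field_def)
next
  fix f g :: "real \<Rightarrow> 'k" assume fg: "f \<in> Lp p" "g \<in> Lp p"
  then show "class_fun (vadd (Lp_unit_interval p) (cls_p f) (cls_p g)) = vadd scalar_field (class_fun (cls_p f)) (class_fun (cls_p g))"
    by (simp add: vadd_Lp_space class_fun_class Lp_fun_add \<phi>_add scalar_field_def)
next
  fix c and f :: "real \<Rightarrow> 'k" assume "f \<in> Lp p"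
  then show "class_fun (vscale (Lp_unit_interval p) c (cls_p f)) = vscale scalar_field c (class_fun (cls_p f))"
    by (simp add: vscale_Lp_space class_fun_class Lp_fun_scale \<phi>_scale scalar_field_def)
next
  fix f :: "real \<Rightarrow> 'k" assume "f \<in> Lp p"
  then show "vnorm scalar_field (class_fun (cls_p f)) \<le> C * vnorm (Lp_unit_interval p) (cls_p f)"
    by (simp add: vnorm_Lp_space class_fun_class \<phi>_norm_bound scalar_field_def)
qed

lemma op_norm_class_op: "op_norm (Lp_unit_interval p) (Lp_unit_interval q) class_op = M"
  unfolding op_norm_def
proof (rule cSup_eq_non_empty)
  let ?B = "{x \<in> elems (Lp_unit_interval p). vnorm (Lp_unit_interval p) x \<le> 1}"
  have B: "?B = cls_p ` {f \<in> Lp p. Lp_norm p UI f \<le> 1}"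
    by (auto simp: elems_Lp_space vnorm_Lp_space)
  show "(\<lambda>x. vnorm (Lp_unit_interval q) (class_op x)) ` ?B \<noteq> {}"
    unfolding B using ex_maximizing[of 1] by auto
  show "x \<le> M" if "x \<in> (\<lambda>x. vnorm (Lp_unit_interval q) (class_op x)) ` ?B" for x
    using that T_less unfolding B by (auto simp: class_op_class T_fun vnorm_Lp_space less_imp_le)
  fix y assume y: "\<And>x. x \<in> (\<lambda>x. vnorm (Lp_unit_interval q) (class_op x)) ` ?B \<Longrightarrow> x \<le> y"
  show "M \<le> y"
  proof (rule field_le_epsilon)
    fix e :: real assume "0 < e"
    from T_approx[OF this] obtain f where f: "f \<in> Lp p" "Lp_norm p UI f \<le> 1" "M - e < Lp_norm q UI (T f)"
      by auto
    have "vnorm (Lp_unit_interval q) (class_op (cls_p f)) \<le> y"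
      by (rule y) (unfold B, use f in auto)
    then show "M \<le> y + e" using f by (simp add: class_op_class T_fun vnorm_Lp_space)
  qed
qed

theorem not_WMP: "\<not> WMP (Lp_unit_interval p :: ('k, (real \<Rightarrow> 'k) set) nspace)
    (Lp_unit_interval q :: ('k, (real \<Rightarrow> 'k) set) nspace)"
proof
  assume W: "WMP (Lp_unit_interval p :: ('k, (real \<Rightarrow> 'k) set) nspace)
    (Lp_unit_interval q :: ('k, (real \<Rightarrow> 'k) set) nspace)"
  have "\<forall>n. \<exists>f\<in>Lp p. Lp_norm p UI f = 1 \<and> M - inverse (real (Suc n)) < Lp_norm q UI (T f)"
    by (intro allI ex_maximizing) simp
  then obtain f where f: "\<And>n. f n \<in> Lp p" "\<And>n. Lp_norm p UI (f n) = 1"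
    and gt: "\<And>n. M - inverse (real (Suc n)) < Lp_norm q UI (T (f n))" by metis
  have lim: "(\<lambda>n. Lp_norm q UI (T (f n))) \<longlonglongrightarrow> M"
  proof (rule tendsto_sandwich)
    show "(\<lambda>n. M - inverse (real (Suc n))) \<longlonglongrightarrow> M"
      using tendsto_diff[OF tendsto_const LIMSEQ_inverse_real_of_nat, of M] by simp
    show "(\<lambda>n. M) \<longlonglongrightarrow> M" by simp
    show "\<forall>\<^sub>F n in sequentially. M - inverse (real (Suc n)) \<le> Lp_norm q UI (T (f n))"
      using gt by (intro always_eventually allI less_imp_le)
    show "\<forall>\<^sub>F n in sequentially. Lp_norm q UI (T (f n)) \<le> M"
      using T_less[OF f(1)] f(2) by (intro always_eventually allI less_imp_le) auto
  qed
  have max: "maximizing_seq (Lp_unit_interval p) (Lp_unit_interval q) class_op (\<lambda>n. cls_p (f n))"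
    unfolding maximizing_seq_def op_norm_class_op
    using f lim by (auto simp: unit_sphere_def elems_Lp_space vnorm_Lp_space class_op_class T_fun)
  have "\<not> weakly_null (Lp_unit_interval p) (\<lambda>n. cls_p (f n))"
  proof
    assume "weakly_null (Lp_unit_interval p) (\<lambda>n. cls_p (f n))"
    then have "(\<lambda>n. class_fun (cls_p (f n))) \<longlonglongrightarrow> 0"
      using bounded_op_class_fun unfolding weakly_null_def by blast
    then have "(\<lambda>n. \<phi> (f n)) \<longlonglongrightarrow> 0" using f(1) by (simp add: class_fun_class)
    then show False using T_null[of f] f lim by auto
  qed
  then have "attains_norm (Lp_unit_interval p) (Lp_unit_interval q) class_op"
    using W bounded_op_class_op max unfolding WMP_def by blast
  then obtain x where x: "x \<in> unit_sphere (Lp_unit_interval p)" "vnorm (Lp_unit_interval q) (class_op x) = M"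
    by (auto simp: attains_norm_def op_norm_class_op)
  then obtain g where g: "g \<in> Lp p" "x = cls_p g"
    by (auto simp: unit_sphere_def elems_Lp_space)
  then have "Lp_norm p UI g = 1" "Lp_norm q UI (T g) = M"
    using x by (auto simp: unit_sphere_def vnorm_Lp_space class_op_class T_fun)
  then show False using T_less[OF g(1)] by simp
qed

end

section \<open>Functionals compatible with the shift\<close>

abbreviation (input) half0 :: "(real \<Rightarrow> 'a) \<Rightarrow> real \<Rightarrow> 'a" where
  "half0 f \<equiv> \<lambda>s. f (s / 2)"

abbreviation (input) half1 :: "(real \<Rightarrow> 'a) \<Rightarrow> real \<Rightarrow> 'a" where
  "half1 f \<equiv> \<lambda>s. f ((s + 1) / 2)"

abbreviation unit_ball :: "ennreal \<Rightarrow> (real \<Rightarrow> 'k::{real_normed_field, second_countable_topology}) set" where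
  "unit_ball p \<equiv> {f \<in> Lp p. Lp_norm p UI f \<le> 1}"

lemma half_measurable:
  assumes "f \<in> borel_measurable UI"
  shows "half0 f \<in> borel_measurable UI" "half1 f \<in> borel_measurable UI"
  using measurable_compose[OF measurable_halves(1) assms] measurable_compose[OF measurable_halves(2) assms]
  by simp_all

text \<open>The exceptional point is s = 1, where s/2 = 1/2 already falls into the second branch of
  \<open>join\<close>.\<close>

lemma half0_join: "AE s in UI. join u v (s / 2) = u s"
proof -
  have "AE s in UI. s \<noteq> 1"
    using AE_lebesgue_neq[of 1] by (auto simp: AE_restrict_space_iff elim!: eventually_mono)
  then show ?thesis
    by (rule AE_mp) (auto simp: join_def intro!: AE_I2)
qed

lemma half1_join: "AE s in UI. join u v ((s + 1) / 2) = v s"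
  by (rule AE_I2) (auto simp: join_def add_divide_distrib)

lemma Lp_fun_infinity_iff:
  shows "f \<in> Lp top \<longleftrightarrow> f \<in> borel_measurable UI \<and> (\<exists>C. AE t in UI. norm (f t) \<le> C)"
  using AE_norm_le_Lp_norm_infinity(1)[of f] Lp_infinity_I(1)[of f] Lp_fun_measurable[of f] by blast

lemma unit_ball_infinity_iff:
  shows "f \<in> unit_ball top \<longleftrightarrow> f \<in> borel_measurable UI \<and> (AE t in UI. norm (f t) \<le> 1)"
proof safe
  assume f: "f \<in> Lp top" "Lp_norm top UI f \<le> 1"
  show "f \<in> borel_measurable UI" by (rule Lp_fun_measurable[OF f(1)])
  show "AE t in UI. norm (f t) \<le> 1"
    using AE_norm_le_Lp_norm_infinity(1)[OF f(1)] f(2) by (auto elim!: eventually_mono)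
qed (auto intro: Lp_infinity_I)

lemma unit_ball_ennreal_iff:
  assumes "1 \<le> r"
  shows "f \<in> unit_ball (ennreal r) \<longleftrightarrow> f \<in> borel_measurable UI \<and>
    integrable UI (\<lambda>t. norm (f t) powr r) \<and> (LINT t|UI. norm (f t) powr r) \<le> 1"
  using assms by (auto simp: Lp_fun_ennreal_iff Lp_norm_ennreal_le_1_iff)

lemma Lp_fun_half:
  assumes p: "1 \<le> p" and f: "f \<in> Lp p"
  shows "half0 f \<in> Lp p" "half1 f \<in> Lp p"
proof -
  have m: "f \<in> borel_measurable UI" by (rule Lp_fun_measurable[OF f])
  have "half0 f \<in> Lp p \<and> half1 f \<in> Lp p"
    using p
  proof (cases rule: exponent_cases)
    case 1
    then obtain C where "AE t in UI. norm (f t) \<le> C" using f by (auto simp: Lp_fun_infinity_iff)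
    then show ?thesis
      using 1 half_measurable[OF m] AE_halves[of "\<lambda>t. norm (f t) \<le> C"] by (auto simp: Lp_fun_infinity_iff)
  next
    case (2 r)
    then show ?thesis
      using f half_measurable[OF m] integrable_halves[of "\<lambda>t. norm (f t) powr r"] by (simp add: Lp_fun_ennreal_iff)
  qed
  then show "half0 f \<in> Lp p" "half1 f \<in> Lp p" by auto
qed

lemma Lp_fun_join:
  assumes p: "1 \<le> p" and u: "u \<in> Lp p" and v: "v \<in> Lp p"
  shows "join u v \<in> Lp p"
proof -
  have [measurable]: "u \<in> borel_measurable UI" "v \<in> borel_measurable UI"
    using u v by (auto intro: Lp_fun_measurable)
  show ?thesis
    using p
  proof (cases rule: exponent_cases)
    case 1
    then obtain C D where CD: "AE t in UI. norm (u t) \<le> C" "AE t in UI. norm (v t) \<le> D"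
      using u v by (auto simp: Lp_fun_infinity_iff)
    have "AE t in UI. norm (u t) \<le> max C D" using CD(1) by (rule eventually_mono) simp
    moreover have "AE t in UI. norm (v t) \<le> max C D" using CD(2) by (rule eventually_mono) simp
    ultimately have "AE t in UI. join (\<lambda>t. norm (u t) \<le> max C D) (\<lambda>t. norm (v t) \<le> max C D) t"
      by (rule AE_join)
    then have "AE t in UI. norm (join u v t) \<le> max C D"
      by (auto simp: join_def elim!: eventually_mono)
    then show ?thesis unfolding 1 by (rule Lp_infinity_I(1)[rotated]) measurable
  next
    case (2 r)
    have "integrable UI (\<lambda>t. norm (join u v t) powr r)"
      unfolding join_comp[where f = "\<lambda>z. norm z powr r"]
      using u v 2 by (intro integrable_join) (auto simp: Lp_fun_ennreal_iff)
    then show ?thesis using 2 by (simp add: Lp_fun_ennreal_iff)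
  qed
qed

lemma unit_ball_join_self:
  assumes p: "1 \<le> p" and f: "f \<in> unit_ball p"
  shows "join f f \<in> unit_ball p"
  using p
proof (cases rule: exponent_cases)
  case 1
  have [measurable]: "f \<in> borel_measurable UI" and ae: "AE t in UI. norm (f t) \<le> 1"
    using f unfolding 1 unit_ball_infinity_iff by auto
  have "AE t in UI. join (\<lambda>t. norm (f t) \<le> 1) (\<lambda>t. norm (f t) \<le> 1) t"
    by (rule AE_join[OF ae ae])
  then have "AE t in UI. norm (join f f t) \<le> 1"
    by (auto simp: join_def elim!: eventually_mono)
  then show ?thesis unfolding 1 unit_ball_infinity_iff by simp
next
  case (2 r)
  have [measurable]: "f \<in> borel_measurable UI" and int: "integrable UI (\<lambda>t. norm (f t) powr r)"
    and le: "(LINT t|UI. norm (f t) powr r) \<le> 1"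
    using f unfolding 2(1) unit_ball_ennreal_iff[OF 2(2)] by auto
  show ?thesis
    using integrable_join[OF int int] integral_join[OF int int] le
    unfolding 2(1) unit_ball_ennreal_iff[OF 2(2)] join_comp[where f = "\<lambda>z. norm z powr r"] by simp
qed

text \<open>The form of the shift used when the functionals live on different halves of the domain:
  the left half, which carries the centre, is kept, and only the right half, which carries the
  coefficients, is doubled.\<close>

lemma unit_ball_join_half:
  assumes p: "1 \<le> p" and f: "f \<in> unit_ball p"
  shows "join (half0 f) (join (half1 f) (half1 f)) \<in> unit_ball p"
  using p
proof (cases rule: exponent_cases)
  case 1
  have m: "f \<in> borel_measurable UI" and ae: "AE t in UI. norm (f t) \<le> 1"
    using f unfolding 1 unit_ball_infinity_iff by auto
  note [measurable] = half_measurable[OF m]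
  have "AE t in UI. join (\<lambda>t. norm (half0 f t) \<le> 1) (join (\<lambda>t. norm (half1 f t) \<le> 1) (\<lambda>t. norm (half1 f t) \<le> 1)) t"
    by (intro AE_join AE_halves[OF ae])
  then have "AE t in UI. norm (join (half0 f) (join (half1 f) (half1 f)) t) \<le> 1"
    by (auto simp: join_def elim!: eventually_mono)
  then show ?thesis unfolding 1 unit_ball_infinity_iff by simp
next
  case (2 r)
  have m: "f \<in> borel_measurable UI" and int: "integrable UI (\<lambda>t. norm (f t) powr r)"
    and le: "(LINT t|UI. norm (f t) powr r) \<le> 1"
    using f unfolding 2(1) unit_ball_ennreal_iff[OF 2(2)] by auto
  note [measurable] = half_measurable[OF m]
  note i0 = integrable_halves(1)[OF int] and i1 = integrable_halves(2)[OF int]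
  show ?thesis
    using integrable_join[OF i0 integrable_join[OF i1 i1]] integral_join[OF i0 integrable_join[OF i1 i1]]
      integral_join[OF i1 i1] integral_halves[OF int] le
    unfolding 2(1) unit_ball_ennreal_iff[OF 2(2)] join_comp[where f = "\<lambda>z. norm z powr r"] by simp
qed

text \<open>For \<open>p = \<infinity>\<close> any finite exponent does.\<close>

lemma finite_exponent:
  assumes "1 < (p :: ennreal)"
  obtains r where "1 < r"
    "\<And>f :: real \<Rightarrow> 'k::{real_normed_field, second_countable_topology}. f \<in> Lp p \<Longrightarrow> integrable UI (\<lambda>t. norm (f t) powr r)"
    "\<And>f :: real \<Rightarrow> 'k. f \<in> unit_ball p \<Longrightarrow> (LINT t|UI. norm (f t) powr r) \<le> 1"
proof -
  have "1 \<le> p" using assms by simp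
  then show thesis
  proof (cases rule: exponent_cases)
    case 1
    have int: "integrable UI (\<lambda>t. norm (f t) powr 2)" if f: "f \<in> Lp p" for f :: "real \<Rightarrow> 'k"
    proof -
      have [measurable]: "f \<in> borel_measurable UI" by (rule Lp_fun_measurable[OF f])
      obtain C where "AE t in UI. norm (f t) \<le> C" using f 1 by (auto simp: Lp_fun_infinity_iff)
      then have "AE t in UI. norm (norm (f t) powr 2) \<le> norm (C powr 2)"
        by (rule eventually_mono) (simp only: real_norm_def abs_of_nonneg powr_ge_zero, rule powr_mono2, auto)
      then show ?thesis
        by (intro Bochner_Integration.integrable_bound[OF integrable_const_UI[of "C powr 2"]]) auto
    qed
    have "(LINT t|UI. norm (f t) powr 2) \<le> 1" if "f \<in> unit_ball p" for f :: "real \<Rightarrow> 'k"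
    proof -
      have f: "f \<in> Lp p" "AE t in UI. norm (f t) \<le> 1"
        using that unit_ball_infinity_iff[of f] 1 by auto
      have "(LINT t|UI. norm (f t) powr 2) \<le> (LINT t|UI. 1 :: real)"
        by (rule integral_mono_AE[OF int[OF f(1)]])
          (use f(2) in \<open>auto elim!: eventually_mono simp: power_le_one\<close>)
      then show ?thesis unfolding integral_const_UI .
    qed
    then show thesis using that[of 2] int by simp
  next
    case (2 r)
    then have "1 < r" using assms by (cases "r = 1") auto
    then show thesis
    proof (rule that)
      show "integrable UI (\<lambda>t. norm (f t) powr r)" if "f \<in> Lp p" for f :: "real \<Rightarrow> 'k"
        using that unfolding 2(1) Lp_fun_ennreal_iff[OF 2(2)] by simp
      show "(LINT t|UI. norm (f t) powr r) \<le> 1" if "f \<in> unit_ball p" for f :: "real \<Rightarrow> 'k"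
        using that unfolding 2(1) unit_ball_ennreal_iff[OF 2(2)] by simp
    qed
  qed
qed

lemma Lp_integrable:
  fixes f :: "real \<Rightarrow> 'k::{real_normed_field, euclidean_space}"
  assumes p: "1 \<le> p" and f: "f \<in> Lp p"
  shows "integrable UI f"
proof (cases "p = 1")
  case True
  then have "f \<in> Lp_fun (ennreal 1) UI" using f by simp
  then have "f \<in> borel_measurable UI" "integrable UI (\<lambda>t. norm (f t) powr 1)"
    unfolding Lp_fun_ennreal_iff[OF order_refl] by auto
  then show ?thesis by (rule integrable_of_norm_powr[OF order_refl])
next
  case False
  then have "1 < p" using p by simp
  then obtain r where "1 < r" "integrable UI (\<lambda>t. norm (f t) powr r)"
    using finite_exponent[of p, where 'k = 'k] f by metis
  then show ?thesis
    by (intro integrable_of_norm_powr[OF less_imp_le Lp_fun_measurable[OF f]])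
qed

lemma Lp_l2_rcoef:
  fixes f :: "real \<Rightarrow> 'k::{real_normed_field, euclidean_space}"
  assumes p: "1 < p" and f: "f \<in> Lp p"
  shows "l2 (rcoef f)"
proof -
  obtain r where "1 < r" "integrable UI (\<lambda>t. norm (f t) powr r)"
    using finite_exponent[OF p, where 'k = 'k] f by metis
  then show ?thesis by (intro l2_rcoef[OF _ Lp_fun_measurable[OF f]]) auto
qed

text \<open>\<open>shift\<close> abstracts the doubling map: the coefficients move up by one index
  while the centre is unchanged and the function stays in the ball. \<open>C\<close> enters the
  threshold \<open>M0\<close>, and \<open>B\<close> determines how large the weight of the centre
  has to be.\<close>

locale shift_functionals =
  fixes p :: ennreal
    and c :: "(real \<Rightarrow> 'k::{real_normed_field, euclidean_space}) \<Rightarrow> 'k"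
    and b :: "(real \<Rightarrow> 'k) \<Rightarrow> nat \<Rightarrow> 'k"
    and C B :: real
  assumes p: "1 \<le> p"
    and c_cong: "f \<in> Lp p \<Longrightarrow> g \<in> Lp p \<Longrightarrow> AE t in UI. f t = g t \<Longrightarrow> c f = c g"
    and c_add: "f \<in> Lp p \<Longrightarrow> g \<in> Lp p \<Longrightarrow> c (\<lambda>t. f t + g t) = c f + c g"
    and c_scale: "f \<in> Lp p \<Longrightarrow> c (\<lambda>t. z * f t) = z * c f"
    and b_cong: "f \<in> Lp p \<Longrightarrow> g \<in> Lp p \<Longrightarrow> AE t in UI. f t = g t \<Longrightarrow> b f = b g"
    and b_add: "f \<in> Lp p \<Longrightarrow> g \<in> Lp p \<Longrightarrow> b (\<lambda>t. f t + g t) m = b f m + b g m"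
    and b_scale: "f \<in> Lp p \<Longrightarrow> b (\<lambda>t. z * f t) m = z * b f m"
    and b_l2: "f \<in> Lp p \<Longrightarrow> l2 (b f)"
    and shift: "f \<in> unit_ball p \<Longrightarrow> \<exists>g\<in>unit_ball p. c g = c f \<and> b g = case_nat 0 (b f)"
    and c_bound: "f \<in> unit_ball p \<Longrightarrow> norm (c f) \<le> C"
    and b_bound: "f \<in> unit_ball p \<Longrightarrow> tail2 (b f) 0 \<le> B"
begin

lemma not_WMP:
  assumes q: "1 \<le> q" and nn: "0 \<le> \<alpha>" "0 \<le> \<beta>"
    and M0: "(\<alpha> powr q + \<beta> powr q) / 2 * C powr q \<le> M0"
    and large: "khinchine_const TYPE('k) q * B powr (q / 2) / 2 \<le> M0 / 2 powr q"
    and exceeds: "\<exists>f\<in>unit_ball p. M0 < pair_energy q \<alpha> \<beta> (c f) (b f)"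
  shows "\<not> WMP (Lp_unit_interval p :: ('k, (real \<Rightarrow> 'k) set) nspace)
      (Lp_unit_interval (ennreal q) :: ('k, (real \<Rightarrow> 'k) set) nspace)"
proof -
  define X where "X = (\<lambda>f. (c f, b f)) ` unit_ball p"
  interpret pairs: shift_invariant_pairs X q \<alpha> \<beta> M0
  proof
    show "1 \<le> q" by fact
    show "l2 b'" if "(c', b') \<in> X" for c' b'
      using that b_l2 by (auto simp: X_def)
    show "(c', case_nat 0 b') \<in> X" if "(c', b') \<in> X" for c' b'
    proof -
      obtain f where f: "f \<in> unit_ball p" "c' = c f" "b' = b f" using \<open>(c', b') \<in> X\<close> by (auto simp: X_def)
      obtain g where g: "g \<in> unit_ball p" "c g = c f \<and> b g = case_nat 0 (b f)" using shift[OF f(1)] by blast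
      then have "(c', case_nat 0 b') = (c g, b g)" using f by simp
      then show ?thesis using g(1) unfolding X_def by blast
    qed
    show "pair_energy q \<alpha> \<beta> c' (\<lambda>_. 0) \<le> M0" if "(c', b') \<in> X" for c' b'
    proof -
      obtain f where f: "f \<in> unit_ball p" "c' = c f" using \<open>(c', b') \<in> X\<close> by (auto simp: X_def)
      have "norm c' powr q \<le> C powr q" using c_bound[OF f(1)] f(2) q by (intro powr_mono2) auto
      then have "(\<alpha> powr q + \<beta> powr q) / 2 * norm c' powr q \<le> (\<alpha> powr q + \<beta> powr q) / 2 * C powr q"
        by (rule mult_left_mono) simp
      then show ?thesis using M0 q nn by (simp add: pair_energy_no_coeffs)
    qed
    show "pair_energy q \<alpha> \<beta> 0 b' \<le> M0 / 2 powr q" if "(c', b') \<in> X" for c' b'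
    proof -
      obtain f where f: "f \<in> unit_ball p" "b' = b f" using \<open>(c', b') \<in> X\<close> by (auto simp: X_def)
      have l: "l2 b'" using f b_l2 by auto
      have "rnorm q 0 b' \<le> khinchine_const TYPE('k) q * tail2 b' 0 powr (q / 2)"
        using rnorm_le_tail[OF l q, of 0] by simp
      also have "\<dots> \<le> khinchine_const TYPE('k) q * B powr (q / 2)"
        using b_bound[OF f(1)] f(2) tail2_nonneg[OF l] khinchine_const_pos[of q, where 'k = 'k] q
        by (intro mult_left_mono powr_mono2) auto
      finally show ?thesis using large by (simp add: pair_energy_no_center)
    qed
    show "\<exists>(c', b')\<in>X. M0 < pair_energy q \<alpha> \<beta> c' b'"
      using exceeds by (auto simp: X_def)
  qed
  \<comment> \<open>The multipliers are part of the operator and not of the functionals, so the set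
    \<open>X\<close> remains invariant under the shift.\<close>
  define D where "D f m = damp m *\<^sub>R b f m" for f m
  define T where "T f = join (\<lambda>_. \<alpha> *\<^sub>R c f) (\<lambda>t. \<beta> *\<^sub>R c f + rlim (D f) t)" for f
  have D_l2: "l2 (D f)" if "f \<in> Lp p" for f
    unfolding D_def by (rule l2_damp[OF b_l2[OF that]])
  have T_meas [measurable]: "T f \<in> borel_measurable UI" if "f \<in> Lp p" for f
    unfolding T_def using D_l2[OF that] by (intro measurable_join) auto
  have T_int: "integrable UI (\<lambda>t. norm (T f t) powr q)"
    and T_energy: "(LINT t|UI. norm (T f t) powr q) = pair_energy q \<alpha> \<beta> (c f) (D f)"
    if f: "f \<in> Lp p" for f
  proof -
    note i = integrable_const_UI[of "norm (\<alpha> *\<^sub>R c f) powr q"] integrable_rlim[OF D_l2[OF f] q, of "\<beta> *\<^sub>R c f"]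
    show "integrable UI (\<lambda>t. norm (T f t) powr q)"
      unfolding T_def join_comp[where f = "\<lambda>z. norm z powr q"] by (rule integrable_join[OF i])
    show "(LINT t|UI. norm (T f t) powr q) = pair_energy q \<alpha> \<beta> (c f) (D f)"
      unfolding T_def join_comp[where f = "\<lambda>z. norm z powr q"] integral_join[OF i]
      by (simp only: pair_energy_def rnorm_def real_scaleR_def norm_scaleR powr_mult abs_of_nonneg[OF nn(1)]
          integral_const_UI divide_inverse mult.commute)
  qed
  have T_norm: "Lp_norm (ennreal q) UI (T f) = pair_energy q \<alpha> \<beta> (c f) (D f) powr (1 / q)"
    if "f \<in> Lp p" for f
    by (simp only: Lp_norm_ennreal[OF q] T_energy[OF that])
  have M0_nonneg: "0 \<le> M0"
    using M0 by (rule order_trans[rotated]) simp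
  have top_pos: "0 < pairs.top_energy" using M0_nonneg pairs.M0_less_top by simp
  define M where "M = pairs.top_energy powr (1 / q)"
  have M_powr: "M powr q = pairs.top_energy" using q top_pos by (simp add: M_def powr_powr)
  have "Lp_operator p (ennreal q) T c C M"
  proof
    show "1 \<le> p" by (rule p)
    show "1 \<le> ennreal q" using q by (simp add: ennreal_1[symmetric] del: ennreal_1)
    show "0 < M" using top_pos by (simp add: M_def)
    show "T f \<in> Lp (ennreal q)" if "f \<in> Lp p" for f
      using T_meas[OF that] T_int[OF that] q by (simp add: Lp_fun_ennreal_iff)
    show "AE t in UI. T f t = T g t"
      if "f \<in> Lp p" "g \<in> Lp p" "AE t in UI. f t = g t" for f g
      using c_cong[OF that] b_cong[OF that] by (simp add: T_def D_def[abs_def])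
    show "AE t in UI. T (\<lambda>t. f t + g t) t = T f t + T g t" if fg: "f \<in> Lp p" "g \<in> Lp p" for f g
    proof -
      have "D (\<lambda>t. f t + g t) = (\<lambda>m. D f m + D g m)"
        by (simp add: D_def[abs_def] b_add[OF fg] scaleR_add_right)
      then have "AE t in UI. rlim (D (\<lambda>t. f t + g t)) t = rlim (D f) t + rlim (D g) t"
        using rlim_add[OF D_l2[OF fg(1)] D_l2[OF fg(2)]] by simp
      then have "AE t in UI. join (\<lambda>_. True) (\<lambda>t. rlim (D (\<lambda>t. f t + g t)) t = rlim (D f) t + rlim (D g) t) t"
        by (intro AE_join) auto
      then show ?thesis
        by (rule AE_mp) (auto simp: T_def join_def c_add[OF fg] algebra_simps intro!: AE_I2)
    qed
    show "AE t in UI. T (\<lambda>t. z * f t) t = z * T f t" if f: "f \<in> Lp p" for z f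
    proof -
      have "D (\<lambda>t. z * f t) = (\<lambda>m. z * D f m)"
        by (simp add: D_def[abs_def] b_scale[OF f])
      then have "AE t in UI. rlim (D (\<lambda>t. z * f t)) t = z * rlim (D f) t"
        using rlim_mult[OF D_l2[OF f]] by simp
      then have "AE t in UI. join (\<lambda>_. True) (\<lambda>t. rlim (D (\<lambda>t. z * f t)) t = z * rlim (D f) t) t"
        by (intro AE_join) auto
      then show ?thesis
        by (rule AE_mp) (auto simp: T_def join_def c_scale[OF f] algebra_simps intro!: AE_I2)
    qed
    show "c f = c g" if "f \<in> Lp p" "g \<in> Lp p" "AE t in UI. f t = g t" for f g
      by (rule c_cong[OF that])
    show "c (\<lambda>t. f t + g t) = c f + c g" if "f \<in> Lp p" "g \<in> Lp p" for f g
      by (rule c_add[OF that])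
    show "c (\<lambda>t. z * f t) = z * c f" if "f \<in> Lp p" for z f
      by (rule c_scale[OF that])
    show "norm (c f) \<le> C" if "f \<in> Lp p" "Lp_norm p UI f \<le> 1" for f
      using c_bound that by simp
    show "Lp_norm (ennreal q) UI (T f) < M" if f: "f \<in> Lp p" "Lp_norm p UI f \<le> 1" for f
    proof -
      have "pair_energy q \<alpha> \<beta> (c f) (D f) < pairs.top_energy"
        unfolding D_def using f by (intro pairs.E_damp_less_top) (auto simp: X_def)
      then show ?thesis
        unfolding T_norm[OF f(1)] M_def using q by (intro powr_less_mono2 pair_energy_nonneg) auto
    qed
    show "\<exists>f\<in>Lp p. Lp_norm p UI f \<le> 1 \<and> M - \<epsilon> < Lp_norm (ennreal q) UI (T f)" if \<epsilon>: "0 < \<epsilon>" for \<epsilon>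
    proof -
      \<comment> \<open>The maximum with 0 keeps the base nonnegative, so that the powers with
        exponents \<open>q\<close> and 1/q are inverse to each other and monotone.\<close>
      define y where "y = max 0 (M - \<epsilon>)"
      have y: "0 \<le> y" "y < M" using \<epsilon> \<open>0 < M\<close> by (auto simp: y_def)
      then have "y powr q < pairs.top_energy"
        using q powr_less_mono2[of q y M] M_powr by simp
      then obtain f where f: "f \<in> unit_ball p" "y powr q < pair_energy q \<alpha> \<beta> (c f) (D f)"
        using pairs.E_damp_approx[of "pairs.top_energy - y powr q"] by (auto simp: X_def D_def[abs_def])
      have "y = (y powr q) powr (1 / q)" using y q by (simp add: powr_powr)
      also have "\<dots> < pair_energy q \<alpha> \<beta> (c f) (D f) powr (1 / q)"
        using f q by (intro powr_less_mono2) auto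
      finally have "M - \<epsilon> < Lp_norm (ennreal q) UI (T f)"
        using T_norm[of f] f(1) by (simp add: y_def)
      then show ?thesis using f(1) by auto
    qed
    show "\<not> (\<lambda>n. Lp_norm (ennreal q) UI (T (F n))) \<longlonglongrightarrow> M"
      if F: "\<And>n. F n \<in> Lp p \<and> Lp_norm p UI (F n) \<le> 1" and null: "(\<lambda>n. c (F n)) \<longlonglongrightarrow> 0" for F
    proof
      assume lim: "(\<lambda>n. Lp_norm (ennreal q) UI (T (F n))) \<longlonglongrightarrow> M"
      have "(\<lambda>n. Lp_norm (ennreal q) UI (T (F n)) powr q) \<longlonglongrightarrow> M powr q"
        using q \<open>0 < M\<close> by (intro tendsto_powr lim tendsto_const) auto
      moreover have "Lp_norm (ennreal q) UI (T (F n)) powr q = pair_energy q \<alpha> \<beta> (c (F n)) (D (F n))" for n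
        using F[of n] q by (simp add: T_norm powr_powr abs_of_nonneg pair_energy_nonneg)
      ultimately have energy_lim: "(\<lambda>n. pair_energy q \<alpha> \<beta> (c (F n)) (D (F n))) \<longlonglongrightarrow> pairs.top_energy"
        by (simp add: M_powr)
      \<comment> \<open>As the centres vanish, the bound of \<open>E_damp_le_center\<close> tends to
        M0/2, which is less than the supremum because 0 \<le> M0 <
        \<open>pairs.top_energy\<close>.\<close>
      have "(\<lambda>n. 2 powr (q - 1) * ((\<alpha> powr q + \<beta> powr q) / 2 * norm (c (F n)) powr q) + M0 / 2)
          \<longlonglongrightarrow> 2 powr (q - 1) * ((\<alpha> powr q + \<beta> powr q) / 2 * 0 powr q) + M0 / 2"
        using q null by (intro tendsto_intros tendsto_powr' tendsto_norm_zero) auto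
      moreover have "pair_energy q \<alpha> \<beta> (c (F n)) (D (F n))
          \<le> 2 powr (q - 1) * ((\<alpha> powr q + \<beta> powr q) / 2 * norm (c (F n)) powr q) + M0 / 2" for n
        using pairs.E_damp_le_center[of "c (F n)" "b (F n)"] F[of n] q nn
        by (auto simp: X_def D_def[abs_def] pair_energy_no_coeffs)
      ultimately have "pairs.top_energy \<le> 2 powr (q - 1) * ((\<alpha> powr q + \<beta> powr q) / 2 * 0 powr q) + M0 / 2"
        by (intro LIMSEQ_le[OF energy_lim]) auto
      then show False using pairs.M0_less_top M0_nonneg q by simp
    qed
  qed
  then show ?thesis by (rule Lp_operator.not_WMP)
qed

end

section \<open>Test functions with a single nonzero coefficient, and bounds on the two
  halves\<close>

lemma rnorm_single:
  fixes c z :: "'k::euclidean_space"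
  assumes "1 \<le> q"
  shows "rnorm q c (case_nat z (\<lambda>_. 0)) = (norm (c + z) powr q + norm (c - z) powr q) / 2"
proof -
  have l: "l2 (case_nat z (\<lambda>_. 0) :: nat \<Rightarrow> 'k)"
    unfolding l2_def by (subst summable_Suc_iff[symmetric]) simp
  from LIMSEQ_Suc[OF signed_avg_tendsto_rnorm[OF l assms, of c]] show ?thesis
    by (simp add: signed_avg_zero LIMSEQ_const_iff)
qed

lemma rcoef_const_fun: "rcoef (\<lambda>_. u :: 'k::euclidean_space) n = 0"
proof (induction n)
  case 0
  have "(\<lambda>t. rad 0 t *\<^sub>R u) = join (\<lambda>_. u) (\<lambda>_. - u)"
    by (auto simp: join_def)
  then show ?case using integral_join[OF integrable_const_UI[of u] integrable_const_UI[of "- u"]]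
    unfolding rcoef_def integral_const_UI by simp
next
  case (Suc n)
  have "(\<lambda>t. rad (Suc n) t *\<^sub>R u) = join (\<lambda>t. rad n t *\<^sub>R u) (\<lambda>t. rad n t *\<^sub>R u)"
    by (auto simp: join_def)
  then show ?case
    using integral_join[OF integrable_rad_scaleR integrable_rad_scaleR, of "\<lambda>_. u" "\<lambda>_. u" n n] Suc
    unfolding rcoef_def by simp
qed

lemma rcoef_join_const:
  "rcoef (join (\<lambda>_. u) (\<lambda>_. v :: 'k::euclidean_space)) = case_nat ((u - v) /\<^sub>R 2) (\<lambda>_. 0)"
proof
  fix n
  show "rcoef (join (\<lambda>_. u) (\<lambda>_. v)) n = case_nat ((u - v) /\<^sub>R 2) (\<lambda>_. 0) n"
  proof (cases n)
    case 0
    have "(\<lambda>t. rad 0 t *\<^sub>R join (\<lambda>_. u) (\<lambda>_. v) t) = join (\<lambda>_. u) (\<lambda>_. - v)"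
      by (auto simp: join_def)
    then show ?thesis using integral_join[OF integrable_const_UI[of u] integrable_const_UI[of "- v"]] 0
      unfolding rcoef_def integral_const_UI by simp
  next
    case (Suc m)
    have "(\<lambda>t. rad (Suc m) t *\<^sub>R join (\<lambda>_. u) (\<lambda>_. v) t) = join (\<lambda>t. rad m t *\<^sub>R u) (\<lambda>t. rad m t *\<^sub>R v)"
      by (auto simp: join_def)
    then show ?thesis
      using integral_join[OF integrable_rad_scaleR integrable_rad_scaleR, of "\<lambda>_. u" "\<lambda>_. v" m m]
        rcoef_const_fun[of u m] rcoef_const_fun[of v m] Suc
      unfolding rcoef_def by simp
  qed
qed

text \<open>The test functions for functionals on separate halves: the constant \<open>x\<close> on
  the left, a multiple of \<open>rad 0\<close> on the stretched right half. Centre and first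
  coefficient are free parameters, and the energy becomes a mean over two points.\<close>

lemma half_functionals_join:
  fixes x y :: "'k::euclidean_space"
  defines "f \<equiv> join (\<lambda>_. x) (join (\<lambda>_. y) (\<lambda>_. - y))"
  shows "f \<in> borel_measurable UI" "(LINT t|UI. half0 f t) = x" "rcoef (half1 f) = case_nat y (\<lambda>_. 0)"
proof -
  show m: "f \<in> borel_measurable UI" unfolding f_def by (intro measurable_join) auto
  have "(LINT t|UI. half0 f t) = (LINT t|UI. x)"
    by (rule integral_cong_AE[OF half_measurable(1)[OF m] borel_measurable_const]) (unfold f_def, rule half0_join)
  then show "(LINT t|UI. half0 f t) = x" unfolding integral_const_UI .
  have "rcoef (half1 f) = rcoef (join (\<lambda>_. y) (\<lambda>_. - y))"
    by (rule rcoef_cong_AE[OF half_measurable(2)[OF m] measurable_join[OF borel_measurable_const borel_measurable_const]])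
      (unfold f_def, rule half1_join)
  then show "rcoef (half1 f) = case_nat y (\<lambda>_. 0)" by (simp add: rcoef_join_const scaleR_2[symmetric])
qed

lemma integral_join_const:
  "(LINT t|UI. join (\<lambda>_. u) (\<lambda>_. v) t) = (u + v :: 'k::euclidean_space) /\<^sub>R 2"
  using integral_join[OF integrable_const_UI[of u] integrable_const_UI[of v]] unfolding integral_const_UI .

lemma integral_norm_le_1:
  fixes f :: "real \<Rightarrow> 'k::{real_normed_field, euclidean_space}"
  assumes p: "1 \<le> p" and f: "f \<in> unit_ball p"
  shows "(LINT t|UI. norm (f t)) \<le> 1"
proof -
  have m: "f \<in> borel_measurable UI" using f by (auto intro: Lp_fun_measurable)
  obtain r where r: "1 \<le> r" "integrable UI (\<lambda>t. norm (f t) powr r)" "(LINT t|UI. norm (f t) powr r) \<le> 1"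
  proof (cases "p = 1")
    case True
    then have "f \<in> unit_ball (ennreal 1)" using f by simp
    then show thesis using that[of 1] unit_ball_ennreal_iff[of 1 f] by blast
  next
    case False
    then have "1 < p" using p by simp
    then show thesis
    proof (rule finite_exponent[where 'k = 'k])
      fix r assume r: "1 < r" "\<And>f :: real \<Rightarrow> 'k. f \<in> Lp p \<Longrightarrow> integrable UI (\<lambda>t. norm (f t) powr r)"
        "\<And>f :: real \<Rightarrow> 'k. f \<in> unit_ball p \<Longrightarrow> (LINT t|UI. norm (f t) powr r) \<le> 1"
      show thesis using that[of r] r(1) r(2)[of f] r(3)[OF f] f by simp
    qed
  qed
  have "(LINT t|UI. norm (f t)) powr r \<le> 1"
    using norm_integral_powr_le[OF r(1) m r(2)] r(3) by simp
  then show ?thesis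
  proof (rule contrapos_pp)
    assume "\<not> (LINT t|UI. norm (f t)) \<le> 1"
    then have "1 < (LINT t|UI. norm (f t)) powr r" using r(1) by (intro gr_one_powr) auto
    then show "\<not> (LINT t|UI. norm (f t)) powr r \<le> 1" by simp
  qed
qed

text \<open>Stretching a half to full length doubles its integrals, so the r-th moment of either
  half is at most 2; Jensen's inequality converts this into the bound on the first moment.\<close>

lemma half_integrals_le:
  fixes f :: "real \<Rightarrow> 'k::euclidean_space"
  assumes r: "1 \<le> r" and m: "f \<in> borel_measurable UI"
    and int: "integrable UI (\<lambda>t. norm (f t) powr r)" and le: "(LINT t|UI. norm (f t) powr r) \<le> 1"
  shows "(LINT t|UI. norm (half1 f t) powr r) \<le> 2"
    "(LINT t|UI. norm (half0 f t)) \<le> 2 powr (1 / r)" "(LINT t|UI. norm (half1 f t)) \<le> 2 powr (1 / r)"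
proof -
  note i = integrable_halves[OF int]
  have "(LINT t|UI. norm (half0 f t) powr r) + (LINT t|UI. norm (half1 f t) powr r) \<le> 2"
    using integral_halves[OF int] le by simp
  moreover have "0 \<le> (LINT t|UI. norm (half0 f t) powr r)" "0 \<le> (LINT t|UI. norm (half1 f t) powr r)" by simp_all
  ultimately have h: "(LINT t|UI. norm (half0 f t) powr r) \<le> 2" "(LINT t|UI. norm (half1 f t) powr r) \<le> 2"
    by linarith+
  have bound: "x \<le> 2 powr (1 / r)" if "x powr r \<le> 2" "0 \<le> x" for x :: real
  proof -
    have "(x powr r) powr (1 / r) \<le> 2 powr (1 / r)" using that r by (intro powr_mono2) auto
    then show ?thesis using that r by (simp add: powr_powr)
  qed
  show "(LINT t|UI. norm (half1 f t) powr r) \<le> 2" by (rule h(2))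
  show "(LINT t|UI. norm (half0 f t)) \<le> 2 powr (1 / r)"
    by (rule bound[OF order_trans[OF norm_integral_powr_le[OF r half_measurable(1)[OF m] i(1)] h(1)]]) simp
  show "(LINT t|UI. norm (half1 f t)) \<le> 2 powr (1 / r)"
    by (rule bound[OF order_trans[OF norm_integral_powr_le[OF r half_measurable(2)[OF m] i(2)] h(2)]]) simp
qed

lemma tail2_0_le:
  assumes "l2 b" "\<And>N. (\<Sum>m<N. (norm (b m))\<^sup>2) \<le> B"
  shows "tail2 b 0 \<le> B"
  using assms suminf_le_const[of "\<lambda>m. (norm (b m))\<^sup>2" B] by (simp add: tail2_def l2_def)

text \<open>Centre and coefficients are both read off the whole function. This choice serves the
  case in which they are kept apart in the range only.\<close>

lemma shift_functionals_full:
  fixes p :: ennreal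
  assumes p: "1 < p"
  shows "\<exists>B. shift_functionals p (\<lambda>f :: real \<Rightarrow> 'k::{real_normed_field, euclidean_space}. LINT t|UI. f t) rcoef 1 B"
proof -
  have p1: "1 \<le> p" using p by simp
  obtain r where r: "1 < r"
    "\<And>f :: real \<Rightarrow> 'k. f \<in> Lp p \<Longrightarrow> integrable UI (\<lambda>t. norm (f t) powr r)"
    "\<And>f :: real \<Rightarrow> 'k. f \<in> unit_ball p \<Longrightarrow> (LINT t|UI. norm (f t) powr r) \<le> 1"
    by (rule finite_exponent[OF p, where 'k = 'k]) blast
  note int = Lp_integrable[OF p1]
  note meas = Lp_fun_measurable
  have "shift_functionals p (\<lambda>f :: real \<Rightarrow> 'k. LINT t|UI. f t) rcoef 1 (rcoef_const TYPE('k) r)"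
  proof
    show "1 \<le> p" by (rule p1)
    fix f g :: "real \<Rightarrow> 'k" and z :: 'k and m :: nat
    assume f: "f \<in> Lp p"
    show "(LINT t|UI. z * f t) = z * (LINT t|UI. f t)" by simp
    show "rcoef (\<lambda>t. z * f t) m = z * rcoef f m" by (rule rcoef_mult)
    show "l2 (rcoef f)" by (rule Lp_l2_rcoef[OF p f])
    assume g: "g \<in> Lp p"
    show "(LINT t|UI. f t + g t) = (LINT t|UI. f t) + (LINT t|UI. g t)"
      using int[OF f] int[OF g] by simp
    show "rcoef (\<lambda>t. f t + g t) m = rcoef f m + rcoef g m" by (rule rcoef_add[OF int[OF f] int[OF g]])
    assume eq: "AE t in UI. f t = g t"
    show "(LINT t|UI. f t) = (LINT t|UI. g t)" by (rule integral_cong_AE[OF meas[OF f] meas[OF g] eq])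
    show "rcoef f = rcoef g" by (rule rcoef_cong_AE[OF meas[OF f] meas[OF g] eq])
  next
    fix f :: "real \<Rightarrow> 'k" assume f: "f \<in> unit_ball p"
    then have f': "f \<in> Lp p" by simp
    show "norm (LINT t|UI. f t) \<le> 1"
      by (rule order_trans[OF integral_norm_bound integral_norm_le_1[OF p1 f]])
    show "tail2 (rcoef f) 0 \<le> rcoef_const TYPE('k) r"
      by (intro tail2_0_le Lp_l2_rcoef[OF p f'] rcoef_square_sum_le[OF r(1) meas[OF f'] r(2)[OF f'] r(3)[OF f]])
    show "\<exists>g\<in>unit_ball p. (LINT t|UI. g t) = (LINT t|UI. f t) \<and> rcoef g = case_nat 0 (rcoef f)"
    proof (intro bexI conjI)
      show "(LINT t|UI. join f f t) = (LINT t|UI. f t)"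
        using integral_join[OF int[OF f'] int[OF f']] by (simp add: scaleR_2[symmetric])
      show "rcoef (join f f) = case_nat 0 (rcoef f)" by (rule rcoef_join_self[OF int[OF f']])
      show "join f f \<in> unit_ball p" by (rule unit_ball_join_self[OF p1 f])
    qed
  qed
  then show ?thesis by blast
qed

text \<open>Centre and coefficients come from disjoint halves and can be varied separately. The
  bound \<open>C\<close> is left open because its value matters for the threshold: it will be
  \<open>2 powr (1 / r)\<close> for a finite exponent and 1 for the infinite one.\<close>

lemma shift_functionals_half:
  fixes p :: ennreal
  assumes p: "1 < p"
    and C: "\<And>f :: real \<Rightarrow> 'k::{real_normed_field, euclidean_space}. f \<in> unit_ball p \<Longrightarrow> norm (LINT t|UI. half0 f t) \<le> C"
  shows "\<exists>B. shift_functionals p (\<lambda>f :: real \<Rightarrow> 'k. LINT t|UI. half0 f t) (\<lambda>f. rcoef (half1 f)) C B"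
proof -
  have p1: "1 \<le> p" using p by simp
  obtain r where r: "1 < r"
    "\<And>f :: real \<Rightarrow> 'k. f \<in> Lp p \<Longrightarrow> integrable UI (\<lambda>t. norm (f t) powr r)"
    "\<And>f :: real \<Rightarrow> 'k. f \<in> unit_ball p \<Longrightarrow> (LINT t|UI. norm (f t) powr r) \<le> 1"
    by (rule finite_exponent[OF p, where 'k = 'k]) blast
  note L0 = Lp_fun_half(1)[OF p1] and L1 = Lp_fun_half(2)[OF p1]
  note int = Lp_integrable[OF p1]
  note meas = Lp_fun_measurable
  have "shift_functionals p (\<lambda>f :: real \<Rightarrow> 'k. LINT t|UI. half0 f t) (\<lambda>f. rcoef (half1 f)) C (4 * rcoef_const TYPE('k) r)"
  proof
    show "1 \<le> p" by (rule p1)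
    fix f g :: "real \<Rightarrow> 'k" and z :: 'k and m :: nat
    assume f: "f \<in> Lp p"
    show "(LINT t|UI. z * half0 f t) = z * (LINT t|UI. half0 f t)" by simp
    show "rcoef (\<lambda>t. z * half1 f t) m = z * rcoef (half1 f) m" by (rule rcoef_mult)
    show "l2 (rcoef (half1 f))" by (rule Lp_l2_rcoef[OF p L1[OF f]])
    assume g: "g \<in> Lp p"
    show "(LINT t|UI. half0 f t + half0 g t) = (LINT t|UI. half0 f t) + (LINT t|UI. half0 g t)"
      using int[OF L0[OF f]] int[OF L0[OF g]] by simp
    show "rcoef (\<lambda>t. half1 f t + half1 g t) m = rcoef (half1 f) m + rcoef (half1 g) m"
      by (rule rcoef_add[OF int[OF L1[OF f]] int[OF L1[OF g]]])
    assume eq: "AE t in UI. f t = g t"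
    show "(LINT t|UI. half0 f t) = (LINT t|UI. half0 g t)"
      by (rule integral_cong_AE[OF meas[OF L0[OF f]] meas[OF L0[OF g]] AE_halves(1)[OF eq]])
    show "rcoef (half1 f) = rcoef (half1 g)"
      by (rule rcoef_cong_AE[OF meas[OF L1[OF f]] meas[OF L1[OF g]] AE_halves(2)[OF eq]])
  next
    fix f :: "real \<Rightarrow> 'k" assume f: "f \<in> unit_ball p"
    then have f': "f \<in> Lp p" by simp
    show "norm (LINT t|UI. half0 f t) \<le> C" by (rule C[OF f])
    show "tail2 (rcoef (half1 f)) 0 \<le> 4 * rcoef_const TYPE('k) r"
    proof (rule tail2_0_le[OF Lp_l2_rcoef[OF p L1[OF f']]])
      fix N
      \<comment> \<open>The stretched right half may have r-th moment 2. Halving the function brings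
        the moment down to at most 1, as r > 1, and returns as the factor 4 on the squared
        coefficients.\<close>
      define h where "h t = (1/2) *\<^sub>R half1 f t" for t
      have m1 [measurable]: "half1 f \<in> borel_measurable UI" by (rule meas[OF L1[OF f']])
      have h_eq: "norm (h t) powr r = (1/2) powr r * norm (half1 f t) powr r" for t
        by (simp add: h_def powr_mult[symmetric])
      have "(LINT t|UI. norm (half1 f t) powr r) \<le> 2"
        using r(1) by (intro half_integrals_le(1) meas[OF f'] r(2)[OF f'] r(3)[OF f]) simp
      moreover have "(1/2) powr r \<le> (1/2 :: real) powr 1"
        using r(1) by (intro powr_mono') auto
      ultimately have "(1/2) powr r * (LINT t|UI. norm (half1 f t) powr r) \<le> (1/2) powr 1 * 2"
        by (intro mult_mono) auto
      then have "(LINT t|UI. norm (h t) powr r) \<le> 1"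
        unfolding h_eq by simp
      moreover have "integrable UI (\<lambda>t. norm (h t) powr r)" unfolding h_eq using integrable_halves(2)[OF r(2)[OF f']] by simp
      moreover have "h \<in> borel_measurable UI" unfolding h_def[abs_def] by measurable
      ultimately have "(\<Sum>n<N. (norm (rcoef h n))\<^sup>2) \<le> rcoef_const TYPE('k) r"
        by (intro rcoef_square_sum_le[OF r(1)])
      moreover have "rcoef h n = (1/2) *\<^sub>R rcoef (half1 f) n" for n
        unfolding h_def[abs_def] by (rule rcoef_scaleR)
      ultimately show "(\<Sum>n<N. (norm (rcoef (half1 f) n))\<^sup>2) \<le> 4 * rcoef_const TYPE('k) r"
        by (simp add: power_divide sum_divide_distrib[symmetric])
    qed
    show "\<exists>g\<in>unit_ball p. (LINT t|UI. half0 g t) = (LINT t|UI. half0 f t)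
        \<and> rcoef (half1 g) = case_nat 0 (rcoef (half1 f))"
    proof (intro bexI conjI)
      let ?g = "join (half0 f) (join (half1 f) (half1 f))"
      show g: "?g \<in> unit_ball p" by (rule unit_ball_join_half[OF p1 f])
      then have g': "?g \<in> Lp p" by simp
      show "(LINT t|UI. half0 ?g t) = (LINT t|UI. half0 f t)"
        by (rule integral_cong_AE[OF meas[OF L0[OF g']] meas[OF L0[OF f']] half0_join])
      have "rcoef (half1 ?g) = rcoef (join (half1 f) (half1 f))"
        by (rule rcoef_cong_AE[OF meas[OF L1[OF g']] meas[OF Lp_fun_join[OF p1 L1[OF f'] L1[OF f']]] half1_join])
      then show "rcoef (half1 ?g) = case_nat 0 (rcoef (half1 f))"
        by (simp only: rcoef_join_self[OF int[OF L1[OF f']]])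
    qed
  qed
  then show ?thesis by blast
qed

text \<open>\<open>K\<close> will be the Khinchine bound for the oscillating part and
  \<open>a powr q / 2\<close> the threshold, or a lower bound for it. The inequality says that
  \<open>a powr q\<close> is at least \<open>2 powr q * K\<close>, which the second argument of the
  maximum solves with equality.\<close>

lemma ex_large_weight:
  fixes K :: real
  assumes "1 \<le> q" "0 \<le> K"
  shows "\<exists>a\<ge>1. K / 2 \<le> (a powr q / 2) / 2 powr q"
proof (intro exI conjI)
  let ?a = "max 1 ((2 powr q * K) powr (1 / q))"
  show "1 \<le> ?a" by simp
  have "2 powr q * K = ((2 powr q * K) powr (1 / q)) powr q"
    using assms by (simp add: powr_powr)
  also have "\<dots> \<le> ?a powr q" using assms by (intro powr_mono2) auto
  finally show "K / 2 \<le> (?a powr q / 2) / 2 powr q" by (simp add: field_simps)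
qed

text \<open>u^2 + v^2 is the mean of (u+v)^2 and (u-v)^2, and the power q/2 is convex for q \<ge> 2.
  An oscillation of size v is thus worth at least v^2 under the square.\<close>

lemma two_point_ge:
  fixes u v :: real
  assumes "2 \<le> q"
  shows "(u\<^sup>2 + v\<^sup>2) powr (q / 2) \<le> (\<bar>u + v\<bar> powr q + \<bar>u - v\<bar> powr q) / 2"
proof -
  have eq: "(x\<^sup>2) powr (q / 2) = \<bar>x\<bar> powr q" for x :: real
  proof -
    have "x\<^sup>2 = \<bar>x\<bar> powr 2" by (cases "x = 0") auto
    then show ?thesis by (simp only: powr_powr) simp
  qed
  have "((1 - 1/2) * (u + v)\<^sup>2 + 1/2 * (u - v)\<^sup>2) powr (q / 2)
    \<le> (1 - 1/2) * ((u + v)\<^sup>2) powr (q / 2) + 1/2 * ((u - v)\<^sup>2) powr (q / 2)"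
    using assms by (intro powr_convex_nonneg) auto
  moreover have "(1 - 1/2) * (u + v)\<^sup>2 + 1/2 * (u - v)\<^sup>2 = u\<^sup>2 + v\<^sup>2"
    by (simp add: power2_sum power2_diff field_simps)
  ultimately show ?thesis unfolding eq by simp
qed

section \<open>The individual ranges of exponents\<close>

text \<open>The largest centre in the ball is \<open>C\<close>, attained by putting all mass on the
  left half. Moving a share of the r-th moment to the right half costs a power r > 2 of the
  oscillation, while \<open>two_point_ge\<close> rewards its square.\<close>

lemma not_WMP_exponents_ge_2:
  fixes p :: ennreal and q :: real
  assumes p: "1 < p" and q: "2 \<le> q" and p2: "p = ennreal r" "2 < r"
  shows "\<not> WMP (Lp_unit_interval p :: ('k::{real_normed_field, euclidean_space}, (real \<Rightarrow> 'k) set) nspace)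
      (Lp_unit_interval (ennreal q) :: ('k, (real \<Rightarrow> 'k) set) nspace)"
proof -
  define C where "C = (2::real) powr (1 / r)"
  have r1: "1 \<le> r" and q1: "1 \<le> q" using p2 q by auto
  have C: "1 \<le> C" "C powr r = 2"
    using p2 by (auto simp: C_def powr_powr intro!: ge_one_powr_ge_zero)
  have "norm (LINT t|UI. half0 f t) \<le> C" if f: "f \<in> unit_ball p" for f :: "real \<Rightarrow> 'k"
  proof -
    have m: "f \<in> borel_measurable UI" and int: "integrable UI (\<lambda>t. norm (f t) powr r)"
      and le: "(LINT t|UI. norm (f t) powr r) \<le> 1"
      using f unfolding p2(1) unit_ball_ennreal_iff[OF r1] by auto
    have "(LINT t|UI. norm (half0 f t)) \<le> C" unfolding C_def by (rule half_integrals_le(2)[OF r1 m int le])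
    then show ?thesis by (rule order_trans[OF integral_norm_bound])
  qed
  from shift_functionals_half[OF p this] obtain B where
    B: "shift_functionals p (\<lambda>f :: real \<Rightarrow> 'k. LINT t|UI. half0 f t) (\<lambda>f. rcoef (half1 f)) C B" by auto
  obtain a where a: "1 \<le> a" "(khinchine_const TYPE('k) q * B powr (q / 2)) / 2 \<le> (a powr q / 2) / 2 powr q"
    using ex_large_weight[OF q1, of "khinchine_const TYPE('k) q * B powr (q / 2)"]
      khinchine_const_pos[of q, where 'k = 'k] q by auto
  show ?thesis
  proof (rule shift_functionals.not_WMP[OF B q1, where \<alpha> = 0 and \<beta> = a and ?M0.0 = "a powr q / 2 * C powr q"])
    show "0 \<le> (0::real)" "0 \<le> a" using a by auto
    show "(0 powr q + a powr q) / 2 * C powr q \<le> a powr q / 2 * C powr q" by simp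
    have "1 \<le> C powr q" using C q by (intro ge_one_powr_ge_zero) auto
    then have "a powr q / 2 * 1 \<le> a powr q / 2 * C powr q"
      by (rule mult_left_mono) simp
    then have "(a powr q / 2) / 2 powr q \<le> a powr q / 2 * C powr q / 2 powr q"
      by (intro divide_right_mono) auto
    then show "khinchine_const TYPE('k) q * B powr (q / 2) / 2 \<le> a powr q / 2 * C powr q / 2 powr q"
      using a(2) by simp
    \<comment> \<open>\<open>\<eta>\<close> is chosen so that \<open>\<eta> powr r\<close> equals
      \<eta>^2/(a^2 + 1): the loss a^2 * \<eta>^r in the square of the centre is then less than the
      gain \<eta>^2. \<open>\<xi>\<close> restores \<xi>^r + \<eta>^r = 1.\<close>
    define \<eta> where "\<eta> = (1 / (a\<^sup>2 + 1)) powr (1 / (r - 2))"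
    define \<xi> where "\<xi> = (1 - \<eta> powr r) powr (1 / r)"
    have a2: "0 < a\<^sup>2" using a by simp
    have \<eta>_powr: "\<eta> powr (r - 2) = 1 / (a\<^sup>2 + 1)"
      using p2 a2 by (simp add: \<eta>_def powr_powr)
    have \<eta>: "0 < \<eta>" "\<eta> < 1"
    proof -
      have "a\<^sup>2 + 1 \<noteq> 0" using a2 by linarith
      then show pos: "0 < \<eta>" by (simp add: \<eta>_def)
      show "\<eta> < 1"
      proof (rule ccontr)
        assume "\<not> \<eta> < 1"
        then have "1 \<le> \<eta> powr (r - 2)" using p2 by (intro ge_one_powr_ge_zero) auto
        then show False using a2 \<eta>_powr by simp
      qed
    qed
    have \<eta>_r: "\<eta> powr r = \<eta>\<^sup>2 / (a\<^sup>2 + 1)"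
    proof -
      have "\<eta> powr r = \<eta> powr (r - 2) * \<eta> powr 2" by (simp flip: powr_add)
      then show ?thesis using \<eta> \<eta>_powr by simp
    qed
    have \<eta>_r1: "0 < \<eta> powr r" "\<eta> powr r < 1"
      using \<eta> p2 powr_less_mono2[of r \<eta> 1] by auto
    have \<xi>_r: "\<xi> powr r = 1 - \<eta> powr r" using \<eta>_r1 p2 by (simp add: \<xi>_def powr_powr)
    have \<xi>: "0 < \<xi>" "\<xi> \<le> 1"
      using \<eta>_r1 p2 by (auto simp: \<xi>_def intro!: powr_le1)
    \<comment> \<open>The square of the centre loses at most what its r-th power loses, because
      \<open>\<xi>\<close> is at most 1 and r > 2.\<close>
    have "\<xi> powr r \<le> \<xi> powr 2" using \<xi> p2 by (intro powr_mono') auto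
    then have \<xi>2: "1 - \<eta> powr r \<le> \<xi>\<^sup>2" using \<xi> \<xi>_r by simp
    have gain: "a\<^sup>2 < (a * \<xi>)\<^sup>2 + \<eta>\<^sup>2"
    proof -
      have "0 < a\<^sup>2 + 1" using a2 by linarith
      then have "a\<^sup>2 / (a\<^sup>2 + 1) < 1" by (simp add: divide_less_eq)
      then have "\<eta>\<^sup>2 * (a\<^sup>2 / (a\<^sup>2 + 1)) < \<eta>\<^sup>2 * 1"
        using \<eta>(1) by (intro mult_strict_left_mono) auto
      then have "a\<^sup>2 * (\<eta>\<^sup>2 / (a\<^sup>2 + 1)) < \<eta>\<^sup>2" by (simp add: mult.commute)
      moreover have "a\<^sup>2 * (1 - \<eta>\<^sup>2 / (a\<^sup>2 + 1)) \<le> a\<^sup>2 * \<xi>\<^sup>2"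
        using \<xi>2 \<eta>_r by (intro mult_left_mono) auto
      ultimately show ?thesis by (simp add: power_mult_distrib right_diff_distrib)
    qed
    \<comment> \<open>The factor \<open>C\<close> has r-th power 2 and compensates for each value
      occupying only half of the interval.\<close>
    define x :: 'k where "x = of_real (C * \<xi>)"
    define y :: 'k where "y = of_real (C * \<eta>)"
    define f where "f = join (\<lambda>_. x) (join (\<lambda>_. y) (\<lambda>_. - y))"
    have norm_x: "norm x powr r = 2 * \<xi> powr r" and norm_y: "norm y powr r = 2 * \<eta> powr r"
      unfolding x_def y_def norm_of_real using C \<xi> \<eta> by (simp_all add: abs_mult powr_mult)
    have f_meas: "f \<in> borel_measurable UI" unfolding f_def by (rule half_functionals_join)
    have f_norm: "(\<lambda>t. norm (f t) powr r) = join (\<lambda>_. norm x powr r) (\<lambda>_. norm y powr r)"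
      by (auto simp: f_def join_def)
    have f_ball: "f \<in> unit_ball p"
      unfolding p2(1) unit_ball_ennreal_iff[OF r1] f_norm integral_join_const
      using f_meas \<xi>_r by (auto intro!: integrable_join simp: norm_x norm_y)
    have c_f: "(LINT t|UI. half0 f t) = x" and b_f: "rcoef (half1 f) = case_nat y (\<lambda>_. 0)"
      unfolding f_def by (rule half_functionals_join)+
    have sc: "norm (a *\<^sub>R x + y) = C * \<bar>a * \<xi> + \<eta>\<bar>" "norm (a *\<^sub>R x - y) = C * \<bar>a * \<xi> - \<eta>\<bar>"
    proof -
      have "a *\<^sub>R x + y = of_real (C * (a * \<xi> + \<eta>))" "a *\<^sub>R x - y = of_real (C * (a * \<xi> - \<eta>))"
        by (simp_all add: x_def y_def scaleR_conv_of_real algebra_simps)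
      then show "norm (a *\<^sub>R x + y) = C * \<bar>a * \<xi> + \<eta>\<bar>" "norm (a *\<^sub>R x - y) = C * \<bar>a * \<xi> - \<eta>\<bar>"
        using C by (simp_all only: norm_of_real abs_mult)
    qed
    have energy: "pair_energy q 0 a x (case_nat y (\<lambda>_. 0))
        = C powr q / 2 * ((\<bar>a * \<xi> + \<eta>\<bar> powr q + \<bar>a * \<xi> - \<eta>\<bar> powr q) / 2)"
      unfolding pair_energy_def rnorm_single[OF q1] sc using C by (simp add: powr_mult algebra_simps)
    have "a powr q = (a\<^sup>2) powr (q / 2)"
    proof -
      have "a\<^sup>2 = a powr 2" using a by simp
      then show ?thesis by (simp only: powr_powr) simp
    qed
    also have "\<dots> < ((a * \<xi>)\<^sup>2 + \<eta>\<^sup>2) powr (q / 2)"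
      using gain q by (intro powr_less_mono2) auto
    also have "\<dots> \<le> (\<bar>a * \<xi> + \<eta>\<bar> powr q + \<bar>a * \<xi> - \<eta>\<bar> powr q) / 2"
      by (rule two_point_ge[OF q])
    finally have "C powr q / 2 * a powr q < pair_energy q 0 a x (case_nat y (\<lambda>_. 0))"
      unfolding energy using C by (intro mult_strict_left_mono) auto
    then show "\<exists>f\<in>(unit_ball p :: (real \<Rightarrow> 'k) set). a powr q / 2 * C powr q
        < pair_energy q 0 a (LINT t|UI. half0 f t) (rcoef (half1 f))"
      using f_ball c_f b_f by (intro bexI[of _ f]) (simp_all add: mult.commute)
  qed
qed

text \<open>The test function takes the two values s(1+t) and s(1-t), with mean s and first
  coefficient st. Staying in the ball forces s below 1 only to second order in t, whereas a separate
  half of the range adds t^q to a^q, and q < 2.\<close>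

lemma not_WMP_small_range:
  fixes q r :: real
  assumes q: "1 \<le> q" "q < 2" and r: "1 < r"
  shows "\<not> WMP (Lp_unit_interval (ennreal r) :: ('k::{real_normed_field, euclidean_space}, (real \<Rightarrow> 'k) set) nspace)
      (Lp_unit_interval (ennreal q) :: ('k, (real \<Rightarrow> 'k) set) nspace)"
proof -
  have p: "1 < ennreal r" using r by simp
  have r1: "1 \<le> r" using r by simp
  from shift_functionals_full[OF p, where 'k = 'k] obtain B where
    B: "shift_functionals (ennreal r) (\<lambda>f :: real \<Rightarrow> 'k. LINT t|UI. f t) rcoef 1 B" by auto
  obtain a where a: "1 \<le> a" "(khinchine_const TYPE('k) q * B powr (q / 2)) / 2 \<le> (a powr q / 2) / 2 powr q"
    using ex_large_weight[OF q(1), of "khinchine_const TYPE('k) q * B powr (q / 2)"]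
      khinchine_const_pos[of q, where 'k = 'k] q by auto
  show ?thesis
  proof (rule shift_functionals.not_WMP[OF B q(1), where \<alpha> = a and \<beta> = 0 and ?M0.0 = "a powr q / 2"])
    show "0 \<le> a" "0 \<le> (0::real)" using a by auto
    show "(a powr q + 0 powr q) / 2 * 1 powr q \<le> a powr q / 2" by simp
    show "khinchine_const TYPE('k) q * B powr (q / 2) / 2 \<le> a powr q / 2 / 2 powr q" by (rule a(2))
    \<comment> \<open>The loss in the energy from the factor \<open>s\<close> is at most A * t^2/2.
      \<open>t\<close> is chosen so that t^2 = t^q/(A+1), which makes this loss smaller than the
      gain t^q.\<close>
    define A where "A = r * q * (a powr q + 1)"
    have A: "0 < A" using q r by (auto simp: A_def intro!: mult_pos_pos add_nonneg_pos)
    define t where "t = (1 / (A + 1)) powr (1 / (2 - q))"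
    have t_powr: "t powr (2 - q) = 1 / (A + 1)" using q A by (simp add: t_def powr_powr)
    have t: "0 < t" "t < 1"
    proof -
      show "0 < t" using A by (simp add: t_def)
      show "t < 1"
      proof (rule ccontr)
        assume "\<not> t < 1"
        then have "1 \<le> t powr (2 - q)" using q by (intro ge_one_powr_ge_zero) auto
        then show False using A t_powr by simp
      qed
    qed
    \<comment> \<open>This normalises \<open>f\<close>: the mean of (1+t)^r and (1-t)^r is at most
      cosh(rt), hence at most exp(r^2 t^2/2), which is the inverse of s^r.\<close>
    define s where "s = exp (- (r * t\<^sup>2 / 2))"
    have s: "0 < s" by (simp add: s_def)
    define x :: 'k where "x = of_real s"
    define y :: 'k where "y = of_real (s * t)"
    define f where "f = join (\<lambda>_. x + y) (\<lambda>_. x - y)"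
    have f_meas: "f \<in> borel_measurable UI" unfolding f_def by (intro measurable_join) auto
    have f_norm: "(\<lambda>t. norm (f t) powr r) = join (\<lambda>_. norm (x + y) powr r) (\<lambda>_. norm (x - y) powr r)"
      by (auto simp: f_def join_def)
    have nxy: "norm (x + y) = s * (1 + t)" "norm (x - y) = s * (1 - t)"
    proof -
      have "x + y = of_real (s * (1 + t))" "x - y = of_real (s * (1 - t))"
        by (simp_all add: x_def y_def algebra_simps)
      then show "norm (x + y) = s * (1 + t)" "norm (x - y) = s * (1 - t)"
        using s t by (simp_all only: norm_of_real) (simp_all add: abs_mult)
    qed
    have "(norm (x + y) powr r + norm (x - y) powr r) / 2 \<le> 1"
    proof -
      have e: "(1 + u) powr r \<le> exp (r * u)" if "-1 < u" for u :: real
      proof -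
        have "(1 + u) powr r \<le> exp u powr r"
          using that r by (intro powr_mono2) (auto simp: exp_ge_add_one_self)
        then show ?thesis by (simp add: powr_def)
      qed
      have "((1 + t) powr r + (1 - t) powr r) / 2 \<le> cosh (r * t)"
        using e[of t] e[of "- t"] t by (simp add: cosh_field_def)
      also have "\<dots> \<le> exp ((r * t)\<^sup>2 / 2)" by (rule cosh_le_exp_square)
      finally have "s powr r * (((1 + t) powr r + (1 - t) powr r) / 2) \<le> s powr r * exp ((r * t)\<^sup>2 / 2)"
        by (rule mult_left_mono) simp
      also have "s powr r * exp ((r * t)\<^sup>2 / 2) = 1"
        by (simp add: s_def powr_def exp_add[symmetric] power2_eq_square)
      finally show ?thesis unfolding nxy powr_mult by (simp add: distrib_left)
    qed
    then have f_ball: "f \<in> unit_ball (ennreal r)"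
      unfolding unit_ball_ennreal_iff[OF r1] f_norm integral_join_const
      using f_meas by (auto intro!: integrable_join)
    have c_f: "(LINT t|UI. f t) = x"
      unfolding f_def integral_join_const by (simp add: scaleR_2[symmetric])
    have b_f: "rcoef f = case_nat y (\<lambda>_. 0)"
      unfolding f_def rcoef_join_const by (simp add: scaleR_2[symmetric])
    have energy: "pair_energy q a 0 x (case_nat y (\<lambda>_. 0)) = s powr q * (a powr q + t powr q) / 2"
    proof -
      have "norm x = s" "norm y = s * t"
        unfolding x_def y_def norm_of_real using s t by (simp_all add: abs_mult)
      then show ?thesis
        unfolding pair_energy_def rnorm_single[OF q(1)] by (simp add: powr_mult algebra_simps)
    qed
    have "a powr q < s powr q * (a powr q + t powr q)"
    proof -
      have t_q: "t powr q \<le> 1" using t q by (intro powr_le1) auto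
      have "t powr q * t powr (2 - q) = t powr 2" by (simp flip: powr_add)
      then have t2: "t\<^sup>2 = t powr q / (A + 1)" using t t_powr by simp
      have tq_pos: "0 < t powr q" using t by simp
      have sq: "1 - r * q * t\<^sup>2 / 2 \<le> s powr q"
      proof -
        have "s powr q = exp (- (r * q * t\<^sup>2 / 2))" by (simp add: s_def powr_def)
        then show ?thesis using exp_ge_add_one_self[of "- (r * q * t\<^sup>2 / 2)"] by simp
      qed
      have "r * q * t\<^sup>2 / 2 * (a powr q + t powr q) \<le> r * q * t\<^sup>2 / 2 * (a powr q + 1)"
        using t_q r q by (intro mult_left_mono) auto
      also have "\<dots> = A * t\<^sup>2 / 2" by (simp add: A_def algebra_simps)
      also have "\<dots> = t powr q * (A / (2 * (A + 1)))" unfolding t2 by (simp add: mult_ac)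
      also have "\<dots> < t powr q * 1"
        using A tq_pos by (intro mult_strict_left_mono) (auto simp: field_simps)
      finally have "a powr q < (1 - r * q * t\<^sup>2 / 2) * (a powr q + t powr q)"
        by (simp add: algebra_simps)
      also have "\<dots> \<le> s powr q * (a powr q + t powr q)"
        by (rule mult_right_mono[OF sq]) simp
      finally show ?thesis .
    qed
    then have "a powr q / 2 < pair_energy q a 0 (LINT t|UI. f t) (rcoef f)"
      unfolding c_f b_f energy by simp
    then show "\<exists>f\<in>(unit_ball (ennreal r) :: (real \<Rightarrow> 'k) set). a powr q / 2 < pair_energy q a 0 (LINT t|UI. f t) (rcoef f)"
      using f_ball by blast
  qed
qed

text \<open>In the sup norm both halves may have modulus 1 at the same time, so centre and first
  coefficient are simultaneously 1. The energy is then (a^q + 1)/2 against the threshold a^q/2, with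
  no small parameter.\<close>

lemma not_WMP_infinite_domain:
  fixes q :: real
  assumes q: "1 \<le> q"
  shows "\<not> WMP (Lp_unit_interval top :: ('k::{real_normed_field, euclidean_space}, (real \<Rightarrow> 'k) set) nspace)
      (Lp_unit_interval (ennreal q) :: ('k, (real \<Rightarrow> 'k) set) nspace)"
proof -
  have top: "1 < (top :: ennreal)" by simp
  have c_le: "norm (LINT t|UI. half0 f t) \<le> 1" if f: "f \<in> unit_ball top" for f :: "real \<Rightarrow> 'k"
  proof -
    have m: "f \<in> borel_measurable UI" and ae: "AE t in UI. norm (f t) \<le> 1"
      using f unfolding unit_ball_infinity_iff by auto
    have "half0 f \<in> unit_ball top"
      unfolding unit_ball_infinity_iff using half_measurable(1)[OF m] AE_halves(1)[OF ae] by simp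
    then have "(LINT t|UI. norm (half0 f t)) \<le> 1" by (intro integral_norm_le_1[of top]) auto
    then show ?thesis by (rule order_trans[OF integral_norm_bound])
  qed
  from shift_functionals_half[OF top c_le] obtain B where
    B: "shift_functionals top (\<lambda>f :: real \<Rightarrow> 'k. LINT t|UI. half0 f t) (\<lambda>f. rcoef (half1 f)) 1 B" by auto
  obtain a where a: "1 \<le> a" "(khinchine_const TYPE('k) q * B powr (q / 2)) / 2 \<le> (a powr q / 2) / 2 powr q"
    using ex_large_weight[OF q(1), of "khinchine_const TYPE('k) q * B powr (q / 2)"]
      khinchine_const_pos[of q, where 'k = 'k] q by auto
  show ?thesis
  proof (rule shift_functionals.not_WMP[OF B q(1), where \<alpha> = a and \<beta> = 0 and ?M0.0 = "a powr q / 2"])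
    show "0 \<le> a" "0 \<le> (0::real)" using a by auto
    show "(a powr q + 0 powr q) / 2 * 1 powr q \<le> a powr q / 2" by simp
    show "khinchine_const TYPE('k) q * B powr (q / 2) / 2 \<le> a powr q / 2 / 2 powr q" by (rule a(2))
    define f :: "real \<Rightarrow> 'k" where "f = join (\<lambda>_. 1) (join (\<lambda>_. 1) (\<lambda>_. - 1))"
    have f_meas: "f \<in> borel_measurable UI" unfolding f_def by (intro measurable_join) auto
    have f_ball: "f \<in> unit_ball top"
      unfolding unit_ball_infinity_iff f_def
      by (intro conjI measurable_join AE_I2) (simp_all add: join_def)
    have c_f: "(LINT t|UI. half0 f t) = 1" and b_f: "rcoef (half1 f) = case_nat 1 (\<lambda>_. 0)"
      unfolding f_def by (rule half_functionals_join)+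
    have "a powr q / 2 < pair_energy q a 0 (LINT t|UI. half0 f t) (rcoef (half1 f))"
      unfolding c_f b_f pair_energy_def rnorm_single[OF q] by simp
    then show "\<exists>f\<in>(unit_ball top :: (real \<Rightarrow> 'k) set). a powr q / 2 < pair_energy q a 0 (LINT t|UI. half0 f t) (rcoef (half1 f))"
      using f_ball by blast
  qed
qed

section \<open>Domain L_1: a rank one operator\<close>

lemma Lp_norm_const:
  assumes "1 \<le> q"
  shows "(\<lambda>_. z) \<in> Lp q" "Lp_norm q UI (\<lambda>_. z :: 'k::{real_normed_field, euclidean_space}) = norm z"
proof -
  have one: "(\<lambda>_. 1 :: 'k) \<in> Lp q \<and> Lp_norm q UI (\<lambda>_. 1 :: 'k) = 1"
    using assms
  proof (cases rule: exponent_cases)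
    case 1
    then show ?thesis
      by (simp add: Lp_fun_def Lp_norm_def esssup_const emeasure_restrict_space)
  next
    case (2 r)
    have "(LINT t|UI. norm (1 :: 'k) powr r) = 1" unfolding integral_const_UI by simp
    then show ?thesis using 2 by (simp only: Lp_fun_ennreal_iff Lp_norm_ennreal) simp
  qed
  then show "(\<lambda>_. z) \<in> Lp q" using Lp_fun_scale[of "\<lambda>_. 1" q UI z] by simp
  show "Lp_norm q UI (\<lambda>_. z) = norm z" using Lp_norm_scale[OF assms, of "\<lambda>_. 1" z] one by simp
qed

lemma measurable_ident_UI [measurable]: "(\<lambda>t. t) \<in> borel_measurable UI"
  using id_borel_measurable_lebesgue_on[of "{0..1}"] by (simp add: id_def)

lemma integrable_ident_scaleR:
  fixes f :: "real \<Rightarrow> 'k::euclidean_space"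
  assumes f: "integrable UI f"
  shows "integrable UI (\<lambda>t. t *\<^sub>R f t)"
proof (rule Bochner_Integration.integrable_bound[OF f])
  have [measurable]: "f \<in> borel_measurable UI" using f by auto
  show "(\<lambda>t. t *\<^sub>R f t) \<in> borel_measurable UI" by measurable
  show "AE t in UI. norm (t *\<^sub>R f t) \<le> norm (f t)"
    by (rule AE_I2) (auto intro: mult_left_le_one_le)
qed

text \<open>Squeezing a density into the right half, with doubled height, keeps its mass and changes
  the mean position m to (1+m)/2, so the distance from 1 is halved in each step.\<close>

lemma concentrating_functions:
  "\<exists>g :: real \<Rightarrow> real. integrable UI g \<and> (\<forall>t. 0 \<le> g t) \<and> (LINT t|UI. g t) = 1
     \<and> 1 - (1/2) ^ k \<le> (LINT t|UI. t * g t)"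
proof (induction k)
  case 0
  show ?case
  proof (intro exI[of _ "\<lambda>_. 1"] conjI)
    show "1 - (1/2) ^ 0 \<le> (LINT t|UI. t * 1 :: real)"
      by (auto intro!: integral_nonneg_AE AE_I2)
    show "(LINT t|UI. 1 :: real) = 1" by (rule integral_const_UI)
  qed (auto simp del: lebesgue_integral_const)
next
  case (Suc k)
  then obtain g :: "real \<Rightarrow> real" where g: "integrable UI g" "\<And>t. 0 \<le> g t" "(LINT t|UI. g t) = 1"
    "1 - (1/2) ^ k \<le> (LINT t|UI. t * g t)" by blast
  let ?h = "join (\<lambda>_. 0) (\<lambda>t. 2 * g t)"
  have i2: "integrable UI (\<lambda>t. 2 * g t)" using g(1) by simp
  have tg: "integrable UI (\<lambda>t. t * g t)" using integrable_ident_scaleR[OF g(1)] by simp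
  have "(LINT t|UI. ?h t) = 1"
    using integral_join[OF integrable_const_UI[of "0::real"] i2] g(3) by simp
  moreover have "1 - (1/2) ^ Suc k \<le> (LINT t|UI. t * ?h t)"
  proof -
    have "(\<lambda>t. t * ?h t) = join (\<lambda>_. 0) (\<lambda>t. g t + t * g t)"
      by (auto simp: join_def algebra_simps)
    moreover have "(LINT t|UI. join (\<lambda>_. 0) (\<lambda>t. g t + t * g t) t) = (1 + (LINT t|UI. t * g t)) / 2"
      using integral_join[OF integrable_const_UI[of "0::real"], of "\<lambda>t. g t + t * g t"] g(1,3) tg by simp
    ultimately show ?thesis using g(4) by simp
  qed
  moreover have "integrable UI ?h" by (rule integrable_join[OF integrable_const_UI i2])
  moreover have "0 \<le> ?h t" for t using g(2) by (simp add: join_def)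
  ultimately show ?case by blast
qed

text \<open>The weight t is less than 1 almost everywhere, so the integral of t|f| is strictly below
  that of |f| unless f = 0; densities concentrating at 1 show that the norm is nevertheless 1. As
  \<open>T\<close> takes constant values \<open>\<phi> f\<close>, maximizing sequences cannot have
  \<open>\<phi>\<close> tending to 0.\<close>

lemma not_WMP_L1:
  assumes q: "1 \<le> q"
  shows "\<not> WMP (Lp_unit_interval 1 :: ('k::{real_normed_field, euclidean_space}, (real \<Rightarrow> 'k) set) nspace)
      (Lp_unit_interval q :: ('k, (real \<Rightarrow> 'k) set) nspace)"
proof -
  define \<phi> where "\<phi> f = (LINT t|UI. t *\<^sub>R f t)" for f :: "real \<Rightarrow> 'k"
  have int: "integrable UI f" if "f \<in> Lp 1" for f :: "real \<Rightarrow> 'k"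
    by (rule Lp_integrable[OF order_refl that])
  have norm1: "(LINT t|UI. norm (f t)) = Lp_norm 1 UI f" for f :: "real \<Rightarrow> 'k"
    using Lp_norm_ennreal[of 1 UI f] by simp
  have less: "norm (\<phi> f) < 1" if f: "f \<in> Lp 1" "Lp_norm 1 UI f \<le> 1" for f :: "real \<Rightarrow> 'k"
  proof -
    have i: "integrable UI (\<lambda>t. norm (f t))" using int[OF f(1)] by simp
    have ti: "integrable UI (\<lambda>t. t * norm (f t))" using integrable_ident_scaleR[OF i] by simp
    have "norm (\<phi> f) \<le> (LINT t|UI. norm (t *\<^sub>R f t))" unfolding \<phi>_def by (rule integral_norm_bound)
    also have "\<dots> = (LINT t|UI. t * norm (f t))"
      by (rule Bochner_Integration.integral_cong) auto
    also have "\<dots> < 1"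
    proof (rule ccontr)
      assume "\<not> (LINT t|UI. t * norm (f t)) < 1"
      then have "(LINT t|UI. norm (f t) - t * norm (f t)) \<le> 0"
        using i ti f(2) norm1[of f] by simp
      moreover have nn: "AE t in UI. 0 \<le> norm (f t) - t * norm (f t)"
        by (rule AE_I2) (auto simp: mult_left_le_one_le)
      ultimately have "(LINT t|UI. norm (f t) - t * norm (f t)) = 0"
        using integral_nonneg_AE[OF nn] by simp
      then have "AE t in UI. norm (f t) - t * norm (f t) = 0"
        using i ti nn by (subst (asm) integral_nonneg_eq_0_iff_AE) auto
      moreover have "AE t in UI. t \<noteq> 1"
        using AE_lebesgue_neq[of 1] by (auto simp: AE_restrict_space_iff elim!: eventually_mono)
      ultimately have "AE t in UI. t * norm (f t) = 0"
        by eventually_elim (auto simp: algebra_simps)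
      then have "(LINT t|UI. t * norm (f t)) = 0"
        using ti by (subst integral_cong_AE[where g = "\<lambda>_. 0"]) auto
      then show False using \<open>\<not> (LINT t|UI. t * norm (f t)) < 1\<close> by simp
    qed
    finally show ?thesis .
  qed
  have "Lp_operator 1 q (\<lambda>f _. \<phi> f) \<phi> 1 1"
  proof
    show "1 \<le> (1 :: ennreal)" "1 \<le> q" "0 < (1::real)" using q by auto
    fix f g :: "real \<Rightarrow> 'k" and z :: 'k
    assume f: "f \<in> Lp 1"
    show "(\<lambda>_. \<phi> f) \<in> Lp q" by (rule Lp_norm_const(1)[OF q])
    show scale: "\<phi> (\<lambda>t. z * f t) = z * \<phi> f"
      unfolding \<phi>_def by (simp flip: mult_scaleR_right)
    then show "AE t in UI. \<phi> (\<lambda>t. z * f t) = z * \<phi> f" by simp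
    assume g: "g \<in> Lp 1"
    show add: "\<phi> (\<lambda>t. f t + g t) = \<phi> f + \<phi> g"
      using integrable_ident_scaleR[OF int[OF f]] integrable_ident_scaleR[OF int[OF g]]
      by (simp add: \<phi>_def scaleR_add_right)
    then show "AE t in UI. \<phi> (\<lambda>t. f t + g t) = \<phi> f + \<phi> g" by simp
    assume eq: "AE t in UI. f t = g t"
    have [measurable]: "f \<in> borel_measurable UI" "g \<in> borel_measurable UI"
      using f g by (auto intro: Lp_fun_measurable)
    show cong: "\<phi> f = \<phi> g"
      unfolding \<phi>_def by (rule integral_cong_AE) (use eq in auto)
    then show "AE t in UI. \<phi> f = \<phi> g" by simp
  next
    fix f :: "real \<Rightarrow> 'k" assume f: "f \<in> Lp 1" "Lp_norm 1 UI f \<le> 1"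
    show "norm (\<phi> f) \<le> 1" using less[OF f] by simp
    show "Lp_norm q UI (\<lambda>_. \<phi> f) < 1" using less[OF f] by (simp add: Lp_norm_const(2)[OF q])
  next
    fix \<epsilon> :: real assume "0 < \<epsilon>"
    then obtain k where k: "(1/2 :: real) ^ k < \<epsilon>" using real_arch_pow_inv[of \<epsilon> "1/2"] by auto
    obtain g :: "real \<Rightarrow> real" where g: "integrable UI g" "\<And>t. 0 \<le> g t" "(LINT t|UI. g t) = 1"
      "1 - (1/2) ^ k \<le> (LINT t|UI. t * g t)" using concentrating_functions[of k] by blast
    define f :: "real \<Rightarrow> 'k" where "f t = of_real (g t)" for t
    have [measurable]: "g \<in> borel_measurable UI" using g(1) by auto
    have norm_f: "norm (f t) = g t" for t using g(2) by (simp add: f_def)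
    have f_meas: "f \<in> borel_measurable UI" unfolding f_def[abs_def] by measurable
    have f_Lp: "f \<in> Lp 1"
      using Lp_fun_ennreal_iff[of 1 f UI] f_meas g(1,2) by (simp add: norm_f)
    have "Lp_norm 1 UI f = 1" using norm1[of f] g(3) by (simp add: norm_f)
    moreover have "\<phi> f = of_real (LINT t|UI. t * g t)"
    proof -
      have "integrable UI (\<lambda>t. t * g t)" using integrable_ident_scaleR[OF g(1)] by simp
      moreover have "(\<lambda>t. t *\<^sub>R f t) = (\<lambda>t. of_real (t * g t))" by (simp add: f_def scaleR_conv_of_real)
      ultimately show ?thesis unfolding \<phi>_def by (simp only: integral_of_real)
    qed
    then have "1 - \<epsilon> < norm (\<phi> f)" using g(4) k by (simp only: norm_of_real)
    ultimately show "\<exists>f\<in>(Lp 1 :: (real \<Rightarrow> 'k) set). Lp_norm 1 UI f \<le> 1 \<and> 1 - \<epsilon> < Lp_norm q UI (\<lambda>_. \<phi> f)"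
      using f_Lp by (intro bexI[of _ f]) (auto simp: Lp_norm_const(2)[OF q])
  next
    fix F :: "nat \<Rightarrow> real \<Rightarrow> 'k"
    assume "(\<lambda>n. \<phi> (F n)) \<longlonglongrightarrow> 0"
    then have "(\<lambda>n. Lp_norm q UI (\<lambda>_. \<phi> (F n))) \<longlonglongrightarrow> 0"
      unfolding Lp_norm_const(2)[OF q] by (rule tendsto_norm_zero)
    then show "\<not> (\<lambda>n. Lp_norm q UI (\<lambda>_. \<phi> (F n))) \<longlonglongrightarrow> 1"
      using LIMSEQ_unique by fastforce
  qed
  then show ?thesis by (rule Lp_operator.not_WMP)
qed

text \<open>\<open>slot\<close> takes the value n \<ge> 1 exactly on the interval (1/(n+1), 1/n], so
  composition with it carries bounded sequences to bounded functions with the supremum as norm. The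
  index 0 occurs in the unit interval only at t = 0, where the quotient 1/0 is 0.\<close>

definition slot :: "real \<Rightarrow> nat" where
  "slot t = nat \<lfloor>1 / t\<rfloor>"

lemma slot_measurable: "slot \<in> UI \<rightarrow>\<^sub>M count_space UNIV"
proof -
  have "(\<lambda>t::real. nat \<lfloor>1 / t\<rfloor>) \<in> borel \<rightarrow>\<^sub>M count_space UNIV" by measurable
  then show ?thesis
    unfolding slot_def[abs_def] by (intro measurable_restrict_space1 measurable_completion) simp
qed

text \<open>Each index from 1 on is taken on an interval of positive length, which cannot lie in a
  null set.\<close>

lemma slot_AE_D:
  assumes ae: "AE t in UI. P (slot t)" and n: "1 \<le> n"
  shows "P n"
proof (rule ccontr)
  assume P: "\<not> P n"
  let ?I = "{1 / (real n + 1)<..1 / real n}"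
  have slot: "slot t = n" if "t \<in> ?I" for t
  proof -
    have t: "0 < t" using that by (auto intro: less_trans[rotated])
    have "real n \<le> 1 / t" "1 / t < real n + 1" using that t n by (auto simp: field_simps)
    then have "\<lfloor>1 / t\<rfloor> = int n" by (simp add: floor_eq_iff)
    then show ?thesis by (simp add: slot_def)
  qed
  have sub: "?I \<subseteq> {0..1}"
  proof
    fix t assume "t \<in> ?I"
    moreover have "1 / real n \<le> 1" "0 \<le> 1 / (real n + 1)" using n by auto
    ultimately show "t \<in> {0..1}" unfolding greaterThanAtMost_iff atLeastAtMost_iff by linarith
  qed
  have "AE t in lebesgue. t \<in> {0..1} \<longrightarrow> P (slot t)"
    using ae by (simp add: AE_restrict_space_iff)
  then have "AE t in lebesgue. t \<notin> ?I"
    using slot P sub by (auto elim!: eventually_mono)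
  then have "?I \<in> null_sets lebesgue" by (simp add: AE_iff_null_sets)
  then have "emeasure lebesgue ?I = 0" by auto
  moreover have lt: "1 / (real n + 1) < 1 / real n" using n by (intro divide_strict_left_mono) auto
  ultimately have "ennreal (1 / real n - 1 / (real n + 1)) = 0" by simp
  then show False using lt by simp
qed

text \<open>The first moments of the two stretched halves of a function in the ball add up to at
  most 2, and they bound the centre and every coefficient. So \<open>norm (w f n)\<close> is below 2
  because of damping, while the constant 1 next to \<open>rad n\<close> gives 1 +
  \<open>damp n\<close>.\<close>

lemma not_WMP_infinite_range:
  assumes p: "1 < p"
  shows "\<not> WMP (Lp_unit_interval p :: ('k::{real_normed_field, euclidean_space}, (real \<Rightarrow> 'k) set) nspace)
      (Lp_unit_interval top :: ('k, (real \<Rightarrow> 'k) set) nspace)"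
proof -
  have p1: "1 \<le> p" using p by simp
  obtain r where r: "1 < r"
    "\<And>f :: real \<Rightarrow> 'k. f \<in> Lp p \<Longrightarrow> integrable UI (\<lambda>t. norm (f t) powr r)"
    "\<And>f :: real \<Rightarrow> 'k. f \<in> unit_ball p \<Longrightarrow> (LINT t|UI. norm (f t) powr r) \<le> 1"
    by (rule finite_exponent[OF p, where 'k = 'k]) blast
  note L0 = Lp_fun_half(1)[OF p1] and L1 = Lp_fun_half(2)[OF p1]
  note int = Lp_integrable[OF p1]
  note meas = Lp_fun_measurable
  define c where "c f = (LINT t|UI. half0 f t)" for f :: "real \<Rightarrow> 'k"
  define b where "b f = rcoef (half1 f)" for f :: "real \<Rightarrow> 'k"
  define w where "w f n = c f + damp n *\<^sub>R b f n" for f n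
  define T where "T f t = w f (slot t)" for f t
  \<comment> \<open>A bound for the centre alone and for any coefficient alone. It is below 2 since
    r > 1, so a function with almost vanishing centre is far from the norm 2.\<close>
  define \<kappa> where "\<kappa> = (2::real) powr (1 / r)"
  have \<kappa>: "\<kappa> < 2" using r(1) powr_less_mono[of "1 / r" 1 "2::real"] by (simp add: \<kappa>_def)
  have half_le: "(LINT t|UI. norm (half0 f t)) \<le> \<kappa>" "(LINT t|UI. norm (half1 f t)) \<le> \<kappa>"
    if f: "f \<in> unit_ball p" for f :: "real \<Rightarrow> 'k"
  proof -
    have f': "f \<in> Lp p" using f by simp
    show "(LINT t|UI. norm (half0 f t)) \<le> \<kappa>" "(LINT t|UI. norm (half1 f t)) \<le> \<kappa>"
      unfolding \<kappa>_def using r(1)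
      by (intro half_integrals_le meas[OF f'] r(2)[OF f'] r(3)[OF f]; simp)+
  qed
  have c_le: "norm (c f) \<le> (LINT t|UI. norm (half0 f t))" for f
    unfolding c_def by (rule integral_norm_bound)
  have b_le: "norm (b f n) \<le> (LINT t|UI. norm (half1 f t))" if "f \<in> Lp p" for f n
    unfolding b_def by (rule norm_rcoef_le[OF int[OF L1[OF that]]])
  have sum_le: "(LINT t|UI. norm (half0 f t)) + (LINT t|UI. norm (half1 f t)) \<le> 2"
    if f: "f \<in> unit_ball p" for f :: "real \<Rightarrow> 'k"
  proof -
    have "integrable UI (\<lambda>t. norm (f t))" using int[of f] f by simp
    from integral_halves[OF this] show ?thesis using integral_norm_le_1[OF p1 f] by simp
  qed
  have w_le: "norm (w f n) \<le> norm (c f) + damp n * norm (b f n)" for f n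
    unfolding w_def using norm_triangle_ineq[of "c f" "damp n *\<^sub>R b f n"] damp_pos[of n] by simp
  have damp_b: "damp n * norm (b f n) \<le> norm (b f n)" for f n
    using damp_less_1[of n] by (intro mult_left_le_one_le) (auto simp: less_imp_le damp_pos)
  have b_lim: "(\<lambda>n. norm (b f n)) \<longlonglongrightarrow> 0" if f: "f \<in> Lp p" for f
  proof -
    have "summable (\<lambda>n. (norm (b f n))\<^sup>2)"
      using Lp_l2_rcoef[OF p L1[OF f]] by (simp add: l2_def b_def)
    then have "(\<lambda>n. sqrt ((norm (b f n))\<^sup>2)) \<longlonglongrightarrow> sqrt 0"
      by (intro tendsto_real_sqrt summable_LIMSEQ_zero)
    then show ?thesis by simp
  qed
  have w_bound: "\<exists>K<2. \<forall>n. norm (w f n) \<le> K" if f: "f \<in> unit_ball p" for f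
  proof -
    have f': "f \<in> Lp p" using f by simp
    \<comment> \<open>The strict inequality has to be uniform in n. Coefficients below
      \<open>\<delta>\<close> are harmless because \<kappa> + \<delta> < 2; larger ones occur at
      finitely many indices only, and there damping loses at least (1 - \<open>damp N\<close>) *
      \<delta>.\<close>
    define \<delta> where "\<delta> = (2 - \<kappa>) / 2"
    have \<delta>: "0 < \<delta>" using \<kappa> by (simp add: \<delta>_def)
    then obtain N where N: "\<And>n. n \<ge> N \<Longrightarrow> norm (b f n) < \<delta>"
      using order_tendstoD(2)[OF b_lim[OF f'], of \<delta>] by (auto simp: eventually_sequentially)
    have "norm (w f n) \<le> max (\<kappa> + \<delta>) (2 - (1 - damp N) * \<delta>)" for n
    proof (cases "norm (b f n) < \<delta>")
      case True
      then have "norm (w f n) \<le> \<kappa> + \<delta>"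
        using w_le[of f n] damp_b[of n f] c_le[of f] half_le(1)[OF f] by linarith
      then show ?thesis by simp
    next
      case False
      then have nN: "n \<le> N" using N[of n] by (cases "n \<le> N") auto
      have "norm (w f n) \<le> norm (c f) + damp N * norm (b f n)"
        using w_le[of f n] mult_right_mono[OF damp_mono[OF nN], of "norm (b f n)"] by simp
      also have "\<dots> = norm (c f) + norm (b f n) - (1 - damp N) * norm (b f n)"
        by (simp add: algebra_simps)
      also have "\<dots> \<le> 2 - (1 - damp N) * \<delta>"
      proof -
        have "(1 - damp N) * \<delta> \<le> (1 - damp N) * norm (b f n)"
          using False damp_less_1[of N] by (intro mult_left_mono) auto
        then show ?thesis using c_le[of f] b_le[OF f', of n] sum_le[OF f] by linarith
      qed
      finally show ?thesis by simp
    qed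
    moreover have "max (\<kappa> + \<delta>) (2 - (1 - damp N) * \<delta>) < 2"
    proof -
      have "0 < (1 - damp N) * \<delta>" using \<delta> damp_less_1[of N] by (intro mult_pos_pos) auto
      moreover have "\<kappa> + \<delta> < 2" using \<kappa> by (simp add: \<delta>_def field_simps)
      ultimately show ?thesis by simp
    qed
    ultimately show ?thesis by blast
  qed
  have T_meas [measurable]: "T f \<in> borel_measurable UI" for f
    unfolding T_def[abs_def] by (rule measurable_compose[OF slot_measurable]) simp
  have T_Lp: "T f \<in> Lp top" if f: "f \<in> Lp p" for f
  proof (rule Lp_infinity_I(1)[OF T_meas AE_I2])
    show "norm (T f t) \<le> norm (c f) + (LINT t|UI. norm (half1 f t))" for t
      using w_le[of f "slot t"] damp_b[of "slot t" f] b_le[OF f, of "slot t"] by (simp add: T_def)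
  qed
  have c_add: "c (\<lambda>t. f t + g t) = c f + c g" if "f \<in> Lp p" "g \<in> Lp p" for f g
    using int[OF L0[OF that(1)]] int[OF L0[OF that(2)]] by (simp add: c_def)
  have c_scale: "c (\<lambda>t. z * f t) = z * c f" for z f by (simp add: c_def)
  have c_cong: "c f = c g" if "f \<in> Lp p" "g \<in> Lp p" "AE t in UI. f t = g t" for f g
    unfolding c_def by (rule integral_cong_AE[OF meas[OF L0[OF that(1)]] meas[OF L0[OF that(2)]] AE_halves(1)[OF that(3)]])
  have "Lp_operator p top T c \<kappa> 2"
  proof
    show "1 \<le> p" "1 \<le> (top :: ennreal)" "0 < (2::real)" using p1 by auto
    fix f g :: "real \<Rightarrow> 'k" and z :: 'k
    assume f: "f \<in> Lp p"
    show "T f \<in> Lp top" by (rule T_Lp[OF f])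
    show "c (\<lambda>t. z * f t) = z * c f" by (rule c_scale)
    show "AE t in UI. T (\<lambda>t. z * f t) t = z * T f t"
      by (rule AE_I2) (simp add: T_def w_def c_scale b_def rcoef_mult distrib_left)
    assume g: "g \<in> Lp p"
    show "c (\<lambda>t. f t + g t) = c f + c g" by (rule c_add[OF f g])
    show "AE t in UI. T (\<lambda>t. f t + g t) t = T f t + T g t"
      by (rule AE_I2) (simp add: T_def w_def c_add[OF f g] b_def rcoef_add[OF int[OF L1[OF f]] int[OF L1[OF g]]] scaleR_add_right)
    assume eq: "AE t in UI. f t = g t"
    show "c f = c g" by (rule c_cong[OF f g eq])
    moreover have "b f = b g"
      unfolding b_def by (rule rcoef_cong_AE[OF meas[OF L1[OF f]] meas[OF L1[OF g]] AE_halves(2)[OF eq]])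
    ultimately show "AE t in UI. T f t = T g t" by (simp add: T_def w_def)
  next
    fix f :: "real \<Rightarrow> 'k" assume f: "f \<in> Lp p" "Lp_norm p UI f \<le> 1"
    then have fb: "f \<in> unit_ball p" by simp
    show "norm (c f) \<le> \<kappa>" using c_le[of f] half_le(1)[OF fb] by simp
    obtain K where K: "K < 2" "\<And>n. norm (w f n) \<le> K" using w_bound[OF fb] by blast
    have "Lp_norm top UI (T f) \<le> K"
      by (rule Lp_infinity_I(2)[OF T_meas AE_I2]) (simp add: T_def K(2))
    then show "Lp_norm top UI (T f) < 2" using K(1) by simp
  next
    fix \<epsilon> :: real assume \<epsilon>: "0 < \<epsilon>"
    have "eventually (\<lambda>n. 1 - \<epsilon> < damp n) sequentially"
      using order_tendstoD(1)[OF damp_tendsto, of "1 - \<epsilon>"] \<epsilon> by simp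
    then obtain N where N: "\<And>n. n \<ge> N \<Longrightarrow> 1 - \<epsilon> < damp n" by (auto simp: eventually_sequentially)
    \<comment> \<open>The successor ensures n \<ge> 1, as \<open>slot\<close> takes the index 0 only
      on a null set.\<close>
    define n where "n = Suc N"
    define h :: "real \<Rightarrow> 'k" where "h t = of_real (rad n t)" for t
    define f where "f = join (\<lambda>_. 1) h"
    have h_meas [measurable]: "h \<in> borel_measurable UI" unfolding h_def[abs_def] by measurable
    have f_meas: "f \<in> borel_measurable UI" unfolding f_def by measurable
    have f_norm: "norm (f t) = 1" for t by (simp add: f_def join_def h_def)
    have f_ball: "f \<in> unit_ball p"
      using p1
    proof (cases rule: exponent_cases)
      case 1
      then show ?thesis using f_meas f_norm by (simp only: unit_ball_infinity_iff) simp
    next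
      case (2 s)
      have "(LINT t|UI. norm (f t) powr s) = 1" unfolding f_norm integral_const_UI by simp
      then show ?thesis unfolding 2(1) unit_ball_ennreal_iff[OF 2(2)] using f_meas by (simp add: f_norm)
    qed
    then have f': "f \<in> Lp p" by simp
    have c_f: "c f = 1"
    proof -
      have "c f = (LINT t|UI. (1::'k))"
        unfolding c_def by (rule integral_cong_AE[OF half_measurable(1)[OF f_meas] borel_measurable_const])
          (unfold f_def, rule half0_join)
      then show ?thesis unfolding integral_const_UI .
    qed
    have b_f: "b f n = 1"
    proof -
      have "b f = rcoef h"
        unfolding b_def by (rule rcoef_cong_AE[OF half_measurable(2)[OF f_meas] h_meas])
          (unfold f_def, rule half1_join)
      moreover have "rad n t *\<^sub>R h t = 1" for t
        using abs_rad[of n t] by (auto simp: h_def abs_if scaleR_conv_of_real of_real_mult[symmetric] split: if_splits simp del: of_real_mult)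
      ultimately show ?thesis unfolding rcoef_def by (simp only: integral_const_UI)
    qed
    have "AE t in UI. norm (w f (slot t)) \<le> Lp_norm top UI (T f)"
      using AE_norm_le_Lp_norm_infinity(1)[OF T_Lp[OF f']] by (simp add: T_def)
    then have "norm (w f n) \<le> Lp_norm top UI (T f)"
      by (rule slot_AE_D) (simp add: n_def)
    moreover have "norm (w f n) = 1 + damp n"
    proof -
      have "w f n = of_real (1 + damp n)" by (simp add: w_def c_f b_f scaleR_conv_of_real)
      then show ?thesis using damp_pos[of n] by (simp only: norm_of_real)
    qed
    moreover have "1 - \<epsilon> < damp n" by (rule N) (simp add: n_def)
    ultimately have "2 - \<epsilon> < Lp_norm top UI (T f)" by simp
    then show "\<exists>f\<in>(Lp p :: (real \<Rightarrow> 'k) set). Lp_norm p UI f \<le> 1 \<and> 2 - \<epsilon> < Lp_norm top UI (T f)"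
      using f_ball by blast
  next
    fix F :: "nat \<Rightarrow> real \<Rightarrow> 'k"
    assume F: "\<And>n. F n \<in> Lp p \<and> Lp_norm p UI (F n) \<le> 1" and null: "(\<lambda>n. c (F n)) \<longlonglongrightarrow> 0"
    show "\<not> (\<lambda>n. Lp_norm top UI (T (F n))) \<longlonglongrightarrow> 2"
    proof
      assume lim: "(\<lambda>n. Lp_norm top UI (T (F n))) \<longlonglongrightarrow> 2"
      have "Lp_norm top UI (T (F n)) \<le> norm (c (F n)) + \<kappa>" for n
      proof (rule Lp_infinity_I(2)[OF T_meas AE_I2])
        have Fn: "F n \<in> unit_ball p" "F n \<in> Lp p" using F[of n] by auto
        show "norm (T (F n) t) \<le> norm (c (F n)) + \<kappa>" for t
          using w_le[of "F n" "slot t"] damp_b[of "slot t" "F n"] b_le[OF Fn(2), of "slot t"] half_le(2)[OF Fn(1)]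
          unfolding T_def by linarith
      qed
      moreover have "(\<lambda>n. norm (c (F n)) + \<kappa>) \<longlonglongrightarrow> 0 + \<kappa>"
        by (intro tendsto_add tendsto_norm_zero null tendsto_const)
      ultimately have "2 \<le> 0 + \<kappa>" by (intro LIMSEQ_le[OF lim]) auto
      then show False using \<kappa> by simp
    qed
  qed
  then show ?thesis by (rule Lp_operator.not_WMP)
qed

section \<open>The ranges of exponents put together\<close>

lemma not_WMP_Lp:
  fixes p q :: ennreal
  assumes p: "1 \<le> p" and q: "1 \<le> q" and pq: "p > 2 \<or> q < 2"
  shows "\<not> WMP (Lp_unit_interval p :: ('k::{real_normed_field, euclidean_space}, (real \<Rightarrow> 'k) set) nspace)
      (Lp_unit_interval q :: ('k, (real \<Rightarrow> 'k) set) nspace)"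
proof (cases "p = 1")
  case True
  then show ?thesis using not_WMP_L1[OF q] by simp
next
  case False
  then have p1: "1 < p" using p by simp
  from q show ?thesis
  proof (cases rule: exponent_cases)
    case 1
    then show ?thesis using not_WMP_infinite_range[OF p1] by simp
  next
    case q': (2 s)
    from p show ?thesis
    proof (cases rule: exponent_cases)
      case 1
      then show ?thesis using not_WMP_infinite_domain[OF q'(2)] q'(1) by simp
    next
      case p': (2 r)
      have r: "1 < r" using p1 p' by (cases "r = 1") auto
      show ?thesis
      proof (cases "s < 2")
        case True
        then show ?thesis using not_WMP_small_range[OF q'(2) True r] p' q' by simp
      next
        case False
        have "\<not> q < 2" using False q' ennreal_leI[of 2 s] by auto
        then have "2 < r" using pq p' ennreal_leI[of r 2] by (auto simp: not_less[symmetric])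
        then show ?thesis using not_WMP_exponents_ge_2[OF p1 _ p'(1), of s] False q'(1) by simp
      qed
    qed
  qed
qed

theorem theorem2p4:
  fixes p q :: ennreal
  assumes "1 \<le> p" and "1 \<le> q"
    and "p > 2 \<or> q < 2"
  shows "\<not> WMP (Lp_unit_interval p :: (real, (real \<Rightarrow> real) set) nspace)
               (Lp_unit_interval q :: (real, (real \<Rightarrow> real) set) nspace) \<and>
         \<not> WMP (Lp_unit_interval p :: (complex, (real \<Rightarrow> complex) set) nspace)
               (Lp_unit_interval q :: (complex, (real \<Rightarrow> complex) set) nspace)"
  using not_WMP_Lp[OF assms, where 'k = real] not_WMP_Lp[OF assms, where 'k = complex] by (rule conjI)

end
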